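(* Let $\Omega\subset\mathbb{R}^d$ be a bounded domain with smooth boundary, let $\rho\in C^\infty(\bar\Omega)$ be strictly positive, and put $p:=\rho/\int_\Omega\rho\,dx$. Let $q_0$ be a strictly positive probability density on $\Omega$ such that $\omega_0:=\log\rho-\log q_0\in C^{0,1}(\bar\Omega)$, let $(\omega,\phi)$ be the corresponding unique global solution of the WLF system with initial datum $\omega_0$ (see context), and let $q_t$ be the density transported from $q_0$ by the velocity $v=\nabla\phi$, i.e. $\partial_tq+\nabla\cdot(qv)=0$. Then $$\frac{d}{dt}\mathrm{KL}(q_t\,\|\,p)=-\mathrm{KL}(q_t\,\|\,p)-\mathrm{KL}(p\,\|\,q_t).$$ Consequently, $$\mathrm{KL}(q_t\,\|\,p)\le e^{-t}\,\mathrm{KL}(q_0\,\|\,p)\qquad(t\ge0),$$ and for every $T>0$, $$\int_0^T\bigl[\mathrm{KL}(q_t\,\|\,p)+\mathrm{KL}(p\,\|\,q_t)\bigr]\,dt=\mathrm{KL}(q_0\,\|\,p)-\mathrm{KL}(q_T\,\|\,p).$$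
   Context: WLF system. A global solution with initial datum $\omega_0$ is a pair of functions $\omega,\phi$ on $[0,\infty)\times\bar\Omega$, together with the scalar function $\bar\omega(t)$ and the flow $X(t,x)$ of $\nabla\phi$, such that for all $t\ge0$: (1) $\frac1\rho\nabla\cdot(\rho\nabla\phi)=-(\omega-\bar\omega)$ in $\Omega$; (2) $\frac{d}{dt}\omega(t,X(t,x))=-(\omega(t,X(t,x))-\bar\omega(t))$ for every $x\in\bar\Omega$; (3) $\frac{d}{dt}X(t,x)=\nabla\phi(t,X(t,x))$, $X(0,x)=x$; (4) $\partial\phi/\partial n=0$ on $\partial\Omega$; (5) $\int_\Omega\rho(x)(\omega(t,x)-\bar\omega(t))\,dx=0$ and $\int_\Omega\phi(t,x)\,dx=0$; and $\omega(0,\cdot)=\omega_0$. The solution considered is the unique one with, for every $T<\infty$ and every $\alpha\in(0,1)$, $\omega\in L^\infty([0,T];C^{0,1}(\bar\Omega))\cap C([0,T];C^{0,\alpha}(\bar\Omega))$ and $\phi\in L^\infty([0,T];C^{2,\alpha}(\bar\Omega))\cap C([0,T];C^{2,\alpha}(\bar\Omega))$; it exists for every $\omega_0\in C^{0,1}(\bar\Omega)$. One has $\omega(t,x)=\log(\rho(x)/q_t(x))$. Transport of $q_0$ by $v$ means $q_t=X(t,\cdot)_\#q_0$ (pushforward of densities). Notation: $\mathrm{KL}(f\,\|\,g)=\int_\Omega f\log(f/g)\,dx$. *)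

theory Defs
  imports "HOL-Probability.Probability"
begin

section \<open>Differential operators\<close>

definition partial_deriv :: "'a::euclidean_space \<Rightarrow> ('a \<Rightarrow> real) \<Rightarrow> 'a \<Rightarrow> real" where
  "partial_deriv b f x = frechet_derivative f (at x) b"

primrec partial_derivs :: "'a::euclidean_space list \<Rightarrow> ('a \<Rightarrow> real) \<Rightarrow> 'a \<Rightarrow> real" where
  "partial_derivs [] f = f"
| "partial_derivs (b # bs) f = partial_deriv b (partial_derivs bs f)"

definition gradient :: "('a::euclidean_space \<Rightarrow> real) \<Rightarrow> 'a \<Rightarrow> 'a" where
  "gradient f x = (\<Sum>b\<in>Basis. partial_deriv b f x *\<^sub>R b)"

definition divergence :: "('a::euclidean_space \<Rightarrow> 'a) \<Rightarrow> 'a \<Rightarrow> real" where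
  "divergence V x = (\<Sum>b\<in>Basis. frechet_derivative V (at x) b \<bullet> b)"

text \<open>The gradient on the closure of an open set, extended to the boundary by continuity; for
  functions that are C1 up to the boundary the limit exists and is the gradient at interior points.\<close>

definition gradient_cl :: "'a::euclidean_space set \<Rightarrow> ('a \<Rightarrow> real) \<Rightarrow> 'a \<Rightarrow> 'a" where
  "gradient_cl \<Omega> f x = Lim (at x within \<Omega>) (gradient f)"


section \<open>Smooth functions and Hoelder spaces\<close>

definition Ck_on :: "nat \<Rightarrow> 'a::euclidean_space set \<Rightarrow> ('a \<Rightarrow> real) \<Rightarrow> bool" where
  "Ck_on k U f \<longleftrightarrow> (\<forall>bs. set bs \<subseteq> Basis \<longrightarrow>
     (length bs < k \<longrightarrow> partial_derivs bs f differentiable_on U) \<and>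
     (length bs \<le> k \<longrightarrow> continuous_on U (partial_derivs bs f)))"

definition smooth_on :: "'a::euclidean_space set \<Rightarrow> ('a \<Rightarrow> real) \<Rightarrow> bool" where
  "smooth_on U f \<longleftrightarrow> (\<forall>k. Ck_on k U f)"

text \<open>Functions on the closure of the open set \<open>\<Omega>\<close> whose derivatives up to order \<open>k\<close> in \<open>\<Omega>\<close>
  extend continuously to the closure.\<close>

definition Ck_closure :: "nat \<Rightarrow> 'a::euclidean_space set \<Rightarrow> ('a \<Rightarrow> real) \<Rightarrow> bool" where
  "Ck_closure k \<Omega> f \<longleftrightarrow> Ck_on k \<Omega> f \<and> continuous_on (closure \<Omega>) f \<and>
     (\<forall>bs. set bs \<subseteq> Basis \<longrightarrow> length bs \<le> k \<longrightarrow>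
        (\<exists>g. continuous_on (closure \<Omega>) g \<and> (\<forall>x\<in>\<Omega>. g x = partial_derivs bs f x)))"

definition smooth_closure :: "'a::euclidean_space set \<Rightarrow> ('a \<Rightarrow> real) \<Rightarrow> bool" where
  "smooth_closure \<Omega> f \<longleftrightarrow> (\<forall>k. Ck_closure k \<Omega> f)"

text \<open>The norm of \<open>C\<^sup>k\<^sup>,\<^sup>\<alpha>\<close> on the closure of \<open>\<Omega>\<close>; it is infinite exactly for the functions outside
  this space.  The sums range over lists of basis vectors rather than multi-indices, so mixed
  derivatives are counted with multiplicity, which gives an equivalent norm.  Suprema over \<open>\<Omega>\<close> and
  over its closure agree, by continuity.\<close>

definition hoelder_norm :: "nat \<Rightarrow> real \<Rightarrow> 'a::euclidean_space set \<Rightarrow> ('a \<Rightarrow> real) \<Rightarrow> ennreal" where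
  "hoelder_norm k \<alpha> \<Omega> f =
     (if Ck_closure k \<Omega> f then
        (\<Sum>bs | set bs \<subseteq> Basis \<and> length bs \<le> k. SUP x\<in>\<Omega>. ennreal \<bar>partial_derivs bs f x\<bar>) +
        (\<Sum>bs | set bs \<subseteq> Basis \<and> length bs = k.
           SUP (x, y)\<in>{(x, y). x \<in> \<Omega> \<and> y \<in> \<Omega> \<and> x \<noteq> y}.
             ennreal (\<bar>partial_derivs bs f x - partial_derivs bs f y\<bar> / dist x y powr \<alpha>))
      else \<infinity>)"

definition hoelder_space :: "nat \<Rightarrow> real \<Rightarrow> 'a::euclidean_space set \<Rightarrow> ('a \<Rightarrow> real) set" where
  "hoelder_space k \<alpha> \<Omega> = {f. hoelder_norm k \<alpha> \<Omega> f < \<infinity>}"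


section \<open>Time-dependent functions with values in a normed function space\<close>

text \<open>The space is given by its norm \<open>N\<close>, with value \<open>\<infinity>\<close> outside the space.  In
  \<open>Linfty_time\<close> no measurability in time is demanded: it is only used for functions that are
  also continuous in time with values in a larger space.\<close>

definition Linfty_time :: "real \<Rightarrow> (('a \<Rightarrow> real) \<Rightarrow> ennreal) \<Rightarrow> (real \<Rightarrow> 'a \<Rightarrow> real) \<Rightarrow> bool" where
  "Linfty_time T N u \<longleftrightarrow> (\<exists>C::real. AE t in lebesgue_on {0..T}. N (u t) \<le> ennreal C)"

definition cont_time :: "real \<Rightarrow> (('a \<Rightarrow> real) \<Rightarrow> ennreal) \<Rightarrow> (real \<Rightarrow> 'a \<Rightarrow> real) \<Rightarrow> bool" where
  "cont_time T N u \<longleftrightarrow> (\<forall>t\<in>{0..T}. N (u t) < \<infinity> \<and>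
     ((\<lambda>s. N (\<lambda>x. u s x - u t x)) \<longlongrightarrow> 0) (at t within {0..T}))"


section \<open>Bounded domains with smooth boundary\<close>

definition local_defining_function ::
    "'a::euclidean_space set \<Rightarrow> 'a \<Rightarrow> 'a set \<Rightarrow> ('a \<Rightarrow> real) \<Rightarrow> bool" where
  "local_defining_function \<Omega> z U g \<longleftrightarrow> open U \<and> z \<in> U \<and> smooth_on U g \<and>
     (\<forall>y\<in>U. gradient g y \<noteq> 0) \<and> \<Omega> \<inter> U = {y\<in>U. g y < 0}"

definition smooth_bounded_domain :: "'a::euclidean_space set \<Rightarrow> bool" where
  "smooth_bounded_domain \<Omega> \<longleftrightarrow> open \<Omega> \<and> connected \<Omega> \<and> \<Omega> \<noteq> {} \<and> bounded \<Omega> \<and>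
     (\<forall>z\<in>frontier \<Omega>. \<exists>U g. local_defining_function \<Omega> z U g)"

definition outward_normal :: "'a::euclidean_space set \<Rightarrow> 'a \<Rightarrow> 'a \<Rightarrow> bool" where
  "outward_normal \<Omega> z n \<longleftrightarrow>
     (\<exists>U g. local_defining_function \<Omega> z U g \<and> n = gradient g z /\<^sub>R norm (gradient g z))"


section \<open>The WLF system\<close>

definition wlf_system ::
    "'a::euclidean_space set \<Rightarrow> ('a \<Rightarrow> real) \<Rightarrow> ('a \<Rightarrow> real) \<Rightarrow>
     (real \<Rightarrow> 'a \<Rightarrow> real) \<Rightarrow> (real \<Rightarrow> 'a \<Rightarrow> real) \<Rightarrow> (real \<Rightarrow> real) \<Rightarrow> (real \<Rightarrow> 'a \<Rightarrow> 'a) \<Rightarrow> bool" where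
  "wlf_system \<Omega> \<rho> \<omega>0 \<omega> \<phi> \<omega>bar X \<longleftrightarrow>
     (\<forall>x\<in>closure \<Omega>. \<omega> 0 x = \<omega>0 x) \<and>
     (\<forall>x\<in>closure \<Omega>. X 0 x = x) \<and>
     (\<forall>t\<ge>0.
        (\<forall>x\<in>\<Omega>. 1 / \<rho> x * divergence (\<lambda>y. \<rho> y *\<^sub>R gradient (\<phi> t) y) x = - (\<omega> t x - \<omega>bar t)) \<and>
        (\<forall>x\<in>closure \<Omega>. X t x \<in> closure \<Omega> \<and>
           ((\<lambda>s. \<omega> s (X s x)) has_real_derivative - (\<omega> t (X t x) - \<omega>bar t)) (at t within {0..}) \<and>
           ((\<lambda>s. X s x) has_vector_derivative gradient_cl \<Omega> (\<phi> t) (X t x)) (at t within {0..})) \<and>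
        (\<forall>z\<in>frontier \<Omega>. \<forall>n. outward_normal \<Omega> z n \<longrightarrow> gradient_cl \<Omega> (\<phi> t) z \<bullet> n = 0) \<and>
        (LINT x:\<Omega>|lborel. \<rho> x * (\<omega> t x - \<omega>bar t)) = 0 \<and>
        (LINT x:\<Omega>|lborel. \<phi> t x) = 0)"

definition wlf_regular ::
    "'a::euclidean_space set \<Rightarrow> (real \<Rightarrow> 'a \<Rightarrow> real) \<Rightarrow> (real \<Rightarrow> 'a \<Rightarrow> real) \<Rightarrow> bool" where
  "wlf_regular \<Omega> \<omega> \<phi> \<longleftrightarrow> (\<forall>T>0. \<forall>\<alpha>\<in>{0<..<1}.
     Linfty_time T (hoelder_norm 0 1 \<Omega>) \<omega> \<and> cont_time T (hoelder_norm 0 \<alpha> \<Omega>) \<omega> \<and>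
     Linfty_time T (hoelder_norm 2 \<alpha> \<Omega>) \<phi> \<and> cont_time T (hoelder_norm 2 \<alpha> \<Omega>) \<phi>)"


section \<open>Densities on a domain, push-forward and relative entropy\<close>

definition pos_prob_density_on :: "'a::euclidean_space set \<Rightarrow> ('a \<Rightarrow> real) \<Rightarrow> bool" where
  "pos_prob_density_on \<Omega> f \<longleftrightarrow> (\<forall>x\<in>\<Omega>. 0 < f x) \<and>
     set_integrable lborel \<Omega> f \<and> (LINT x:\<Omega>|lborel. f x) = 1"

text \<open>\<open>g\<close> is the density on \<open>\<Omega>\<close> of the push-forward under \<open>F\<close> of the measure on \<open>\<Omega>\<close> with density
  \<open>f\<close>.  The target is the whole space, as \<open>F\<close> is only known to map \<open>\<Omega>\<close> into its closure.\<close>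

definition pushforward_density ::
    "'a::euclidean_space set \<Rightarrow> ('a \<Rightarrow> 'a) \<Rightarrow> ('a \<Rightarrow> real) \<Rightarrow> ('a \<Rightarrow> real) \<Rightarrow> bool" where
  "pushforward_density \<Omega> F f g \<longleftrightarrow> (\<forall>x\<in>\<Omega>. 0 \<le> g x) \<and>
     distributed (density (restrict_space lborel \<Omega>) (\<lambda>x. ennreal (f x))) lborel F
       (\<lambda>y. ennreal (g y) * indicator \<Omega> y)"

definition KL :: "'a::euclidean_space set \<Rightarrow> ('a \<Rightarrow> real) \<Rightarrow> ('a \<Rightarrow> real) \<Rightarrow> real" where
  "KL \<Omega> f g = (LINT x:\<Omega>|lborel. f x * ln (f x / g x))"

text \<open>Finiteness of \<open>KL \<Omega> f g\<close>: the defining integral converges, so that it is not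
  the default value 0 of the Bochner integral.\<close>

definition KL_finite :: "'a::euclidean_space set \<Rightarrow> ('a \<Rightarrow> real) \<Rightarrow> ('a \<Rightarrow> real) \<Rightarrow> bool" where
  "KL_finite \<Omega> f g \<longleftrightarrow> set_integrable lborel \<Omega> (\<lambda>x. f x * ln (f x / g x))"

end

theory Submission
  imports Defs "HOL-Complex_Analysis.Great_Picard"
begin

text \<open>
  Let \<open>r\<^sub>t = \<rho> exp (-\<omega>\<^sub>t)\<close>.  The system gives \<open>d/dt log r\<^sub>t(X\<^sub>t x) = -div v(X\<^sub>t x)\<close>, while Liouville's
  formula gives \<open>d/dt log det DX\<^sub>t(x) = div v(X\<^sub>t x)\<close>; hence \<open>det DX\<^sub>t \<cdot> r\<^sub>t \<circ> X\<^sub>t = q\<^sub>0\<close>.  As \<open>X\<^sub>t\<close> is a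
  bijection of \<open>\<Omega>\<close> (trajectories cannot reach or leave the boundary because \<open>v\<close> is tangential there),
  the change of variables formula identifies \<open>q\<^sub>t\<close> with \<open>r\<^sub>t\<close> almost everywhere.  Writing
  \<open>Z = \<integral>\<rho>\<close>, this yields \<open>KL(q\<^sub>t, p) = log Z - \<integral> q\<^sub>0 \<omega>\<^sub>t(X\<^sub>t)\<close> and
  \<open>KL(p, q\<^sub>t) = \<omega>bar(t) - log Z\<close>, and the claim follows from the equation for \<open>\<omega>\<close> along trajectories.
\<close>

section \<open>Differential inequalities and linear equations\<close>

text \<open>Uniqueness is established only for interior trajectories. The field is C1 up to the
  boundary, but \<Omega> need not be convex, so the mean value inequality is applied only on balls
  inside \<Omega>. Invariance of the interior therefore has to precede uniqueness, and it rests on a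
  Gronwall argument for a local defining function along the curve. The flow \<open>X\<close> is
  given by the system, and nothing about its dependence on the initial point is known in advance:
  injectivity, surjectivity and differentiability are derived, surjectivity by compactness and
  connectedness in place of backward solutions. Push-forward fixes \<open>q t\<close> only up to
  null sets, which the integrals in \<open>KL\<close> do not see; pointwise work is done with the
  continuous function \<open>r t\<close>. No differentiation under the integral occurs: differences
  of \<open>\<omega>\<close> along two trajectories solve a linear equation, which reduces the mean
  of \<open>\<omega>\<close> to a single trajectory. The dissipation is not shown to be continuous
  in time, so its integrability needs nonnegativity and measurability arguments of its own.\<close>

lemma gronwall_norm:
  fixes f f' :: "real \<Rightarrow> 'a::real_inner"
  assumes deriv: "\<And>s. s \<in> {a..b} \<Longrightarrow> (f has_vector_derivative f' s) (at s within {a..b})"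
    and bound: "\<And>s. s \<in> {a..b} \<Longrightarrow> norm (f' s) \<le> C * norm (f s) + e"
    and "0 \<le> C" "0 \<le> e" "a \<le> b"
  shows "norm (f b) \<le> (norm (f a) + e * (b - a)) * exp (C * (b - a))"
proof -
  have cont: "continuous_on {a..b} f"
    using deriv by (meson continuous_on_eq_continuous_within has_vector_derivative_continuous)
  have approx: "norm (f b) \<le> (norm (f a) + \<eta> + e * (b - a)) * exp (C * (b - a))" if "\<eta> > 0" for \<eta>
  proof -
    \<comment> \<open>The norm is not differentiable at 0, so it is replaced by \<open>w\<close>,
      and \<eta> tends to 0 at the end. The function \<open>h\<close> is nonincreasing because the
      derivative of \<open>w\<close> is at most \<open>C * w + e\<close> and the exponential factor
      is at most 1, so the error contributes at most \<open>e\<close> per unit time.\<close>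
    define w where "w s = sqrt (f s \<bullet> f s + \<eta>\<^sup>2)" for s
    define h where "h s = w s * exp (- (C * (s - a))) - e * (s - a)" for s
    have pos: "0 < f s \<bullet> f s + \<eta>\<^sup>2" for s
      using that by (simp add: add_nonneg_pos)
    then have wpos: "0 < w s" for s
      unfolding w_def by simp
    have wnorm: "norm (f s) \<le> w s" for s
      unfolding w_def norm_eq_sqrt_inner by (simp add: real_sqrt_le_mono)
    have "h a \<ge> h b"
    proof (rule DERIV_nonpos_imp_decreasing_open[OF \<open>a \<le> b\<close>])
      show "continuous_on {a..b} h"
        unfolding h_def w_def by (intro continuous_intros cont)
    next
      fix s assume s: "a < s" "s < b"
      then have "(f has_vector_derivative f' s) (at s)"
        using deriv[of s] at_within_Icc_at[of a s b] by auto
      then have sq: "((\<lambda>s. f s \<bullet> f s + \<eta>\<^sup>2) has_real_derivative (2 * (f s \<bullet> f' s))) (at s)"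
        unfolding has_vector_derivative_def has_field_derivative_def
        by (auto intro!: derivative_eq_intros simp: fun_eq_iff inner_commute algebra_simps)
      have "(w has_real_derivative (2 * (f s \<bullet> f' s)) * (inverse (w s) / 2)) (at s)"
        unfolding w_def
        by (rule DERIV_chain2[OF DERIV_real_sqrt[OF pos[of s]] sq, THEN DERIV_cong]) simp
      then have "(h has_real_derivative
          ((f s \<bullet> f' s) / w s - C * w s) * exp (- (C * (s - a))) - e) (at s)"
        unfolding h_def by (auto intro!: derivative_eq_intros simp: field_simps)
      moreover have "((f s \<bullet> f' s) / w s - C * w s) * exp (- (C * (s - a))) - e \<le> 0"
      proof -
        have nb: "norm (f' s) \<le> C * w s + e"
          using bound[of s] s mult_left_mono[OF wnorm[of s] \<open>0 \<le> C\<close>] by simp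
        have "f s \<bullet> f' s \<le> norm (f s) * norm (f' s)"
          by (rule norm_cauchy_schwarz)
        also have "\<dots> \<le> w s * (C * w s + e)"
          using wnorm[of s] nb wpos[of s] by (intro mult_mono) auto
        finally have "(f s \<bullet> f' s) / w s - C * w s \<le> e"
          using wpos[of s] by (simp add: field_simps)
        then have "((f s \<bullet> f' s) / w s - C * w s) * exp (- (C * (s - a))) \<le> e * exp (- (C * (s - a)))"
          by (intro mult_right_mono) auto
        also have "\<dots> \<le> e * 1"
          using s \<open>0 \<le> C\<close> \<open>0 \<le> e\<close> by (intro mult_left_mono) auto
        finally show ?thesis by simp
      qed
      ultimately show "\<exists>y. (h has_real_derivative y) (at s) \<and> y \<le> 0"
        by blast
    qed
    then have "w b * exp (- (C * (b - a))) \<le> w a + e * (b - a)"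
      unfolding h_def by simp
    then have "w b * exp (- (C * (b - a))) * exp (C * (b - a)) \<le> (w a + e * (b - a)) * exp (C * (b - a))"
      by (rule mult_right_mono) simp
    then have "w b \<le> (w a + e * (b - a)) * exp (C * (b - a))"
      by (simp add: mult.assoc flip: exp_add)
    also have "w a \<le> norm (f a) + \<eta>"
      unfolding w_def norm_eq_sqrt_inner
      using sqrt_add_le_add_sqrt[of "f a \<bullet> f a" "\<eta>\<^sup>2"] that by simp
    finally show ?thesis
      using wnorm[of b] by (simp add: mult_right_mono)
  qed
  have "((\<lambda>\<eta>. (norm (f a) + \<eta> + e * (b - a)) * exp (C * (b - a)))
      \<longlongrightarrow> (norm (f a) + 0 + e * (b - a)) * exp (C * (b - a))) (at_right 0)"
    by (intro tendsto_intros)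
  then have "norm (f b) \<le> (norm (f a) + 0 + e * (b - a)) * exp (C * (b - a))"
    by (rule tendsto_lowerbound) (use approx in \<open>auto simp: eventually_at_right_less intro!: eventually_at_rightI[of 0 1]\<close>)
  then show ?thesis by simp
qed

text \<open>Times after \<open>s0\<close> are covered by the forward estimate with error 0. The
  bound on \<open>f'\<close> does not see the direction of time, so earlier times follow by applying
  the same estimate to \<open>f (- \<tau>)\<close>.\<close>

lemma gronwall_zero:
  fixes f f' :: "real \<Rightarrow> 'a::real_inner"
  assumes deriv: "\<And>s. s \<in> {a..b} \<Longrightarrow> (f has_vector_derivative f' s) (at s within {a..b})"
    and bound: "\<And>s. s \<in> {a..b} \<Longrightarrow> norm (f' s) \<le> C * norm (f s)"
    and "0 \<le> C" and s0: "s0 \<in> {a..b}" "f s0 = 0" and s: "s \<in> {a..b}"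
  shows "f s = 0"
proof (cases "s0 \<le> s")
  case True
  have "norm (f s) \<le> (norm (f s0) + 0 * (s - s0)) * exp (C * (s - s0))"
  proof (rule gronwall_norm)
    fix \<tau> assume "\<tau> \<in> {s0..s}"
    then have "\<tau> \<in> {a..b}" using s s0 by auto
    then show "(f has_vector_derivative f' \<tau>) (at \<tau> within {s0..s})"
      "norm (f' \<tau>) \<le> C * norm (f \<tau>) + 0"
      using bound deriv[of \<tau>] s s0 by (auto elim!: has_vector_derivative_within_subset)
  qed (use \<open>0 \<le> C\<close> True in auto)
  then show ?thesis using s0 by simp
next
  case False
  have "norm ((\<lambda>\<tau>. f (- \<tau>)) (- s)) \<le> (norm ((\<lambda>\<tau>. f (- \<tau>)) (- s0)) + 0 * ((- s) - (- s0))) * exp (C * ((- s) - (- s0)))"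
  proof (rule gronwall_norm)
    fix \<tau> assume \<tau>: "\<tau> \<in> {- s0.. - s}"
    then have m: "- \<tau> \<in> {a..b}" using s s0 by auto
    have "((f \<circ> uminus) has_vector_derivative ((-1) *\<^sub>R f' (- \<tau>))) (at \<tau> within {- s0.. - s})"
    proof (rule vector_diff_chain_within)
      show "(uminus has_vector_derivative - 1) (at \<tau> within {- s0..- s})"
        by (auto intro!: derivative_eq_intros)
      show "(f has_vector_derivative f' (- \<tau>)) (at (- \<tau>) within uminus ` {- s0..- s})"
        using deriv[OF m] s s0 by (auto elim!: has_vector_derivative_within_subset)
    qed
    then show "((\<lambda>\<tau>. f (- \<tau>)) has_vector_derivative (- f' (- \<tau>))) (at \<tau> within {- s0.. - s})"
      by (simp add: o_def)
    show "norm (- f' (- \<tau>)) \<le> C * norm (f (- \<tau>)) + 0"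
      using bound[OF m] by simp
  qed (use \<open>0 \<le> C\<close> False in auto)
  then show ?thesis using s0 by simp
qed

text \<open>Connectedness of the interval. It globalises arguments whose Gronwall estimate is
  available only locally: in a chart near the boundary, or in a ball inside the domain.\<close>

lemma interval_clopen_induct:
  fixes a b :: real
  assumes "closed {s\<in>{a..b}. P s}" and s0: "s0 \<in> {a..b}" "P s0"
    and nbhd: "\<And>s. s \<in> {a..b} \<Longrightarrow> P s \<Longrightarrow> \<exists>d>0. \<forall>s'\<in>{a..b}. \<bar>s' - s\<bar> \<le> d \<longrightarrow> P s'"
    and s: "s \<in> {a..b}"
  shows "P s"
proof -
  let ?S = "{s\<in>{a..b}. P s}"
  have "openin (top_of_set {a..b}) ?S"
    unfolding openin_euclidean_subtopology_iff
  proof (intro conjI ballI)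
    fix x assume "x \<in> ?S"
    then obtain d where "d > 0" "\<forall>s'\<in>{a..b}. \<bar>s' - x\<bar> \<le> d \<longrightarrow> P s'"
      using nbhd by blast
    then show "\<exists>e>0. \<forall>x'\<in>{a..b}. dist x' x < e \<longrightarrow> x' \<in> ?S"
      by (intro exI[of _ d]) (auto simp: dist_real_def)
  qed auto
  moreover have "closedin (top_of_set {a..b}) ?S"
    using assms(1) by (intro closed_subset) auto
  moreover have "connected {a..b}"
    by (rule convex_connected) simp
  ultimately have "?S = {} \<or> ?S = {a..b}"
    unfolding connected_clopen by blast
  then show ?thesis using s0 s by blast
qed

section \<open>Existence for linear equations and Jacobi's formula\<close>

text \<open>Picard iteration for the integral equation. The increment \<open>Z (Suc k) - Z k\<close>
  is of size \<open>(K * s) ^ Suc k / fact (Suc k)\<close>, so the telescoping series is dominated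
  by an exponential series and converges on all of \<open>{0..T}\<close>, without shrinking the
  interval. The solutions become the columns of the derivative of the flow.\<close>

lemma linear_ode_exists:
  fixes A :: "real \<Rightarrow> 'a::euclidean_space \<Rightarrow>\<^sub>L 'a"
  assumes contA: "continuous_on {0..T} A" and "0 \<le> T"
  obtains z where "z 0 = e"
    "\<And>s. s \<in> {0..T} \<Longrightarrow> (z has_vector_derivative A s (z s)) (at s within {0..T})"
proof -
  obtain K where K: "K \<ge> 0" "\<And>s. s \<in> {0..T} \<Longrightarrow> norm (A s) \<le> K"
  proof -
    have "bounded (A ` {0..T})"
      by (intro compact_imp_bounded compact_continuous_image contA) simp
    then show thesis using that unfolding bounded_pos by (meson imageI less_imp_le)
  qed
  define Z where "Z = rec_nat (\<lambda>_. e) (\<lambda>_ z s. e + integral {0..s} (\<lambda>\<tau>. A \<tau> (z \<tau>)))"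
  have Z0: "Z 0 = (\<lambda>_. e)" and ZS: "Z (Suc k) = (\<lambda>s. e + integral {0..s} (\<lambda>\<tau>. A \<tau> (Z k \<tau>)))" for k
    unfolding Z_def by simp_all
  have contAz: "continuous_on {0..T} (\<lambda>\<tau>. A \<tau> (z \<tau>))" if "continuous_on {0..T} z" for z
    by (intro continuous_intros contA that)
  have contZ: "continuous_on {0..T} (Z k)" for k
  proof (induction k)
    case (Suc k)
    show ?case unfolding ZS
      by (intro continuous_intros indefinite_integral_continuous_1 integrable_continuous_interval contAz Suc)
  qed (simp add: Z0)
  have int: "(\<lambda>\<tau>. A \<tau> (z \<tau>)) integrable_on {0..s}" if "continuous_on {0..T} z" "s \<in> {0..T}" for z s
    by (rule integrable_continuous_interval, rule continuous_on_subset[OF contAz]) (use that in auto)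
  have step: "norm (Z (Suc k) s - Z k s) \<le> norm e * (K * s) ^ Suc k / fact (Suc k)" if "s \<in> {0..T}" for k s
    using that
  proof (induction k arbitrary: s)
    case 0
    have "norm (integral {0..s} (\<lambda>\<tau>. A \<tau> e)) \<le> (K * norm e) * (s - 0)"
    proof (rule integral_bound)
      show "continuous_on {0..s} (\<lambda>\<tau>. A \<tau> e)"
        using continuous_on_subset[OF contAz[of "\<lambda>_. e"]] 0 by auto
      fix t assume "t \<in> {0..s}"
      then show "norm (A t e) \<le> K * norm e"
        using K(2)[of t] 0 norm_blinfun[of "A t" e] mult_right_mono[of "norm (A t)" K "norm e"] by auto
    qed (use 0 in auto)
    then show ?case by (simp add: ZS Z0 algebra_simps)
  next
    case (Suc k)
    have "Z (Suc (Suc k)) s - Z (Suc k) s =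
        integral {0..s} (\<lambda>\<tau>. A \<tau> (Z (Suc k) \<tau>)) - integral {0..s} (\<lambda>\<tau>. A \<tau> (Z k \<tau>))"
      unfolding ZS[of "Suc k"] ZS[of k] by simp
    also have "\<dots> = integral {0..s} (\<lambda>\<tau>. A \<tau> (Z (Suc k) \<tau>) - A \<tau> (Z k \<tau>))"
      by (rule Henstock_Kurzweil_Integration.integral_diff[symmetric]; intro int contZ Suc.prems)
    also have "norm \<dots> \<le> integral {0..s} (\<lambda>\<tau>. norm e * K ^ Suc (Suc k) / fact (Suc k) * \<tau> ^ Suc k)"
    proof (rule integral_norm_bound_integral)
      show "(\<lambda>\<tau>. A \<tau> (Z (Suc k) \<tau>) - A \<tau> (Z k \<tau>)) integrable_on {0..s}"
        by (intro Henstock_Kurzweil_Integration.integrable_diff int contZ Suc.prems)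
      show "(\<lambda>\<tau>. norm e * K ^ Suc (Suc k) / fact (Suc k) * \<tau> ^ Suc k) integrable_on {0..s}"
        by (intro integrable_continuous_interval continuous_intros)
      fix \<tau> assume \<tau>: "\<tau> \<in> {0..s}"
      then have "norm (A \<tau> (Z (Suc k) \<tau>) - A \<tau> (Z k \<tau>)) \<le> norm (A \<tau>) * norm (Z (Suc k) \<tau> - Z k \<tau>)"
        by (simp flip: blinfun.diff_right add: norm_blinfun)
      also have "\<dots> \<le> K * (norm e * (K * \<tau>) ^ Suc k / fact (Suc k))"
        using \<tau> Suc K by (intro mult_mono) auto
      finally show "norm (A \<tau> (Z (Suc k) \<tau>) - A \<tau> (Z k \<tau>)) \<le> norm e * K ^ Suc (Suc k) / fact (Suc k) * \<tau> ^ Suc k"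
        by (simp add: power_mult_distrib algebra_simps)
    qed
    also have "integral {0..s} (\<lambda>\<tau>. norm e * K ^ Suc (Suc k) / fact (Suc k) * \<tau> ^ Suc k) =
       norm e * K ^ Suc (Suc k) / fact (Suc k) * (s ^ Suc (Suc k) / real (Suc (Suc k)))"
    proof -
      have "((\<lambda>\<tau>. \<tau> ^ Suc k) has_integral (s ^ Suc (Suc k) / real (Suc (Suc k)) - 0 ^ Suc (Suc k) / real (Suc (Suc k)))) {0..s}"
      proof (rule fundamental_theorem_of_calculus)
        fix x :: real
        have "((\<lambda>\<tau>. \<tau> ^ Suc (Suc k) / real (Suc (Suc k))) has_real_derivative
            (real (Suc (Suc k)) * x ^ (Suc (Suc k) - Suc 0)) / real (Suc (Suc k))) (at x within {0..s})"
          by (intro DERIV_cdivide DERIV_pow)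
        then show "((\<lambda>\<tau>. \<tau> ^ Suc (Suc k) / real (Suc (Suc k))) has_vector_derivative x ^ Suc k) (at x within {0..s})"
          by (simp flip: has_real_derivative_iff_has_vector_derivative del: of_nat_Suc)
      qed (use Suc.prems in auto)
      then show ?thesis by (simp add: integral_unique)
    qed
    also have "\<dots> = norm e * (K * s) ^ Suc (Suc k) / fact (Suc (Suc k))"
      by (simp add: power_mult_distrib field_simps)
    finally show ?case .
  qed
  have tele: "(\<Sum>k<n. Z (Suc k) s - Z k s) = Z n s - e" for n s
    using sum_lessThan_telescope[of "\<lambda>k. Z k s" n] by (simp add: Z0)
  have "uniform_limit {0..T} (\<lambda>n s. \<Sum>k<n. Z (Suc k) s - Z k s) (\<lambda>s. \<Sum>k. Z (Suc k) s - Z k s) sequentially"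
  proof (rule Weierstrass_m_test)
    show "norm (Z (Suc k) s - Z k s) \<le> norm e * ((K * T) ^ Suc k / fact (Suc k))" if "s \<in> {0..T}" for k s
    proof -
      have "norm e * (K * s) ^ Suc k / fact (Suc k) \<le> norm e * ((K * T) ^ Suc k / fact (Suc k))"
        using that K(1) by (auto intro!: mult_left_mono divide_right_mono power_mono simp del: power_Suc fact_Suc simp flip: times_divide_eq_right)
      then show ?thesis using step[OF that, of k] by linarith
    qed
    have "summable (\<lambda>k. (K * T) ^ k / fact k)"
      using summable_exp[of "K * T"] by (simp add: field_simps)
    then show "summable (\<lambda>k. norm e * ((K * T) ^ Suc k / fact (Suc k)))"
      by (intro summable_mult summable_Suc_iff[THEN iffD2])
  qed
  then have "uniform_limit {0..T} (\<lambda>n s. Z n s - e) (\<lambda>s. \<Sum>k. Z (Suc k) s - Z k s) sequentially"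
    by (simp only: tele)
  then have "uniform_limit {0..T} (\<lambda>n s. (Z n s - e) + e) (\<lambda>s. (\<Sum>k. Z (Suc k) s - Z k s) + e) sequentially"
    by (intro uniform_limit_intros)
  moreover define z where "z s = (\<Sum>k. Z (Suc k) s - Z k s) + e" for s
  ultimately have lim: "uniform_limit {0..T} Z z sequentially"
    by (simp add: z_def[abs_def])
  have contz: "continuous_on {0..T} z"
    using uniform_limit_theorem[OF _ lim] contZ by auto
  have bA: "bounded_bilinear (blinfun_apply :: ('a \<Rightarrow>\<^sub>L 'a) \<Rightarrow> 'a \<Rightarrow> 'a)"
    by (rule bounded_bilinear_blinfun_apply)
  have zeq: "z s = e + integral {0..s} (\<lambda>\<tau>. A \<tau> (z \<tau>))" if s: "s \<in> {0..T}" for s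
  proof -
    have "uniform_limit {0..T} (\<lambda>n \<tau>. A \<tau> (Z n \<tau>)) (\<lambda>\<tau>. A \<tau> (z \<tau>)) sequentially"
      by (rule bounded_bilinear.bounded_uniform_limit[OF bA uniform_limit_const lim])
         (intro compact_imp_bounded compact_continuous_image contA contz; simp)+
    then have "uniform_limit {0..s} (\<lambda>n \<tau>. A \<tau> (Z n \<tau>)) (\<lambda>\<tau>. A \<tau> (z \<tau>)) sequentially"
      by (rule uniform_limit_on_subset) (use s in auto)
    moreover have "continuous_on {0..s} (\<lambda>\<tau>. A \<tau> (Z n \<tau>))" for n
      using continuous_on_subset[OF contAz[OF contZ], of "{0..s}"] s by auto
    ultimately obtain I J where IJ: "\<And>n. ((\<lambda>\<tau>. A \<tau> (Z n \<tau>)) has_integral I n) {0..s}"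
      "((\<lambda>\<tau>. A \<tau> (z \<tau>)) has_integral J) {0..s}" "I \<longlonglongrightarrow> J"
      by (rule uniform_limit_integral) auto
    have "(\<lambda>n. integral {0..s} (\<lambda>\<tau>. A \<tau> (Z n \<tau>))) \<longlonglongrightarrow> integral {0..s} (\<lambda>\<tau>. A \<tau> (z \<tau>))"
      unfolding integral_unique[OF IJ(1)] integral_unique[OF IJ(2)] by (rule IJ(3))
    then have "(\<lambda>n. Z (Suc n) s) \<longlonglongrightarrow> e + integral {0..s} (\<lambda>\<tau>. A \<tau> (z \<tau>))"
      unfolding ZS by (intro tendsto_intros)
    moreover have "(\<lambda>n. Z (Suc n) s) \<longlonglongrightarrow> z s"
      using tendsto_uniform_limitI[OF lim s] by (rule LIMSEQ_Suc)
    ultimately show ?thesis by (simp add: LIMSEQ_unique)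
  qed
  show thesis
  proof (rule that[of z])
    show "z 0 = e" using zeq[of 0] \<open>0 \<le> T\<close> by simp
    fix s assume s: "s \<in> {0..T}"
    have "((\<lambda>s. e + integral {0..s} (\<lambda>\<tau>. A \<tau> (z \<tau>))) has_vector_derivative 0 + A s (z s)) (at s within {0..T})"
      by (intro has_vector_derivative_add has_vector_derivative_const integral_has_vector_derivative contAz contz s)
    then show "(z has_vector_derivative A s (z s)) (at s within {0..T})"
      unfolding add_0_left by (rule has_vector_derivative_transform[OF s, rotated]) (use zeq in auto)
  qed
qed

text \<open>Jacobi's formula for solutions of M' = A M; invertibility of M is never invoked. The
  product rule in the Leibniz expansion gives a sum of determinants in which row i is replaced by
  row i of A M. That row is a combination of the rows of M, and every term except the multiple of
  row i itself has a repeated row.\<close>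

lemma det_has_derivative_trace:
  fixes M :: "real \<Rightarrow> real^'n^'n" and A :: "real^'n^'n"
  assumes "\<And>i j. ((\<lambda>s. M s $ i $ j) has_real_derivative (A ** M s) $ i $ j) (at s within S)"
  shows "((\<lambda>s. det (M s)) has_real_derivative trace A * det (M s)) (at s within S)"
proof -
  let ?P = "{p. p permutes (UNIV::'n set)}"
  have prodD: "((\<lambda>s. \<Prod>i\<in>UNIV. M s $ i $ p i) has_real_derivative
      (\<Sum>i\<in>UNIV. (A ** M s) $ i $ p i * (\<Prod>j\<in>UNIV - {i}. M s $ j $ p j))) (at s within S)" for p
  proof -
    have "((\<lambda>s. \<Prod>i\<in>UNIV. M s $ i $ p i) has_derivative
        (\<lambda>y. \<Sum>i\<in>UNIV. ((A ** M s) $ i $ p i * y) * (\<Prod>j\<in>UNIV - {i}. M s $ j $ p j))) (at s within S)"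
      by (rule has_derivative_prod) (use assms in \<open>simp add: has_field_derivative_def\<close>)
    then show ?thesis
      unfolding has_field_derivative_def
      by (rule has_derivative_eq_rhs) (simp add: fun_eq_iff sum_distrib_left sum_distrib_right mult_ac)
  qed
  have rowdet: "det (\<chi> k. if k = i then c else M s $ k) =
      (\<Sum>p\<in>?P. of_int (sign p) * (c $ p i * (\<Prod>j\<in>UNIV - {i}. M s $ j $ p j)))" for i c
  proof -
    have "(\<Prod>k\<in>UNIV. (\<chi> k. if k = i then c else M s $ k) $ k $ p k) =
        c $ p i * (\<Prod>j\<in>UNIV - {i}. M s $ j $ p j)" for p
      by (subst prod.remove[of _ i]) (auto intro!: prod.cong)
    then show ?thesis unfolding det_def by simp
  qed
  have deriv: "((\<lambda>s. det (M s)) has_real_derivative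
     (\<Sum>p\<in>?P. of_int (sign p) * (\<Sum>i\<in>UNIV. (A ** M s) $ i $ p i * (\<Prod>j\<in>UNIV - {i}. M s $ j $ p j)))) (at s within S)"
    unfolding det_def by (intro DERIV_sum DERIV_cmult prodD)
  have "(\<Sum>p\<in>?P. of_int (sign p) * (\<Sum>i\<in>UNIV. (A ** M s) $ i $ p i * (\<Prod>j\<in>UNIV - {i}. M s $ j $ p j)))
      = (\<Sum>i\<in>UNIV. det (\<chi> k. if k = i then (A ** M s) $ i else M s $ k))"
    unfolding rowdet sum_distrib_left by (rule sum.swap)
  also have "\<dots> = (\<Sum>i\<in>UNIV. A $ i $ i * det (M s))"
  proof (rule sum.cong)
    fix i
    have row: "(A ** M s) $ i = (\<Sum>j\<in>UNIV. A $ i $ j *s M s $ j)"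
      by (simp add: vec_eq_iff matrix_matrix_mult_def)
    have "det (\<chi> k. if k = i then (A ** M s) $ i else M s $ k) =
      (\<Sum>j\<in>UNIV. det (\<chi> k. if k = i then A $ i $ j *s M s $ j else M s $ k))"
      unfolding row by (rule det_linear_row_sum) simp
    also have "\<dots> = (\<Sum>j\<in>UNIV. A $ i $ j * det (\<chi> k. if k = i then M s $ j else M s $ k))"
      by (intro sum.cong refl det_row_mul)
    also have "\<dots> = (\<Sum>j\<in>UNIV. if j = i then A $ i $ i * det (M s) else 0)"
    proof (intro sum.cong refl)
      fix j
      show "A $ i $ j * det (\<chi> k. if k = i then M s $ j else M s $ k) = (if j = i then A $ i $ i * det (M s) else 0)"
      proof (cases "j = i")
        case True
        then have "(\<chi> k. if k = i then M s $ j else M s $ k) = M s"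
          by (simp add: vec_eq_iff)
        then show ?thesis using True by simp
      next
        case False
        then have "det (\<chi> k. if k = i then M s $ j else M s $ k) = 0"
          by (intro det_identical_rows[of i j]) (auto simp: row_def)
        then show ?thesis using False by simp
      qed
    qed
    finally show "det (\<chi> k. if k = i then (A ** M s) $ i else M s $ k) = A $ i $ i * det (M s)" by simp
  qed simp
  also have "\<dots> = trace A * det (M s)"
    by (simp add: trace_def sum_distrib_right)
  finally show ?thesis using deriv by simp
qed

section \<open>Gradient, Hessian and their continuous extensions\<close>

lemma has_derivative_gradient:
  assumes "f differentiable (at x)"
  shows "(f has_derivative (\<lambda>u. gradient f x \<bullet> u)) (at x)"
proof -
  have der: "(f has_derivative frechet_derivative f (at x)) (at x)"
    using assms frechet_derivative_works by blast
  then interpret bounded_linear "frechet_derivative f (at x)"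
    by (rule has_derivative_bounded_linear)
  have "frechet_derivative f (at x) u = gradient f x \<bullet> u" for u
  proof -
    have "frechet_derivative f (at x) u = frechet_derivative f (at x) (\<Sum>b\<in>Basis. (u \<bullet> b) *\<^sub>R b)"
      by (simp add: euclidean_representation)
    also have "\<dots> = gradient f x \<bullet> u"
      unfolding sum scale gradient_def partial_deriv_def
      by (simp add: inner_sum_right inner_commute[of _ u] mult.commute)
    finally show ?thesis .
  qed
  then have "frechet_derivative f (at x) = (\<lambda>u. gradient f x \<bullet> u)" ..
  with der show ?thesis by simp
qed

definition rank_one :: "'a::euclidean_space \<Rightarrow> 'a \<Rightarrow> 'a \<Rightarrow>\<^sub>L 'a" where
  "rank_one c b = Blinfun (\<lambda>u. (u \<bullet> c) *\<^sub>R b)"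

lemma rank_one_apply [simp]: "blinfun_apply (rank_one c b) u = (u \<bullet> c) *\<^sub>R b"
  unfolding rank_one_def
  by (subst bounded_linear_Blinfun_apply) (auto intro!: bounded_linear_intros)

definition hessian :: "('a::euclidean_space \<Rightarrow> real) \<Rightarrow> 'a \<Rightarrow> 'a \<Rightarrow>\<^sub>L 'a" where
  "hessian f x = (\<Sum>b\<in>Basis. \<Sum>c\<in>Basis. partial_derivs [c, b] f x *\<^sub>R rank_one c b)"

lemma Ck_on_differentiable:
  assumes "Ck_on k U f" "open U" "x \<in> U" "set bs \<subseteq> Basis" "length bs < k"
  shows "partial_derivs bs f differentiable (at x)"
  using assms unfolding Ck_on_def differentiable_on_def by (metis at_within_open)

lemma has_derivative_gradient_hessian:
  assumes "Ck_on 2 U f" "open U" "x \<in> U"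
  shows "(gradient f has_derivative hessian f x) (at x)"
proof -
  have grad: "gradient f = (\<lambda>x. \<Sum>b\<in>Basis. partial_deriv b f x *\<^sub>R b)"
    by (rule ext) (rule gradient_def)
  have "(gradient f has_derivative
      (\<lambda>u. \<Sum>b\<in>Basis. (gradient (partial_deriv b f) x \<bullet> u) *\<^sub>R b)) (at x)"
    unfolding grad
  proof (intro has_derivative_sum has_derivative_scaleR_left)
    fix b :: 'a assume "b \<in> Basis"
    then show "(partial_deriv b f has_derivative (\<lambda>u. gradient (partial_deriv b f) x \<bullet> u)) (at x)"
      using Ck_on_differentiable[OF assms, where bs = "[b]"] by (intro has_derivative_gradient) auto
  qed
  moreover have "(\<Sum>b\<in>Basis. (gradient (partial_deriv b f) x \<bullet> u) *\<^sub>R b) = hessian f x u" for u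
    unfolding hessian_def gradient_def
    by (simp add: blinfun.sum_left blinfun.scaleR_left inner_sum_right scaleR_sum_left inner_commute[of _ u])
  ultimately show ?thesis by simp
qed

lemma Ck_on_continuous_gradient:
  assumes "Ck_on 2 U f"
  shows "continuous_on U f" "continuous_on U (gradient f)" "continuous_on U (hessian f)"
proof -
  have c: "continuous_on U (partial_derivs bs f)" if "set bs \<subseteq> Basis" "length bs \<le> 2" for bs
    using assms that unfolding Ck_on_def by blast
  show "continuous_on U f"
    using c[of "[]"] by simp
  have "continuous_on U (partial_deriv b f)" if "b \<in> Basis" for b
    using c[of "[b]"] that by simp
  then show "continuous_on U (gradient f)"
    unfolding gradient_def[abs_def] by (intro continuous_intros)
  show "continuous_on U (hessian f)"
    unfolding hessian_def[abs_def] by (intro continuous_intros c) auto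
qed

text \<open>\<open>frechet_derivative\<close> is additive only where both functions are
  differentiable. The induction carries the identity at all points of the open set, because
  differentiating once more requires it on a neighbourhood.\<close>

lemma partial_derivs_diff:
  assumes "Ck_on k U f" "Ck_on k U g" "open U" "set bs \<subseteq> Basis" "length bs \<le> k" "x \<in> U"
  shows "partial_derivs bs (\<lambda>x. f x - g x) x = partial_derivs bs f x - partial_derivs bs g x"
  using assms(4-6)
proof (induction bs arbitrary: x)
  case (Cons b bs)
  have "(partial_derivs bs f has_derivative frechet_derivative (partial_derivs bs f) (at x)) (at x)"
    "(partial_derivs bs g has_derivative frechet_derivative (partial_derivs bs g) (at x)) (at x)"
    using Ck_on_differentiable[OF assms(1,3)] Ck_on_differentiable[OF assms(2,3)] Cons.prems
    by (auto simp: frechet_derivative_works[symmetric])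
  then have "((\<lambda>y. partial_derivs bs f y - partial_derivs bs g y) has_derivative
      (\<lambda>h. frechet_derivative (partial_derivs bs f) (at x) h - frechet_derivative (partial_derivs bs g) (at x) h)) (at x)"
    by (rule has_derivative_diff)
  then have "(partial_derivs bs (\<lambda>x. f x - g x) has_derivative
      (\<lambda>h. frechet_derivative (partial_derivs bs f) (at x) h - frechet_derivative (partial_derivs bs g) (at x) h)) (at x)"
    by (rule has_derivative_transform_within_open[OF _ \<open>open U\<close> \<open>x \<in> U\<close>]) (use Cons in auto)
  from frechet_derivative_at[OF this, symmetric] show ?case
    by (simp add: partial_deriv_def)
qed simp

lemma hoelder_norm_ge_partial_derivs:
  fixes f :: "'a::euclidean_space \<Rightarrow> real"
  assumes "x \<in> \<Omega>" "set bs \<subseteq> Basis" "length bs \<le> k"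
  shows "ennreal \<bar>partial_derivs bs f x\<bar> \<le> hoelder_norm k \<alpha> \<Omega> f"
proof (cases "Ck_closure k \<Omega> f")
  case True
  have fin: "finite {bs :: 'a list. set bs \<subseteq> Basis \<and> length bs \<le> k}"
    by (rule finite_lists_length_le) simp
  have "ennreal \<bar>partial_derivs bs f x\<bar> \<le> (SUP x\<in>\<Omega>. ennreal \<bar>partial_derivs bs f x\<bar>)"
    using assms by (intro SUP_upper)
  also have "\<dots> \<le> (\<Sum>bs | set bs \<subseteq> Basis \<and> length bs \<le> k. SUP x\<in>\<Omega>. ennreal \<bar>partial_derivs bs f x\<bar>)"
    by (rule member_le_sum[OF _ _ fin, of bs]) (simp_all add: assms)
  finally show ?thesis
    unfolding hoelder_norm_def if_P[OF True] by (rule add_increasing2[OF zero_le])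
qed (simp add: hoelder_norm_def)

lemma hoelder_norm_finite_Ck_closure: "hoelder_norm k \<alpha> \<Omega> f < \<infinity> \<Longrightarrow> Ck_closure k \<Omega> f"
  unfolding hoelder_norm_def by (auto split: if_splits)

lemma closure_abs_diff_le:
  fixes g h :: "'a::topological_space \<Rightarrow> real"
  assumes "continuous_on (closure S) g" "continuous_on (closure S) h"
    and "\<And>x. x \<in> S \<Longrightarrow> \<bar>g x - h x\<bar> \<le> e" "x \<in> closure S"
  shows "\<bar>g x - h x\<bar> \<le> e"
proof (rule continuous_le_on_closure[of S "\<lambda>x. \<bar>g x - h x\<bar>"])
  show "continuous_on (closure S) (\<lambda>x. \<bar>g x - h x\<bar>)"
    by (intro continuous_intros assms)
qed (use assms in auto)

section \<open>Joint continuity in time and space up to the boundary\<close>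

text \<open>The extensions to the closure are chosen separately for each time, so their dependence
  on time has to be recovered. Convergence in the Hoelder norm bounds their differences uniformly on
  \<Omega>, and by density on the closure. A sup-norm continuous family of continuous functions is
  jointly continuous.\<close>

lemma cont_time_hoelder_extension:
  fixes u :: "real \<Rightarrow> 'a::euclidean_space \<Rightarrow> real"
  assumes "open \<Omega>" "cont_time T (hoelder_norm k \<alpha> \<Omega>) u" "set bs \<subseteq> Basis" "length bs \<le> k"
  obtains G where "continuous_on ({0..T} \<times> closure \<Omega>) (\<lambda>(t, x). G t x)"
    "\<And>t x. t \<in> {0..T} \<Longrightarrow> x \<in> \<Omega> \<Longrightarrow> G t x = partial_derivs bs (u t) x"
proof -
  have Ck: "Ck_closure k \<Omega> (u t)" if "t \<in> {0..T}" for t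
    using assms(2) that unfolding cont_time_def by (blast intro: hoelder_norm_finite_Ck_closure)
  then have "\<forall>t\<in>{0..T}. \<exists>g. continuous_on (closure \<Omega>) g \<and> (\<forall>x\<in>\<Omega>. g x = partial_derivs bs (u t) x)"
    using assms(3,4) unfolding Ck_closure_def by blast
  then obtain G where G: "\<And>t. t \<in> {0..T} \<Longrightarrow> continuous_on (closure \<Omega>) (G t)"
    "\<And>t x. t \<in> {0..T} \<Longrightarrow> x \<in> \<Omega> \<Longrightarrow> G t x = partial_derivs bs (u t) x"
    by metis
  have unif: "\<forall>\<^sub>F s in at t within {0..T}. \<forall>x\<in>closure \<Omega>. \<bar>G s x - G t x\<bar> \<le> e"
    if t: "t \<in> {0..T}" and "e > 0" for t e
  proof -
    have "((\<lambda>s. hoelder_norm k \<alpha> \<Omega> (\<lambda>x. u s x - u t x)) \<longlongrightarrow> 0) (at t within {0..T})"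
      using assms(2) t unfolding cont_time_def by blast
    then have "\<forall>\<^sub>F s in at t within {0..T}. hoelder_norm k \<alpha> \<Omega> (\<lambda>x. u s x - u t x) < ennreal e"
      by (rule order_tendstoD) (use \<open>e > 0\<close> in simp)
    moreover have "\<forall>\<^sub>F s in at t within {0..T}. s \<in> {0..T}"
      by (simp add: eventually_at_filter)
    ultimately show ?thesis
    proof eventually_elim
      case (elim s)
      show ?case
      proof
        fix x assume "x \<in> closure \<Omega>"
        then show "\<bar>G s x - G t x\<bar> \<le> e"
        proof (rule closure_abs_diff_le[rotated 3])
          fix x assume x: "x \<in> \<Omega>"
          have "ennreal \<bar>partial_derivs bs (\<lambda>x. u s x - u t x) x\<bar> \<le> ennreal e"
            using hoelder_norm_ge_partial_derivs[OF x assms(3,4), of "\<lambda>x. u s x - u t x" \<alpha>] elim by simp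
          then have "\<bar>partial_derivs bs (\<lambda>x. u s x - u t x) x\<bar> \<le> e"
            using \<open>e > 0\<close> by simp
          then show "\<bar>G s x - G t x\<bar> \<le> e"
            using partial_derivs_diff[of k \<Omega> "u s" "u t" bs x] Ck[OF t] Ck[OF elim(2)] G(2) elim(2) t x assms
            by (simp add: Ck_closure_def)
        qed (use G elim t in auto)
      qed
    qed
  qed
  have "continuous_on ({0..T} \<times> closure \<Omega>) (\<lambda>(t, x). G t x)"
    unfolding continuous_on_iff
  proof (intro ballI allI impI)
    fix p and e :: real assume "p \<in> {0..T} \<times> closure \<Omega>" "e > 0"
    then obtain t x where p: "p = (t, x)" and t: "t \<in> {0..T}" and x: "x \<in> closure \<Omega>" by blast
    obtain d1 where d1: "d1 > 0" "\<And>s y. s \<in> {0..T} \<Longrightarrow> s \<noteq> t \<Longrightarrow> dist s t < d1 \<Longrightarrow> y \<in> closure \<Omega> \<Longrightarrow> \<bar>G s y - G t y\<bar> \<le> e / 2"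
      using unif[OF t, of "e / 2"] \<open>e > 0\<close> unfolding eventually_at by auto
    obtain d2 where d2: "d2 > 0" "\<And>y. y \<in> closure \<Omega> \<Longrightarrow> dist y x < d2 \<Longrightarrow> dist (G t y) (G t x) < e / 2"
      using G(1)[OF t] x \<open>e > 0\<close> unfolding continuous_on_iff by (meson half_gt_zero)
    show "\<exists>d>0. \<forall>p'\<in>{0..T} \<times> closure \<Omega>. dist p' p < d \<longrightarrow>
       dist (case p' of (t, x) \<Rightarrow> G t x) (case p of (t, x) \<Rightarrow> G t x) < e"
    proof (intro exI[of _ "min d1 d2"] conjI ballI impI)
      fix p' assume p': "p' \<in> {0..T} \<times> closure \<Omega>" "dist p' p < min d1 d2"
      then obtain s y where sy: "p' = (s, y)" "s \<in> {0..T}" "y \<in> closure \<Omega>" by blast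
      have "dist s t < d1" "dist y x < d2"
        using p'(2) dist_fst_le[of p' p] dist_snd_le[of p' p] unfolding sy p by auto
      then have "dist (G t y) (G t x) < e / 2" "\<bar>G s y - G t y\<bar> \<le> e / 2"
        using d1(2)[of s y] d2(2)[of y] sy \<open>e > 0\<close> by (cases "s = t"; auto)+
      then show "dist (case p' of (t, x) \<Rightarrow> G t x) (case p of (t, x) \<Rightarrow> G t x) < e"
        unfolding sy p dist_real_def prod.case by arith
    qed (use d1 d2 in auto)
  qed
  then show thesis using that G(2) by blast
qed

text \<open>The \<open>Lim\<close> in \<open>gradient_cl\<close> is meaningful only along a proper
  filter. Points of an open set in Euclidean space are not isolated, and the remaining points of the
  closure are limit points by definition.\<close>

lemma at_within_open_closure_nontrivial:
  fixes x :: "'a::euclidean_space"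
  assumes "open S" "x \<in> closure S"
  shows "at x within S \<noteq> bot"
proof -
  have "x islimpt S"
  proof (cases "x \<in> S")
    case True
    then show ?thesis
      using assms(1) by (intro interior_limit_point) (simp add: interior_open)
  next
    case False
    then show ?thesis
      using assms(2) unfolding closure_def by blast
  qed
  then show ?thesis
    by (simp only: trivial_limit_within not_not)
qed

lemma gradient_cl_eq:
  fixes f :: "'a::euclidean_space \<Rightarrow> real"
  assumes "open \<Omega>" "x \<in> closure \<Omega>"
    and "continuous_on (closure \<Omega>) g" "\<And>y. y \<in> \<Omega> \<Longrightarrow> g y = gradient f y"
  shows "gradient_cl \<Omega> f x = g x"
  unfolding gradient_cl_def
proof (rule tendsto_Lim)
  show "at x within \<Omega> \<noteq> bot"
    using assms by (intro at_within_open_closure_nontrivial)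
  have "(g \<longlongrightarrow> g x) (at x within closure \<Omega>)"
    using assms(2,3) unfolding continuous_on_def by blast
  then have "(g \<longlongrightarrow> g x) (at x within \<Omega>)"
    by (rule tendsto_within_subset) (rule closure_subset)
  then show "(gradient f \<longlongrightarrow> g x) (at x within \<Omega>)"
    by (rule Lim_transform_eventually) (auto simp: eventually_at_filter assms(4))
qed

text \<open>\<open>DV\<close> extends the Hessian continuously to the closure. The identity with
  \<open>hessian\<close> is kept only inside \<Omega>; the boundary values serve to make the domain
  compact, which yields uniform bounds and uniform continuity.\<close>

lemma cont_time_gradient_hessian:
  fixes \<phi> :: "real \<Rightarrow> 'a::euclidean_space \<Rightarrow> real"
  assumes "open \<Omega>" "cont_time T (hoelder_norm 2 \<alpha> \<Omega>) \<phi>"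
  obtains DV where
    "continuous_on ({0..T} \<times> closure \<Omega>) (\<lambda>(t, x). gradient_cl \<Omega> (\<phi> t) x)"
    "continuous_on ({0..T} \<times> closure \<Omega>) (\<lambda>(t, x). DV t x)"
    "\<And>t x. t \<in> {0..T} \<Longrightarrow> x \<in> \<Omega> \<Longrightarrow> DV t x = hessian (\<phi> t) x"
    "\<And>t x. t \<in> {0..T} \<Longrightarrow> x \<in> \<Omega> \<Longrightarrow> gradient_cl \<Omega> (\<phi> t) x = gradient (\<phi> t) x"
proof -
  have "\<forall>bs\<in>{bs. set bs \<subseteq> Basis \<and> length bs \<le> 2}. \<exists>G.
      continuous_on ({0..T} \<times> closure \<Omega>) (\<lambda>p. G (fst p) (snd p)) \<and>
      (\<forall>t\<in>{0..T}. \<forall>x\<in>\<Omega>. G t x = partial_derivs bs (\<phi> t) x)"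
    
  proof
    fix bs :: "'a list" assume bs: "bs \<in> {bs. set bs \<subseteq> Basis \<and> length bs \<le> 2}"
    then obtain G where "continuous_on ({0..T} \<times> closure \<Omega>) (\<lambda>(t, x). G t x)"
      "\<And>t x. t \<in> {0..T} \<Longrightarrow> x \<in> \<Omega> \<Longrightarrow> G t x = partial_derivs bs (\<phi> t) x"
      using cont_time_hoelder_extension[OF assms, where bs = bs] by blast
    then show "\<exists>G. continuous_on ({0..T} \<times> closure \<Omega>) (\<lambda>p. G (fst p) (snd p)) \<and>
      (\<forall>t\<in>{0..T}. \<forall>x\<in>\<Omega>. G t x = partial_derivs bs (\<phi> t) x)"
      by (intro exI[of _ G]) (auto simp: case_prod_beta')
  qed
  then obtain G where G: "\<And>bs. set bs \<subseteq> Basis \<Longrightarrow> length bs \<le> 2 \<Longrightarrow>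
       continuous_on ({0..T} \<times> closure \<Omega>) (\<lambda>p. G bs (fst p) (snd p))"
    "\<And>bs t x. set bs \<subseteq> Basis \<Longrightarrow> length bs \<le> 2 \<Longrightarrow> t \<in> {0..T} \<Longrightarrow> x \<in> \<Omega> \<Longrightarrow>
       G bs t x = partial_derivs bs (\<phi> t) x"
    unfolding bchoice_iff
  proof -
    assume "\<exists>f. \<forall>bs\<in>{bs. set bs \<subseteq> Basis \<and> length bs \<le> 2}.
        continuous_on ({0..T} \<times> closure \<Omega>) (\<lambda>p. f bs (fst p) (snd p)) \<and>
        (\<forall>t\<in>{0..T}. \<forall>x\<in>\<Omega>. f bs t x = partial_derivs bs (\<phi> t) x)"
    then obtain f where f: "\<forall>bs\<in>{bs. set bs \<subseteq> Basis \<and> length bs \<le> 2}.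
        continuous_on ({0..T} \<times> closure \<Omega>) (\<lambda>p. f bs (fst p) (snd p)) \<and>
        (\<forall>t\<in>{0..T}. \<forall>x\<in>\<Omega>. f bs t x = partial_derivs bs (\<phi> t) x)" ..
    show thesis
    proof (rule that)
      fix bs :: "'a list" assume bs: "set bs \<subseteq> Basis" "length bs \<le> 2"
      show "continuous_on ({0..T} \<times> closure \<Omega>) (\<lambda>p. f bs (fst p) (snd p))"
        using f bs by blast
      fix t x assume "t \<in> {0..T}" "x \<in> \<Omega>"
      then show "f bs t x = partial_derivs bs (\<phi> t) x"
        using f bs by blast
    qed
  qed
  define g where "g t x = (\<Sum>b\<in>Basis. G [b] t x *\<^sub>R b)" for t x
  define DV where "DV t x = (\<Sum>b\<in>Basis. \<Sum>c\<in>Basis. G [c, b] t x *\<^sub>R rank_one c b)" for t x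
  have contg: "continuous_on ({0..T} \<times> closure \<Omega>) (\<lambda>p. g (fst p) (snd p))"
    unfolding g_def by (intro continuous_intros G) auto
  have contg': "continuous_on (closure \<Omega>) (g t)" if "t \<in> {0..T}" for t
  proof -
    have "continuous_on (closure \<Omega>) (Pair t)"
      by (rule continuous_on_Pair; rule continuous_on_const continuous_on_id)
    then show ?thesis
      using continuous_on_compose2[OF contg, of "closure \<Omega>" "Pair t"] that by (simp add: image_subset_iff)
  qed
  have geq: "g t x = gradient (\<phi> t) x" if "t \<in> {0..T}" "x \<in> \<Omega>" for t x
    unfolding g_def gradient_def using that G(2) by (intro sum.cong) auto
  have cl: "gradient_cl \<Omega> (\<phi> t) x = g t x" if "t \<in> {0..T}" "x \<in> closure \<Omega>" for t x
    by (rule gradient_cl_eq) (use that assms contg' geq in auto)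
  show thesis
  proof (rule that[of DV])
    show "continuous_on ({0..T} \<times> closure \<Omega>) (\<lambda>(t, x). gradient_cl \<Omega> (\<phi> t) x)"
      using continuous_on_eq[OF contg] cl by (auto simp: case_prod_beta')
    show "continuous_on ({0..T} \<times> closure \<Omega>) (\<lambda>(t, x). DV t x)"
      unfolding case_prod_beta' DV_def by (intro continuous_intros G) auto
    show "DV t x = hessian (\<phi> t) x" if "t \<in> {0..T}" "x \<in> \<Omega>" for t x
      unfolding DV_def hessian_def using that G(2) by (intro sum.cong) auto
    show "gradient_cl \<Omega> (\<phi> t) x = gradient (\<phi> t) x" if "t \<in> {0..T}" "x \<in> \<Omega>" for t x
      using cl[of t x] geq[of t x] subsetD[OF closure_subset that(2)] that by simp
  qed
qed

section \<open>Flows of tangential vector fields\<close>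

text \<open>The set where \<open>g\<close> is positive is open and disjoint from \<Omega>, hence
  disjoint from the closure.\<close>

lemma local_defining_function_closure:
  assumes ldf: "local_defining_function \<Omega> z U g" and y: "y \<in> U" "y \<in> closure \<Omega>"
  shows "g y \<le> 0"
proof (rule ccontr)
  assume "\<not> g y \<le> 0"
  have U: "open U" "\<Omega> \<inter> U = {y\<in>U. g y < 0}" "Ck_on 2 U g"
    using ldf unfolding local_defining_function_def smooth_on_def by blast+
  have "open (U \<inter> g -` {0<..})"
    by (rule continuous_open_preimage[OF Ck_on_continuous_gradient(1)[OF U(3)] U(1)]) simp
  moreover have "g x < 0" if "x \<in> \<Omega>" "x \<in> U" for x
    using U(2) that by blast
  then have "(U \<inter> g -` {0<..}) \<inter> \<Omega> = {}"
    by fastforce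
  ultimately have "(U \<inter> g -` {0<..}) \<inter> closure \<Omega> = {}"
    using open_Int_closure_eq_empty by blast
  with y \<open>\<not> g y \<le> 0\<close> show False by auto
qed

lemma local_defining_function_frontier_iff:
  assumes "open \<Omega>" "local_defining_function \<Omega> z U g" "y \<in> U" "y \<in> closure \<Omega>"
  shows "y \<in> frontier \<Omega> \<longleftrightarrow> g y = 0"
proof -
  have "y \<in> \<Omega> \<longleftrightarrow> g y < 0"
    using assms(2,3) unfolding local_defining_function_def by blast
  moreover have "g y \<le> 0"
    using local_defining_function_closure assms by blast
  ultimately show ?thesis
    using assms unfolding frontier_def by (auto simp: interior_open)
qed

text \<open>Tangency is phrased through every local defining function instead of a unit normal. One
  \<open>g\<close> on \<open>U\<close> is a defining function at all boundary points in
  \<open>U\<close>, so a single \<open>g\<close> can be followed along a curve.\<close>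

locale tangential_field =
  fixes \<Omega> :: "'a::euclidean_space set" and V :: "real \<Rightarrow> 'a \<Rightarrow> 'a"
    and DV :: "real \<Rightarrow> 'a \<Rightarrow> 'a \<Rightarrow>\<^sub>L 'a" and T :: real
  assumes domain: "smooth_bounded_domain \<Omega>"
    and T: "0 \<le> T"
    and V_deriv: "\<And>t x. t \<in> {0..T} \<Longrightarrow> x \<in> \<Omega> \<Longrightarrow> (V t has_derivative DV t x) (at x)"
    and V_cont: "continuous_on ({0..T} \<times> closure \<Omega>) (\<lambda>(t, x). V t x)"
    and DV_cont: "continuous_on ({0..T} \<times> closure \<Omega>) (\<lambda>(t, x). DV t x)"
    and tangential: "\<And>t z U g. t \<in> {0..T} \<Longrightarrow> z \<in> frontier \<Omega> \<Longrightarrow>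
      local_defining_function \<Omega> z U g \<Longrightarrow> gradient g z \<bullet> V t z = 0"
begin

lemma open_domain: "open \<Omega>" and compact_closure: "compact (closure \<Omega>)"
  using domain unfolding smooth_bounded_domain_def by (auto simp: compact_eq_bounded_closed)

lemma compact_spacetime: "compact ({0..T} \<times> closure \<Omega>)"
  by (intro compact_Times compact_closure) simp

lemma in_closure: "x \<in> \<Omega> \<Longrightarrow> x \<in> closure \<Omega>"
  using closure_subset by blast

lemma frontier_iff: "x \<in> closure \<Omega> \<Longrightarrow> x \<in> frontier \<Omega> \<longleftrightarrow> x \<notin> \<Omega>"
  using open_domain unfolding frontier_def by (simp add: interior_open)

lemma V_bound: obtains K where "0 \<le> K" "\<And>t x. t \<in> {0..T} \<Longrightarrow> x \<in> closure \<Omega> \<Longrightarrow> norm (V t x) \<le> K"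
proof -
  have "bounded ((\<lambda>(t, x). V t x) ` ({0..T} \<times> closure \<Omega>))"
    by (intro compact_imp_bounded compact_continuous_image V_cont compact_spacetime)
  then obtain K where "K > 0" "\<forall>y\<in>(\<lambda>(t, x). V t x) ` ({0..T} \<times> closure \<Omega>). norm y \<le> K"
    unfolding bounded_pos by blast
  then show thesis by (intro that[of K]) auto
qed

lemma DV_bound: obtains L where "0 \<le> L" "\<And>t x. t \<in> {0..T} \<Longrightarrow> x \<in> closure \<Omega> \<Longrightarrow> norm (DV t x) \<le> L"
proof -
  have "bounded ((\<lambda>(t, x). DV t x) ` ({0..T} \<times> closure \<Omega>))"
    by (intro compact_imp_bounded compact_continuous_image DV_cont compact_spacetime)
  then obtain K where "K > 0" "\<forall>y\<in>(\<lambda>(t, x). DV t x) ` ({0..T} \<times> closure \<Omega>). norm y \<le> K"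
    unfolding bounded_pos by blast
  then show thesis by (intro that[of K]) auto
qed

text \<open>The mean value inequality needs a convex set, and \<Omega> is not assumed convex;
  \<open>S\<close> will always be a ball inside \<Omega>.\<close>

lemma V_Lipschitz:
  assumes L: "\<And>t x. t \<in> {0..T} \<Longrightarrow> x \<in> closure \<Omega> \<Longrightarrow> norm (DV t x) \<le> L"
    and S: "convex S" "S \<subseteq> \<Omega>" "t \<in> {0..T}" "x \<in> S" "y \<in> S"
  shows "norm (V t x - V t y) \<le> L * norm (x - y)"
proof (rule differentiable_bound[OF \<open>convex S\<close>])
  fix u assume "u \<in> S"
  then have "u \<in> \<Omega>" using S by blast
  then show "(V t has_derivative DV t u) (at u within S)" "onorm (DV t u) \<le> L"
    using V_deriv[of t u] L[of t u] S in_closure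
    by (auto simp: norm_blinfun.rep_eq[symmetric] intro: has_derivative_at_withinI)
qed (use S in auto)

lemma continuous_V: "t \<in> {0..T} \<Longrightarrow> continuous_on (closure \<Omega>) (V t)"
proof -
  assume t: "t \<in> {0..T}"
  have "continuous_on (closure \<Omega>) (Pair t)"
    by (rule continuous_on_Pair; rule continuous_on_const continuous_on_id)
  then show ?thesis
    using continuous_on_compose2[OF V_cont, of "closure \<Omega>" "Pair t"] t by (simp add: image_subset_iff)
qed

text \<open>Since \<open>\<nabla>g \<bullet> V\<close> vanishes on the boundary, following the direction \<open>\<nabla>g(z)\<close> from an interior
  point to the boundary bounds it by a multiple of \<open>\<bar>g\<bar>\<close>.\<close>

lemma boundary_estimate:
  assumes ldf: "local_defining_function \<Omega> z U g" and z: "z \<in> frontier \<Omega>"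
  obtains r C where "0 < r" "0 \<le> C" "ball z r \<subseteq> U"
    "\<And>t x. t \<in> {0..T} \<Longrightarrow> x \<in> ball z r \<Longrightarrow> x \<in> closure \<Omega> \<Longrightarrow> \<bar>gradient g x \<bullet> V t x\<bar> \<le> C * \<bar>g x\<bar>"
proof -
  have U: "open U" "z \<in> U" "\<Omega> \<inter> U = {y\<in>U. g y < 0}" "Ck_on 2 U g" "\<And>y. y \<in> U \<Longrightarrow> gradient g y \<noteq> 0"
    using ldf unfolding local_defining_function_def smooth_on_def by blast+
  have ldf': "local_defining_function \<Omega> y U g" if "y \<in> U" for y
    using ldf that unfolding local_defining_function_def by blast
  note cont = Ck_on_continuous_gradient[OF U(4)]
  \<comment> \<open>The direction is frozen at \<open>z\<close>. Half of
    \<open>n \<bullet> n\<close> is a growth rate of \<open>g\<close> along \<open>n\<close> that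
    persists on the neighbourhood \<open>W\<close> of \<open>z\<close>.\<close>
  define n where "n = gradient g z"
  define c where "c = (n \<bullet> n) / 2"
  have n: "n \<noteq> 0" "0 < norm n" using U(2,5) unfolding n_def by auto
  then have c: "0 < c" "c < n \<bullet> n" unfolding c_def by auto
  define W where "W = U \<inter> (\<lambda>y. gradient g y \<bullet> n) -` {c<..}"
  have "continuous_on U (\<lambda>y. gradient g y \<bullet> n)"
    by (intro continuous_intros cont(2))
  then have "open W"
    unfolding W_def by (rule continuous_open_preimage[OF _ U(1)]) simp
  moreover have "z \<in> W"
    unfolding W_def n_def[symmetric] using U(2) c by (simp add: n_def)
  moreover have "W \<subseteq> U" "\<And>y. y \<in> W \<Longrightarrow> c < gradient g y \<bullet> n"
    unfolding W_def by auto
  ultimately have W: "open W" "z \<in> W" "W \<subseteq> U" "\<And>y. y \<in> W \<Longrightarrow> c < gradient g y \<bullet> n"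
    by blast+
  obtain R where R: "R > 0" "cball z R \<subseteq> W"
    using W(1,2) open_contains_cball by blast
  have cb: "cball z R \<subseteq> U" using R W(3) by blast
  have "bounded (gradient g ` cball z R)" "bounded (hessian g ` cball z R)"
    using cont(2,3) continuous_on_subset[OF _ cb]
    by (auto intro!: compact_imp_bounded compact_continuous_image)
  then obtain G1 G2 where G: "G1 > 0" "G2 > 0" "\<And>y. y \<in> cball z R \<Longrightarrow> norm (gradient g y) \<le> G1"
    "\<And>y. y \<in> cball z R \<Longrightarrow> norm (hessian g y) \<le> G2"
    unfolding bounded_pos by blast
  obtain K where K: "0 \<le> K" "\<And>t x. t \<in> {0..T} \<Longrightarrow> x \<in> closure \<Omega> \<Longrightarrow> norm (V t x) \<le> K"
    using V_bound by blast
  obtain L where L: "0 \<le> L" "\<And>t x. t \<in> {0..T} \<Longrightarrow> x \<in> closure \<Omega> \<Longrightarrow> norm (DV t x) \<le> L"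
    using DV_bound by blast
  \<comment> \<open>\<open>B\<close> bounds the derivative of
    \<open>gradient g \<bullet> V t\<close> along lines in direction \<open>n\<close>: the Hessian
    of \<open>g\<close> against \<open>V\<close>, plus the gradient of \<open>g\<close> against
    \<open>DV\<close>.\<close>
  define B where "B = (G2 * K + G1 * L) * norm n"
  have B: "0 \<le> B" unfolding B_def using G K L by auto
  have gz: "g z = 0"
    using local_defining_function_frontier_iff[OF open_domain ldf U(2)] z frontier_closures by blast
  \<comment> \<open>If \<open>\<bar>g x\<bar>\<close> is below \<epsilon>, the displacement
    \<open>\<tau>1 * norm n\<close> used below is at most \<open>R / 2\<close>. Starting within
    \<open>R / 2\<close> of \<open>z\<close>, the segment then stays in \<open>cball z R\<close>,
    where all bounds hold.\<close>
  define \<epsilon> where "\<epsilon> = R * c / (2 * norm n)"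
  have \<epsilon>: "0 < \<epsilon>" unfolding \<epsilon>_def using R c n by auto
  have "open (U \<inter> g -` {-\<epsilon><..<\<epsilon>})"
    by (rule continuous_open_preimage[OF cont(1) U(1)]) simp
  moreover have "z \<in> U \<inter> g -` {-\<epsilon><..<\<epsilon>}"
    using U(2) gz \<epsilon> by auto
  ultimately obtain r0 where r0: "r0 > 0" "ball z r0 \<subseteq> U \<inter> g -` {-\<epsilon><..<\<epsilon>}"
    using open_contains_ball by blast
  define r where "r = min r0 (R / 2)"
  show thesis
  proof (rule that[of r "B / c"])
    show "0 < r" unfolding r_def using r0 R by auto
    show "0 \<le> B / c" using B c by auto
    show "ball z r \<subseteq> U" unfolding r_def using r0 by auto
    fix t x assume t: "t \<in> {0..T}" and x: "x \<in> ball z r" "x \<in> closure \<Omega>"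
    have xU: "x \<in> U" "\<bar>g x\<bar> < \<epsilon>" using subsetD[OF r0(2), of x] x(1) unfolding r_def by auto
    show "\<bar>gradient g x \<bullet> V t x\<bar> \<le> B / c * \<bar>g x\<bar>"
    proof (cases "x \<in> \<Omega>")
      case False
      then have "gradient g x \<bullet> V t x = 0"
        by (intro tangential[OF t _ ldf'[OF xU(1)]]) (simp add: frontier_iff[OF x(2)])
      then show ?thesis using B c by simp
    next
      case True
      then have gx: "g x < 0" using U(3) xU by blast
      \<comment> \<open>Since \<open>g\<close> grows at rate at least \<open>c\<close> along
        \<open>n\<close>, the value 0 is reached no later than this time.\<close>
      define \<tau>1 where "\<tau>1 = - g x / c"
      have \<tau>1: "0 < \<tau>1" unfolding \<tau>1_def using gx c by (simp add: divide_neg_pos)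
      define y where "y \<tau> = x + \<tau> *\<^sub>R n" for \<tau>
      have yR: "y \<tau> \<in> cball z R" if "\<tau> \<in> {0..\<tau>1}" for \<tau>
      proof -
        have "\<tau>1 * norm n \<le> R / 2"
        proof -
          have "\<tau>1 * norm n \<le> \<epsilon> / c * norm n"
            unfolding \<tau>1_def using xU(2) c n by (intro mult_right_mono divide_right_mono) auto
          also have "\<dots> = R / 2" unfolding \<epsilon>_def using c n by simp
          finally show ?thesis .
        qed
        moreover have "\<tau> * norm n \<le> \<tau>1 * norm n" using that n by auto
        moreover have "dist z x < R / 2" using x(1) unfolding r_def by auto
        moreover have "dist z (y \<tau>) \<le> dist z x + dist x (y \<tau>)" by (rule dist_triangle)
        moreover have "dist x (y \<tau>) = \<tau> * norm n"
          unfolding y_def dist_norm using that by simp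
        ultimately show ?thesis by simp
      qed
      have yU: "y \<tau> \<in> U" "c < gradient g (y \<tau>) \<bullet> n" if "\<tau> \<in> {0..\<tau>1}" for \<tau>
        using yR[OF that] R(2) W by auto
      have yder: "(y has_vector_derivative n) (at \<tau>)" for \<tau>
        unfolding y_def by (auto intro!: derivative_eq_intros)
      have ycont: "continuous_on S y" for S
        unfolding y_def by (intro continuous_intros)
      define h where "h \<tau> = g (y \<tau>)" for \<tau>
      have hder: "(h has_real_derivative gradient g (y \<tau>) \<bullet> n) (at \<tau>)" if "\<tau> \<in> {0..\<tau>1}" for \<tau>
      proof -
        have "(g has_derivative (\<lambda>u. gradient g (y \<tau>) \<bullet> u)) (at (y \<tau>))"
          using Ck_on_differentiable[OF U(4,1) yU(1)[OF that], where bs = "[]"]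
          by (intro has_derivative_gradient) simp
        then have "((g \<circ> y) has_vector_derivative gradient g (y \<tau>) \<bullet> n) (at \<tau>)"
          by (intro vector_derivative_diff_chain_within[OF yder]) (rule has_derivative_at_withinI)
        then show ?thesis
          unfolding h_def o_def has_real_derivative_iff_has_vector_derivative .
      qed
      have hinc: "h \<tau> < h \<tau>'" if "0 \<le> \<tau>" "\<tau> < \<tau>'" "\<tau>' \<le> \<tau>1" for \<tau> \<tau>'
      proof (rule DERIV_pos_imp_increasing[OF that(2)])
        fix \<sigma> assume "\<tau> \<le> \<sigma>" "\<sigma> \<le> \<tau>'"
        then have "\<sigma> \<in> {0..\<tau>1}" using that by auto
        then show "\<exists>y. (h has_real_derivative y) (at \<sigma>) \<and> 0 < y"
          using hder yU(2) c by (meson less_trans)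
      qed
      have h0: "h 0 < 0" unfolding h_def y_def using gx by simp
      have h1: "0 \<le> h \<tau>1"
      proof -
        obtain \<xi> where \<xi>: "0 < \<xi>" "\<xi> < \<tau>1" "h \<tau>1 - h 0 = (\<tau>1 - 0) * (gradient g (y \<xi>) \<bullet> n)"
          using MVT2[OF \<tau>1, of h "\<lambda>\<tau>. gradient g (y \<tau>) \<bullet> n"] hder by auto
        have "\<tau>1 * c \<le> \<tau>1 * (gradient g (y \<xi>) \<bullet> n)"
          using yU(2)[of \<xi>] \<xi> \<tau>1 by (intro mult_left_mono) auto
        moreover have "h 0 = - (\<tau>1 * c)" unfolding h_def y_def \<tau>1_def using c by simp
        ultimately show ?thesis using \<xi>(3) by simp
      qed
      have "continuous_on {0..\<tau>1} h"
        using hder by (meson DERIV_isCont continuous_at_imp_continuous_on)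
      then obtain \<sigma> where \<sigma>: "0 \<le> \<sigma>" "\<sigma> \<le> \<tau>1" "h \<sigma> = 0"
        using IVT'[of h 0 0 \<tau>1] h0 h1 \<tau>1 by auto
      have \<sigma>0: "0 < \<sigma>" using \<sigma> h0 by (cases "\<sigma> = 0") auto
      have y\<Omega>: "y \<tau> \<in> \<Omega>" if "0 \<le> \<tau>" "\<tau> < \<sigma>" for \<tau>
        using hinc[OF that \<sigma>(2)] \<sigma>(3) yU(1)[of \<tau>] that \<sigma>(2) U(3) unfolding h_def by auto
      have "y ` closure {0..<\<sigma>} \<subseteq> closure \<Omega>"
        by (rule image_closure_subset[OF ycont]) (use y\<Omega> in_closure in auto)
      then have ycl: "y \<tau> \<in> closure \<Omega>" if "\<tau> \<in> {0..\<sigma>}" for \<tau>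
        using that \<sigma>0 by auto
      define F where "F \<tau> = gradient g (y \<tau>) \<bullet> V t (y \<tau>)" for \<tau>
      have "y \<sigma> \<in> frontier \<Omega>"
        using local_defining_function_frontier_iff[OF open_domain ldf yU(1) ycl] \<sigma> unfolding h_def by auto
      then have F\<sigma>: "F \<sigma> = 0"
        unfolding F_def using tangential[OF t _ ldf'[OF yU(1)]] \<sigma> by auto
      \<comment> \<open>\<open>F\<close> vanishes at the exit time \<open>\<sigma>\<close>, so its
        increment bounds \<open>F 0\<close>. \<open>V\<close> has a derivative only inside \<Omega>,
        so the version of the mean value inequality used here asks for derivatives on the open
        interval and for continuity at its ends.\<close>
      have "norm (F \<sigma> - F 0) \<le> B * \<sigma> - B * 0"
      proof (rule differentiable_bound_general[OF \<sigma>0])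
        show "continuous_on {0..\<sigma>} (\<lambda>\<tau>. B * \<tau>)" by (intro continuous_intros)
        show "continuous_on {0..\<sigma>} F"
          unfolding F_def
        proof (intro continuous_intros)
          show "continuous_on {0..\<sigma>} (\<lambda>\<tau>. gradient g (y \<tau>))"
            by (rule continuous_on_compose2[OF cont(2) ycont]) (use yU(1) \<sigma> in auto)
          show "continuous_on {0..\<sigma>} (\<lambda>\<tau>. V t (y \<tau>))"
            by (rule continuous_on_compose2[OF continuous_V[OF t] ycont]) (use ycl in auto)
        qed
        fix \<tau> assume \<tau>: "0 < \<tau>" "\<tau> < \<sigma>"
        then have \<tau>': "\<tau> \<in> {0..\<tau>1}" "y \<tau> \<in> \<Omega>" using \<sigma> y\<Omega> by auto
        show "((\<lambda>\<tau>. B * \<tau>) has_vector_derivative B) (at \<tau>)"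
          by (auto intro!: derivative_eq_intros simp flip: has_real_derivative_iff_has_vector_derivative)
        have d1: "((gradient g \<circ> y) has_vector_derivative hessian g (y \<tau>) n) (at \<tau>)"
          by (rule vector_derivative_diff_chain_within[OF yder has_derivative_at_withinI[OF
             has_derivative_gradient_hessian[OF U(4,1) yU(1)[OF \<tau>'(1)]]]])
        have d2: "((V t \<circ> y) has_vector_derivative DV t (y \<tau>) n) (at \<tau>)"
          by (rule vector_derivative_diff_chain_within[OF yder has_derivative_at_withinI[OF
             V_deriv[OF t \<tau>'(2)]]])
        show "(F has_vector_derivative
           gradient g (y \<tau>) \<bullet> DV t (y \<tau>) n + hessian g (y \<tau>) n \<bullet> V t (y \<tau>)) (at \<tau>)"
          using bounded_bilinear.has_vector_derivative[OF bounded_bilinear_inner d1 d2]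
          unfolding F_def o_def .
        have "\<bar>gradient g (y \<tau>) \<bullet> DV t (y \<tau>) n\<bar> \<le> G1 * (L * norm n)"
          using Cauchy_Schwarz_ineq2[of "gradient g (y \<tau>)" "DV t (y \<tau>) n"] G K L \<tau>' t yR[OF \<tau>'(1)]
          by (elim order_trans) (intro mult_mono norm_blinfun[THEN order_trans] mult_right_mono; auto simp: in_closure)
        moreover have "\<bar>hessian g (y \<tau>) n \<bullet> V t (y \<tau>)\<bar> \<le> (G2 * norm n) * K"
          using Cauchy_Schwarz_ineq2[of "hessian g (y \<tau>) n" "V t (y \<tau>)"] G K L \<tau>' t yR[OF \<tau>'(1)]
          by (elim order_trans) (intro mult_mono norm_blinfun[THEN order_trans] mult_right_mono; auto simp: in_closure)
        ultimately show "norm (gradient g (y \<tau>) \<bullet> DV t (y \<tau>) n + hessian g (y \<tau>) n \<bullet> V t (y \<tau>)) \<le> B"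
          unfolding B_def by (simp add: algebra_simps)
      qed
      then have "\<bar>F 0\<bar> \<le> B * \<sigma>" using F\<sigma> by simp
      also have "\<dots> \<le> B * \<tau>1" using \<sigma> B by (intro mult_left_mono)
      also have "\<dots> = B / c * \<bar>g x\<bar>" unfolding \<tau>1_def using gx by simp
      finally show ?thesis unfolding F_def y_def by simp
    qed
  qed
qed

section \<open>Integral curves: invariance of interior and boundary, uniqueness\<close>

definition integral_curve :: "(real \<Rightarrow> 'a) \<Rightarrow> bool" where
  "integral_curve \<gamma> \<longleftrightarrow> (\<forall>s\<in>{0..T}. \<gamma> s \<in> closure \<Omega> \<and>
     (\<gamma> has_vector_derivative V s (\<gamma> s)) (at s within {0..T}))"

lemma integral_curveD:
  assumes "integral_curve \<gamma>" "s \<in> {a..b}" "{a..b} \<subseteq> {0..T}"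
  shows "(\<gamma> has_vector_derivative V s (\<gamma> s)) (at s within {a..b})"
proof -
  have "s \<in> {0..T}" using assms(2,3) by blast
  then have "(\<gamma> has_vector_derivative V s (\<gamma> s)) (at s within {0..T})"
    using assms(1) unfolding integral_curve_def by simp
  then show ?thesis
    by (rule has_vector_derivative_within_subset) (rule assms(3))
qed

lemma integral_curve_continuous: "integral_curve \<gamma> \<Longrightarrow> continuous_on {0..T} \<gamma>"
  unfolding integral_curve_def
  by (meson continuous_on_eq_continuous_within has_vector_derivative_continuous)

text \<open>Near a boundary point on the curve, the derivative of
  \<open>g (\<gamma> \<sigma>)\<close> is the gradient of \<open>g\<close> against \<open>V\<close>,
  which \<open>boundary_estimate\<close> bounds by a multiple of
  \<open>\<bar>g (\<gamma> \<sigma>)\<bar>\<close>. As \<open>g\<close> vanishes at that point,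
  Gronwall in both time directions keeps it zero, so the set of boundary times is open as well as
  closed.\<close>

lemma integral_curve_frontier:
  assumes \<gamma>: "integral_curve \<gamma>" and s0: "s0 \<in> {0..T}" "\<gamma> s0 \<in> frontier \<Omega>" and s: "s \<in> {0..T}"
  shows "\<gamma> s \<in> frontier \<Omega>"
proof (rule interval_clopen_induct[where P = "\<lambda>s. \<gamma> s \<in> frontier \<Omega>", OF _ s0 _ s])
  note cont = integral_curve_continuous[OF \<gamma>]
  show "closed {s \<in> {0..T}. \<gamma> s \<in> frontier \<Omega>}"
    using continuous_closed_preimage[OF cont _ frontier_closed, of \<Omega>] by (simp add: vimage_def Int_def)
  fix s assume s: "s \<in> {0..T}" "\<gamma> s \<in> frontier \<Omega>"
  then obtain U g where ldf: "local_defining_function \<Omega> (\<gamma> s) U g"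
    using domain unfolding smooth_bounded_domain_def by blast
  have U: "open U" "\<gamma> s \<in> U" "Ck_on 2 U g"
    using ldf unfolding local_defining_function_def smooth_on_def by blast+
  obtain r C where r: "0 < r" "0 \<le> C" "ball (\<gamma> s) r \<subseteq> U"
    "\<And>t x. t \<in> {0..T} \<Longrightarrow> x \<in> ball (\<gamma> s) r \<Longrightarrow> x \<in> closure \<Omega> \<Longrightarrow> \<bar>gradient g x \<bullet> V t x\<bar> \<le> C * \<bar>g x\<bar>"
    using boundary_estimate[OF ldf s(2)] by blast
  obtain d where d: "d > 0" "\<And>s'. s' \<in> {0..T} \<Longrightarrow> dist s' s < d \<Longrightarrow> dist (\<gamma> s') (\<gamma> s) < r"
    using cont s(1) r(1) unfolding continuous_on_iff by blast
  show "\<exists>d>0. \<forall>s'\<in>{0..T}. \<bar>s' - s\<bar> \<le> d \<longrightarrow> \<gamma> s' \<in> frontier \<Omega>"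
  proof (intro exI[of _ "d / 2"] conjI ballI impI)
    fix s' assume s': "s' \<in> {0..T}" "\<bar>s' - s\<bar> \<le> d / 2"
    \<comment> \<open>A window around \<open>s\<close>, cut off at the ends of
      \<open>{0..T}\<close>. Its half-width is less than \<open>d\<close>, so the curve stays in the
      ball where the boundary estimate holds.\<close>
    let ?a = "max 0 (s - d / 2)" and ?b = "min T (s + d / 2)"
    have "s - d / 2 \<le> s'" "s' \<le> s + d / 2"
      using s'(2) by linarith+
    then have s'I: "s' \<in> {?a..?b}" using s' by simp
    have near: "\<sigma> \<in> {0..T} \<and> \<gamma> \<sigma> \<in> ball (\<gamma> s) r \<and> \<gamma> \<sigma> \<in> closure \<Omega>" if "\<sigma> \<in> {?a..?b}" for \<sigma>
    proof -
      have "\<sigma> \<in> {0..T}" using that by auto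
      moreover have "dist \<sigma> s < d" using that d by (auto simp: dist_real_def)
      ultimately show ?thesis
        using d(2)[of \<sigma>] \<gamma> unfolding integral_curve_def by (simp add: dist_commute)
    qed
    have gder: "((\<lambda>\<sigma>. g (\<gamma> \<sigma>)) has_vector_derivative gradient g (\<gamma> \<sigma>) \<bullet> V \<sigma> (\<gamma> \<sigma>)) (at \<sigma> within {?a..?b})"
      if "\<sigma> \<in> {?a..?b}" for \<sigma>
    proof -
      have "\<gamma> \<sigma> \<in> U" using near[OF that] r(3) by blast
      then have "(g has_derivative (\<lambda>u. gradient g (\<gamma> \<sigma>) \<bullet> u)) (at (\<gamma> \<sigma>))"
        using Ck_on_differentiable[OF U(3,1), where bs = "[]"]
        by (intro has_derivative_gradient) simp
      then have "((g \<circ> \<gamma>) has_vector_derivative gradient g (\<gamma> \<sigma>) \<bullet> V \<sigma> (\<gamma> \<sigma>)) (at \<sigma> within {?a..?b})"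
        by (intro vector_derivative_diff_chain_within[OF integral_curveD[OF \<gamma> that]])
          (auto intro: has_derivative_at_withinI)
      then show ?thesis
        unfolding o_def .
    qed
    have "g (\<gamma> s') = 0"
    proof (rule gronwall_zero[OF gder])
      show "norm (gradient g (\<gamma> \<sigma>) \<bullet> V \<sigma> (\<gamma> \<sigma>)) \<le> C * norm (g (\<gamma> \<sigma>))" if "\<sigma> \<in> {?a..?b}" for \<sigma>
        using r(4) near[OF that] by auto
      show "g (\<gamma> s) = 0"
        using local_defining_function_frontier_iff[OF open_domain ldf U(2)] s frontier_subset_closed[of "closure \<Omega>"]
          by (simp add: frontier_def)
      show "s \<in> {?a..?b}" using s d by auto
      show "s' \<in> {?a..?b}" by (rule s'I)
    qed (use r in auto)
    moreover have "\<gamma> s' \<in> ball (\<gamma> s) r" "\<gamma> s' \<in> closure \<Omega>"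
      using near[OF s'I] by auto
    ultimately show "\<gamma> s' \<in> frontier \<Omega>"
      using local_defining_function_frontier_iff[OF open_domain ldf, of "\<gamma> s'"] subsetD[OF r(3), of "\<gamma> s'"] by simp
  qed (use d in auto)
qed

lemma integral_curve_interior:
  assumes "integral_curve \<gamma>" "s0 \<in> {0..T}" "\<gamma> s0 \<in> \<Omega>" "s \<in> {0..T}"
  shows "\<gamma> s \<in> \<Omega>"
proof -
  have cl: "\<gamma> s \<in> closure \<Omega>" "\<gamma> s0 \<in> closure \<Omega>"
    using assms unfolding integral_curve_def by auto
  show ?thesis
  proof (rule ccontr)
    assume "\<gamma> s \<notin> \<Omega>"
    then have "\<gamma> s \<in> frontier \<Omega>" using frontier_iff[OF cl(1)] by simp
    then have "\<gamma> s0 \<in> frontier \<Omega>" by (rule integral_curve_frontier[OF assms(1,4) _ assms(2)])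
    then show False using frontier_iff[OF cl(2)] assms(3) by simp
  qed
qed

text \<open>Once the curves meet at an interior point they stay interior, so at every time of
  coincidence there is a ball in \<Omega> containing both for a while. There the local Lipschitz
  bound and \<open>gronwall_zero\<close> apply, and coincidence times form a clopen set.\<close>

lemma integral_curve_unique:
  assumes \<gamma>: "integral_curve \<gamma>1" "integral_curve \<gamma>2" and s0: "s0 \<in> {0..T}" "\<gamma>1 s0 = \<gamma>2 s0" "\<gamma>1 s0 \<in> \<Omega>"
    and s: "s \<in> {0..T}"
  shows "\<gamma>1 s = \<gamma>2 s"
proof -
  define f where "f s = \<gamma>1 s - \<gamma>2 s" for s
  have cont1: "continuous_on {0..T} \<gamma>1" and cont2: "continuous_on {0..T} \<gamma>2"
    using \<gamma> integral_curve_continuous by auto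
  then have contf: "continuous_on {0..T} f" unfolding f_def by (intro continuous_intros)
  obtain L where L: "0 \<le> L" "\<And>t x. t \<in> {0..T} \<Longrightarrow> x \<in> closure \<Omega> \<Longrightarrow> norm (DV t x) \<le> L"
    using DV_bound by blast
  have "f s = 0"
  proof (rule interval_clopen_induct[where P = "\<lambda>s. f s = 0", OF _ s0(1) _ _ s])
    show "closed {s \<in> {0..T}. f s = 0}"
      using continuous_closed_preimage[OF contf, of "{0}"] by (simp add: vimage_def Int_def)
    show "f s0 = 0" using s0 unfolding f_def by simp
    fix s assume s: "s \<in> {0..T}" "f s = 0"
    then have eq: "\<gamma>2 s = \<gamma>1 s" unfolding f_def by simp
    have "\<gamma>1 s \<in> \<Omega>" using integral_curve_interior \<gamma> s0 s by blast
    then obtain r where r: "r > 0" "ball (\<gamma>1 s) r \<subseteq> \<Omega>"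
      using open_domain open_contains_ball by blast
    obtain d1 where d1: "d1 > 0" "\<And>s'. s' \<in> {0..T} \<Longrightarrow> dist s' s < d1 \<Longrightarrow> dist (\<gamma>1 s') (\<gamma>1 s) < r"
      using cont1 s(1) r(1) unfolding continuous_on_iff by blast
    obtain d2 where d2: "d2 > 0" "\<And>s'. s' \<in> {0..T} \<Longrightarrow> dist s' s < d2 \<Longrightarrow> dist (\<gamma>2 s') (\<gamma>2 s) < r"
      using cont2 s(1) r(1) unfolding continuous_on_iff by blast
    define d where "d = min d1 d2 / 2"
    have d: "d > 0" "d < d1" "d < d2" unfolding d_def using d1 d2 by auto
    show "\<exists>d>0. \<forall>s'\<in>{0..T}. \<bar>s' - s\<bar> \<le> d \<longrightarrow> f s' = 0"
    proof (intro exI[of _ d] conjI ballI impI)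
      fix s' assume s': "s' \<in> {0..T}" "\<bar>s' - s\<bar> \<le> d"
      let ?a = "max 0 (s - d)" and ?b = "min T (s + d)"
      have "s - d \<le> s'" "s' \<le> s + d"
        using s'(2) by linarith+
      then have s'I: "s' \<in> {?a..?b}" using s' by simp
      show "f s' = 0"
      proof (rule gronwall_zero[of ?a ?b f "\<lambda>\<sigma>. V \<sigma> (\<gamma>1 \<sigma>) - V \<sigma> (\<gamma>2 \<sigma>)" L s])
        fix \<sigma> assume \<sigma>: "\<sigma> \<in> {?a..?b}"
        then have \<sigma>T: "\<sigma> \<in> {0..T}" by auto
        have "dist \<sigma> s < d1" "dist \<sigma> s < d2" using \<sigma> d by (auto simp: dist_real_def)
        then have "\<gamma>1 \<sigma> \<in> ball (\<gamma>1 s) r" "\<gamma>2 \<sigma> \<in> ball (\<gamma>1 s) r"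
          using d1(2)[OF \<sigma>T] d2(2)[OF \<sigma>T] eq by (auto simp: dist_commute)
        then show "norm (V \<sigma> (\<gamma>1 \<sigma>) - V \<sigma> (\<gamma>2 \<sigma>)) \<le> L * norm (f \<sigma>)"
          unfolding f_def by (intro V_Lipschitz[OF L(2) _ r(2) \<sigma>T]) auto
        show "(f has_vector_derivative V \<sigma> (\<gamma>1 \<sigma>) - V \<sigma> (\<gamma>2 \<sigma>)) (at \<sigma> within {?a..?b})"
          unfolding f_def
          by (intro has_vector_derivative_diff integral_curveD \<gamma> \<sigma>) auto
      next
        show "s \<in> {?a..?b}" using s(1) d(1) by auto
      qed (use s(2) s'I L(1) in simp_all)
    qed (use d in auto)
  qed
  then show ?thesis unfolding f_def by simp
qed

end

section \<open>The flow map: Lipschitz dependence, bijectivity, differentiability\<close>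

text \<open>Every \<open>X s\<close> is prescribed only pointwise, through the trajectories of
  individual starting points; its regularity in the starting point is derived below.\<close>

locale tangential_flow = tangential_field +
  fixes X :: "real \<Rightarrow> 'a \<Rightarrow> 'a"
  assumes X_0: "\<And>x. x \<in> closure \<Omega> \<Longrightarrow> X 0 x = x"
    and X_curve: "\<And>x. x \<in> closure \<Omega> \<Longrightarrow> integral_curve (\<lambda>s. X s x)"
begin

lemma flow_in_domain: "x \<in> \<Omega> \<Longrightarrow> s \<in> {0..T} \<Longrightarrow> X s x \<in> \<Omega>"
  by (rule integral_curve_interior[of "\<lambda>s. X s x" 0, OF X_curve]) (use T X_0 in_closure in auto)

lemma flow_inj: "s \<in> {0..T} \<Longrightarrow> inj_on (X s) \<Omega>"
proof (rule inj_onI)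
  fix x y assume s: "s \<in> {0..T}" and xy: "x \<in> \<Omega>" "y \<in> \<Omega>" "X s x = X s y"
  have "X 0 x = X 0 y"
    by (rule integral_curve_unique[OF X_curve X_curve s xy(3)])
      (use xy in_closure flow_in_domain[OF _ s] T in auto)
  then show "x = y" using X_0 xy in_closure by auto
qed

text \<open>The trajectory is a compact subset of the open set \<Omega>. A radius valid for all
  times allows Lipschitz bounds on balls that move with it.\<close>

lemma flow_tube:
  assumes "x0 \<in> \<Omega>"
  obtains \<rho> where "0 < \<rho>" "\<And>s. s \<in> {0..T} \<Longrightarrow> ball (X s x0) \<rho> \<subseteq> \<Omega>"
proof -
  have "compact ((\<lambda>s. X s x0) ` {0..T})"
    using integral_curve_continuous[OF X_curve[OF in_closure[OF assms]]]
    by (intro compact_continuous_image) auto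
  moreover have "(\<lambda>s. X s x0) ` {0..T} \<subseteq> \<Omega>"
    using flow_in_domain[OF assms] by blast
  ultimately obtain e where "e > 0" "(\<Union>x\<in>(\<lambda>s. X s x0) ` {0..T}. ball x e) \<subseteq> \<Omega>"
    using compact_subset_open_imp_ball_epsilon_subset[OF _ open_domain] by metis
  then show thesis by (intro that[of e]) blast+
qed

text \<open>A bootstrap: Gronwall applies only while the second trajectory stays in the tube, which
  is itself part of the claim. The radius \<open>r\<close> is chosen with
  \<open>r * C = \<rho> / 2\<close>. At the first time when the distance is
  \<open>\<rho> / 2\<close> the estimate is still valid, and it gives a distance strictly below
  \<open>r * C\<close>, a contradiction.\<close>

lemma flow_Lipschitz:
  assumes x0: "x0 \<in> \<Omega>"
  obtains r C where "0 < r" "0 < C" "ball x0 r \<subseteq> \<Omega>"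
    "\<And>s x. s \<in> {0..T} \<Longrightarrow> x \<in> ball x0 r \<Longrightarrow> norm (X s x - X s x0) \<le> C * norm (x - x0)"
proof -
  obtain \<rho> where \<rho>: "0 < \<rho>" "\<And>s. s \<in> {0..T} \<Longrightarrow> ball (X s x0) \<rho> \<subseteq> \<Omega>"
    using flow_tube[OF x0] by blast
  obtain L where L: "0 \<le> L" "\<And>t x. t \<in> {0..T} \<Longrightarrow> x \<in> closure \<Omega> \<Longrightarrow> norm (DV t x) \<le> L"
    using DV_bound by blast
  define C where "C = exp (L * T)"
  have C: "1 \<le> C" unfolding C_def using L T by simp
  define r where "r = \<rho> / (2 * C)"
  have r: "0 < r" "r \<le> \<rho> / 2" "r * C = \<rho> / 2"
    unfolding r_def using \<rho>(1) C by (auto simp: field_simps)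
  have sub: "ball x0 r \<subseteq> \<Omega>"
  proof -
    have "ball x0 r \<subseteq> ball x0 \<rho>"
      by (rule subset_ball) (use r \<rho> in auto)
    then show ?thesis
      using \<rho>(2)[of 0] T X_0[OF in_closure[OF x0]] by auto
  qed
  have est: "norm (X s x - X s x0) \<le> norm (x - x0) * exp (L * s)"
    if x: "x \<in> ball x0 r" and s: "s \<in> {0..T}"
      and near: "\<And>\<sigma>. \<sigma> \<in> {0..s} \<Longrightarrow> norm (X \<sigma> x - X \<sigma> x0) < \<rho>" for s x
  proof -
    have cl: "x \<in> closure \<Omega>" "x0 \<in> closure \<Omega>" using sub x x0 in_closure by auto
    have "norm (X s x - X s x0) \<le> (norm (X 0 x - X 0 x0) + 0 * (s - 0)) * exp (L * (s - 0))"
    proof (rule gronwall_norm[where f = "\<lambda>s. X s x - X s x0" and f' = "\<lambda>s. V s (X s x) - V s (X s x0)"])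
      fix \<sigma> assume \<sigma>: "\<sigma> \<in> {0..s}"
      show "((\<lambda>s. X s x - X s x0) has_vector_derivative V \<sigma> (X \<sigma> x) - V \<sigma> (X \<sigma> x0)) (at \<sigma> within {0..s})"
        using s by (intro has_vector_derivative_diff integral_curveD[OF X_curve] cl \<sigma>) auto
      have \<sigma>T: "\<sigma> \<in> {0..T}" using \<sigma> s by auto
      have "norm (V \<sigma> (X \<sigma> x) - V \<sigma> (X \<sigma> x0)) \<le> L * norm (X \<sigma> x - X \<sigma> x0)"
        by (rule V_Lipschitz[OF L(2) _ \<rho>(2)[OF \<sigma>T] \<sigma>T])
          (use near[OF \<sigma>] \<rho>(1) in \<open>auto simp: dist_norm norm_minus_commute\<close>)
      then show "norm (V \<sigma> (X \<sigma> x) - V \<sigma> (X \<sigma> x0)) \<le> L * norm (X \<sigma> x - X \<sigma> x0) + 0"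
        by simp
    qed (use L s in auto)
    then show ?thesis using X_0 cl by simp
  qed
  have near: "norm (X s x - X s x0) < \<rho> / 2" if x: "x \<in> ball x0 r" and s: "s \<in> {0..T}" for s x
  proof (rule ccontr)
    assume far: "\<not> norm (X s x - X s x0) < \<rho> / 2"
    have cl: "x \<in> closure \<Omega>" "x0 \<in> closure \<Omega>" using sub x x0 in_closure by auto
    define f where "f \<sigma> = norm (X \<sigma> x - X \<sigma> x0)" for \<sigma>
    have contf: "continuous_on {0..T} f"
      unfolding f_def by (intro continuous_intros integral_curve_continuous X_curve cl)
    have dx: "norm (x - x0) < r" using x by (simp add: dist_norm norm_minus_commute)
    have "closed {\<sigma>\<in>{0..T}. \<rho> / 2 \<le> f \<sigma>}"
      using continuous_closed_preimage[OF contf _ closed_atLeast[of "\<rho> / 2"]] by (simp add: vimage_def Int_def)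
    moreover have "bounded {\<sigma>\<in>{0..T}. \<rho> / 2 \<le> f \<sigma>}"
      by (rule bounded_subset[of "{0..T}"]) auto
    moreover have "s \<in> {\<sigma>\<in>{0..T}. \<rho> / 2 \<le> f \<sigma>}" using s far unfolding f_def by auto
    \<comment> \<open>\<open>s1\<close> is the first time at distance at least
      \<open>\<rho> / 2\<close>. Since the initial distance is no larger than
      \<open>\<rho> / 2\<close>, the intermediate value theorem forces equality at
      \<open>s1\<close>.\<close>
    ultimately obtain s1 where s1: "s1 \<in> {0..T}" "\<rho> / 2 \<le> f s1"
      "\<And>\<sigma>. \<sigma> \<in> {0..T} \<Longrightarrow> \<rho> / 2 \<le> f \<sigma> \<Longrightarrow> s1 \<le> \<sigma>"
      using compact_attains_inf[of "{\<sigma>\<in>{0..T}. \<rho> / 2 \<le> f \<sigma>}"] by (auto simp: compact_eq_bounded_closed)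
    have f0: "f 0 \<le> \<rho> / 2" unfolding f_def using X_0 cl dx r by simp
    have "continuous_on {0..s1} f" using contf s1(1) by (elim continuous_on_subset) auto
    then obtain s2 where "0 \<le> s2" "s2 \<le> s1" "f s2 = \<rho> / 2"
      using IVT'[of f 0 "\<rho> / 2" s1] f0 s1 by auto
    then have fs1: "f s1 = \<rho> / 2" using s1(1) s1(3)[of s2] by auto
    have "f s1 \<le> norm (x - x0) * exp (L * s1)"
      unfolding f_def
    proof (rule est[OF x s1(1)])
      fix \<sigma> assume "\<sigma> \<in> {0..s1}"
      then have "f \<sigma> \<le> \<rho> / 2" using s1(1) s1(3)[of \<sigma>] fs1 by (cases "\<sigma> = s1") force+
      then show "norm (X \<sigma> x - X \<sigma> x0) < \<rho>" unfolding f_def using \<rho>(1) by simp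
    qed
    also have "\<dots> \<le> norm (x - x0) * C"
      unfolding C_def using L(1) s1(1) by (intro mult_left_mono) (auto intro: mult_left_mono)
    also have "\<dots> < r * C" using dx C by (intro mult_strict_right_mono) auto
    finally show False using s1(2) r(3) by simp
  qed
  show thesis
  proof (rule that[OF r(1) _ sub, of C])
    show "0 < C" using C by simp
    fix s x assume s: "s \<in> {0..T}" and x: "x \<in> ball x0 r"
    have "norm (X s x - X s x0) \<le> norm (x - x0) * exp (L * s)"
    proof (rule est[OF x s])
      fix \<sigma> assume "\<sigma> \<in> {0..s}"
      then show "norm (X \<sigma> x - X \<sigma> x0) < \<rho>" using near[OF x, of \<sigma>] s \<rho>(1) by auto
    qed
    also have "\<dots> \<le> norm (x - x0) * C"
      unfolding C_def using L(1) s by (intro mult_left_mono) (auto intro: mult_left_mono)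
    finally show "norm (X s x - X s x0) \<le> C * norm (x - x0)" by (simp add: mult.commute)
  qed
qed

lemma flow_continuous: "s \<in> {0..T} \<Longrightarrow> continuous_on \<Omega> (X s)"
proof (rule continuous_at_imp_continuous_on, rule ballI)
  fix x0 assume s: "s \<in> {0..T}" and x0: "x0 \<in> \<Omega>"
  obtain r C where rC: "0 < r" "0 < C" "ball x0 r \<subseteq> \<Omega>"
    "\<And>s x. s \<in> {0..T} \<Longrightarrow> x \<in> ball x0 r \<Longrightarrow> norm (X s x - X s x0) \<le> C * norm (x - x0)"
    using flow_Lipschitz[OF x0] by blast
  show "isCont (X s) x0"
    unfolding continuous_at_eps_delta
  proof (intro allI impI)
    fix e :: real assume e: "e > 0"
    show "\<exists>d>0. \<forall>x'. dist x' x0 < d \<longrightarrow> dist (X s x') (X s x0) < e"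
    proof (intro exI[of _ "min r (e / C)"] conjI allI impI)
      fix x' assume x': "dist x' x0 < min r (e / C)"
      then have "dist (X s x') (X s x0) \<le> C * dist x' x0"
        using rC(4)[OF s, of x'] by (simp add: dist_norm norm_minus_commute)
      also have "\<dots> < e" using x' rC(2) by (simp add: field_simps)
      finally show "dist (X s x') (X s x0) < e" .
    qed (use e rC in auto)
  qed
qed

text \<open>Uniform continuity of \<open>V\<close> on the compact space-time set turns uniform
  convergence of the curves into uniform convergence of their derivatives, so the limit may be
  differentiated.\<close>

lemma integral_curve_limit:
  assumes F: "\<And>n. integral_curve (F n)"
    and unif: "uniform_limit {0..T} F \<gamma> sequentially"
  shows "integral_curve \<gamma>"
proof -
  have Fcl: "F n s \<in> closure \<Omega>" if "s \<in> {0..T}" for n s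
    using F that unfolding integral_curve_def by blast
  have lim: "(\<lambda>n. F n s) \<longlonglongrightarrow> \<gamma> s" if "s \<in> {0..T}" for s
    by (rule tendsto_uniform_limitI[OF unif that])
  have cl: "\<gamma> s \<in> closure \<Omega>" if "s \<in> {0..T}" for s
    by (rule closed_sequentially[OF closed_closure _ lim[OF that]]) (rule Fcl[OF that])
  have "\<exists>g. \<forall>s\<in>{0..T}. (\<lambda>n. F n s) \<longlonglongrightarrow> g s \<and> (g has_derivative (\<lambda>h. h *\<^sub>R V s (\<gamma> s))) (at s within {0..T})"
  proof (rule has_derivative_sequence)
    show "convex {0..T}" by simp
    show "(F n has_derivative (\<lambda>h. h *\<^sub>R V s (F n s))) (at s within {0..T})" if "s \<in> {0..T}" for n s
      using F that unfolding integral_curve_def has_vector_derivative_def by blast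
    show "0 \<in> {0..T}" using T by simp
    show "(\<lambda>n. F n 0) \<longlonglongrightarrow> \<gamma> 0" using lim T by simp
    fix e :: real assume e: "e > 0"
    have "uniformly_continuous_on ({0..T} \<times> closure \<Omega>) (\<lambda>(t, x). V t x)"
      by (rule compact_uniformly_continuous[OF V_cont compact_spacetime])
    then obtain d where d: "d > 0" "\<And>p p'. p \<in> {0..T} \<times> closure \<Omega> \<Longrightarrow> p' \<in> {0..T} \<times> closure \<Omega> \<Longrightarrow>
        dist p' p < d \<Longrightarrow> dist (case p' of (t, x) \<Rightarrow> V t x) (case p of (t, x) \<Rightarrow> V t x) < e"
      using e unfolding uniformly_continuous_on_def by blast
    have "\<forall>\<^sub>F n in sequentially. \<forall>s\<in>{0..T}. dist (F n s) (\<gamma> s) < d"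
      using unif d(1) unfolding uniform_limit_iff by blast
    then show "\<forall>\<^sub>F n in sequentially. \<forall>s\<in>{0..T}. \<forall>h. norm (h *\<^sub>R V s (F n s) - h *\<^sub>R V s (\<gamma> s)) \<le> e * norm h"
    proof eventually_elim
      case (elim n)
      show ?case
      proof (intro ballI allI)
        fix s and h :: real assume s: "s \<in> {0..T}"
        have "dist (s, F n s) (s, \<gamma> s) < d"
          using elim s by (simp add: dist_Pair_Pair)
        then have "norm (V s (F n s) - V s (\<gamma> s)) < e"
          using d(2)[of "(s, \<gamma> s)" "(s, F n s)"] s Fcl[OF s] cl[OF s] by (simp add: dist_norm)
        then show "norm (h *\<^sub>R V s (F n s) - h *\<^sub>R V s (\<gamma> s)) \<le> e * norm h"
          using mult_left_mono[of "norm (V s (F n s) - V s (\<gamma> s))" e "\<bar>h\<bar>"]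
          by (simp flip: scaleR_diff_right add: mult.commute[of e])
      qed
    qed
  qed
  then obtain g where g: "\<And>s. s \<in> {0..T} \<Longrightarrow> (\<lambda>n. F n s) \<longlonglongrightarrow> g s"
    "\<And>s. s \<in> {0..T} \<Longrightarrow> (g has_derivative (\<lambda>h. h *\<^sub>R V s (\<gamma> s))) (at s within {0..T})"
    by blast
  have geq: "g s = \<gamma> s" if "s \<in> {0..T}" for s
    by (rule LIMSEQ_unique[OF g(1)[OF that] lim[OF that]])
  show ?thesis
    unfolding integral_curve_def
  proof (intro ballI conjI cl)
    fix s assume s: "s \<in> {0..T}"
    show "(\<gamma> has_vector_derivative V s (\<gamma> s)) (at s within {0..T})"
      unfolding has_vector_derivative_def
      by (rule has_derivative_transform[OF s _ g(2)[OF s]]) (use geq in auto)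
  qed
qed

text \<open>The image is open by invariance of domain. It is relatively closed by compactness:
  trajectories ending at points converging to \<open>y\<close> are equicontinuous because
  \<open>V\<close> is bounded, and Arzela-Ascoli gives a limiting integral curve that ends at
  \<open>y\<close>. Connectedness of \<Omega> finishes the proof.\<close>

lemma flow_surj:
  assumes t: "t \<in> {0..T}"
  shows "X t ` \<Omega> = \<Omega>"
proof -
  have "open (X t ` \<Omega>)"
    by (rule invariance_of_domain[OF flow_continuous[OF t] open_domain flow_inj[OF t]])
  moreover have sub: "X t ` \<Omega> \<subseteq> \<Omega>" using flow_in_domain t by blast
  ultimately have "openin (top_of_set \<Omega>) (X t ` \<Omega>)"
    by (simp add: open_subset)
  moreover have "closedin (top_of_set \<Omega>) (X t ` \<Omega>)"
  proof -
    have "y \<in> X t ` \<Omega>" if y: "y \<in> \<Omega>" "y \<in> closure (X t ` \<Omega>)" for y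
    proof -
      obtain w where w: "\<And>n. w n \<in> X t ` \<Omega>" "w \<longlonglongrightarrow> y"
        using y(2) unfolding closure_sequential by blast
      then have "\<forall>n. \<exists>x\<in>\<Omega>. w n = X t x" by blast
      then obtain x where x: "\<And>n. x n \<in> \<Omega>" "\<And>n. w n = X t (x n)" by metis
      have curve: "integral_curve (\<lambda>s. X s (x n))" for n
        by (rule X_curve[OF in_closure[OF x(1)]])
      have Xcl: "X s (x n) \<in> closure \<Omega>" if "s \<in> {0..T}" for s n
        using curve that unfolding integral_curve_def by blast
      obtain M where M: "\<And>x. x \<in> closure \<Omega> \<Longrightarrow> norm x \<le> M"
        using compact_imp_bounded[OF compact_closure] unfolding bounded_iff by blast
      obtain K where K: "0 \<le> K" "\<And>t x. t \<in> {0..T} \<Longrightarrow> x \<in> closure \<Omega> \<Longrightarrow> norm (V t x) \<le> K"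
        using V_bound by blast
      have lip: "norm (X s (x n) - X s' (x n)) \<le> K * norm (s - s')" if "s \<in> {0..T}" "s' \<in> {0..T}" for s s' n
      proof (rule differentiable_bound[where f' = "\<lambda>\<sigma> h. h *\<^sub>R V \<sigma> (X \<sigma> (x n))" and S = "{0..T}"])
        fix \<sigma> assume \<sigma>: "\<sigma> \<in> {0..T}"
        show "((\<lambda>s. X s (x n)) has_derivative (\<lambda>h. h *\<^sub>R V \<sigma> (X \<sigma> (x n)))) (at \<sigma> within {0..T})"
          using curve \<sigma> unfolding integral_curve_def has_vector_derivative_def by blast
        show "onorm (\<lambda>h. h *\<^sub>R V \<sigma> (X \<sigma> (x n))) \<le> K"
        proof (rule onorm_le)
          fix h :: real
          show "norm (h *\<^sub>R V \<sigma> (X \<sigma> (x n))) \<le> K * norm h"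
            using mult_left_mono[OF K(2)[OF \<sigma> Xcl[OF \<sigma>]], of "\<bar>h\<bar>"] by (simp add: mult.commute[of K])
        qed
      qed (use that in auto)
      obtain \<gamma> k where \<gamma>: "continuous_on {0..T} \<gamma>" "strict_mono (k :: nat \<Rightarrow> nat)"
        "\<And>e. 0 < e \<Longrightarrow> \<exists>N. \<forall>n s. n \<ge> N \<and> s \<in> {0..T} \<longrightarrow> norm (X s (x (k n)) - \<gamma> s) < e"
      proof (rule Arzela_Ascoli[of "{0..T}" "\<lambda>n s. X s (x n)" M])
        show "norm (X s (x n)) \<le> M" if "s \<in> {0..T}" for n s
          by (rule M[OF Xcl[OF that]])
        show "\<exists>d>0. \<forall>n s'. s' \<in> {0..T} \<and> norm (s - s') < d \<longrightarrow> norm (X s (x n) - X s' (x n)) < e"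
          if "s \<in> {0..T}" "0 < e" for s e
        proof (intro exI[of _ "e / (K + 1)"] conjI allI impI)
          show "0 < e / (K + 1)" using that K by simp
          fix n s' assume s': "s' \<in> {0..T} \<and> norm (s - s') < e / (K + 1)"
          then have "norm (X s (x n) - X s' (x n)) \<le> K * norm (s - s')"
            using lip that by blast
          also have "\<dots> \<le> (K + 1) * norm (s - s')" by (simp add: algebra_simps)
          also have "\<dots> < e" using s' K(1) by (simp add: field_simps)
          finally show "norm (X s (x n) - X s' (x n)) < e" .
        qed
      qed auto
      have "uniform_limit {0..T} (\<lambda>n s. X s (x (k n))) \<gamma> sequentially"
        unfolding uniform_limit_iff eventually_sequentially dist_norm using \<gamma>(3) by blast
      then have g: "integral_curve \<gamma>" and lim: "(\<lambda>n. X t (x (k n))) \<longlonglongrightarrow> \<gamma> t"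
        using integral_curve_limit[OF curve] tendsto_uniform_limitI[OF _ t] by blast+
      have "(\<lambda>n. w (k n)) \<longlonglongrightarrow> y"
        using LIMSEQ_subseq_LIMSEQ[OF w(2) \<gamma>(2)] by (simp add: o_def)
      then have \<gamma>t: "\<gamma> t = y"
        using lim unfolding x(2) by (rule LIMSEQ_unique[rotated])
      \<comment> \<open>The limit of the starting points is a priori only in the closure. Since the
        limit curve is interior at time \<open>t\<close>, invariance backwards in time puts its
        start in \<Omega>.\<close>
      have \<gamma>0: "\<gamma> 0 \<in> \<Omega>"
        by (rule integral_curve_interior[OF g t]) (use \<gamma>t y T in auto)
      have "\<gamma> t = X t (\<gamma> 0)"
        by (rule integral_curve_unique[OF g X_curve[OF in_closure[OF \<gamma>0]] _ _ _ t, of 0])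
          (use T X_0 in_closure[OF \<gamma>0] \<gamma>0 in auto)
      then show ?thesis using \<gamma>t \<gamma>0 by blast
    qed
    then have eq: "\<Omega> \<inter> closure (X t ` \<Omega>) = X t ` \<Omega>"
      using sub closure_subset[of "X t ` \<Omega>"] by blast
    have "closedin (top_of_set \<Omega>) (\<Omega> \<inter> closure (X t ` \<Omega>))"
      by (rule closedin_closed_Int) simp
    then show ?thesis unfolding eq .
  qed
  moreover have "X t ` \<Omega> \<noteq> {}" "connected \<Omega>"
    using domain unfolding smooth_bounded_domain_def by auto
  ultimately show ?thesis
    unfolding connected_clopen by blast
qed

text \<open>The candidate \<open>M\<close> solves the variational equation. The remainder
  \<open>X s y - X s x0 - M s (y - x0)\<close> satisfies the same linear equation up to the
  linearisation error of \<open>V\<close>, which is small relative to \<open>norm (y - x0)\<close>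
  by uniform continuity of \<open>DV\<close> and \<open>flow_Lipschitz\<close>. Gronwall then yields
  differentiability.\<close>

lemma flow_has_derivative:
  assumes x0: "x0 \<in> \<Omega>"
  obtains M where "\<And>e. M 0 e = e" "\<And>s. s \<in> {0..T} \<Longrightarrow> (X s has_derivative M s) (at x0)"
    "\<And>s e. s \<in> {0..T} \<Longrightarrow> ((\<lambda>s. M s e) has_vector_derivative DV s (X s x0) (M s e)) (at s within {0..T})"
proof -
  have cl0: "x0 \<in> closure \<Omega>" by (rule in_closure[OF x0])
  have contX: "continuous_on {0..T} (\<lambda>s. X s x0)"
    by (rule integral_curve_continuous[OF X_curve[OF cl0]])
  have "continuous_on {0..T} (\<lambda>s. (s, X s x0))"
    by (intro continuous_intros contX)
  then have contA: "continuous_on {0..T} (\<lambda>s. DV s (X s x0))"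
    using continuous_on_compose2[OF DV_cont, of "{0..T}" "\<lambda>s. (s, X s x0)"] flow_in_domain[OF x0] in_closure
    by (simp add: image_subset_iff)
  have "\<forall>e. \<exists>z. z 0 = e \<and> (\<forall>s\<in>{0..T}. (z has_vector_derivative DV s (X s x0) (z s)) (at s within {0..T}))"
    using linear_ode_exists[OF contA T] by metis
  then obtain Z where Z: "\<And>e. Z e 0 = e"
    "\<And>e s. s \<in> {0..T} \<Longrightarrow> (Z e has_vector_derivative DV s (X s x0) (Z e s)) (at s within {0..T})"
    by metis
  \<comment> \<open>Combining the solutions for basis vectors makes \<open>M s\<close> linear by
    construction, with no appeal to uniqueness for the variational equation.\<close>
  define M where "M s u = (\<Sum>b\<in>Basis. (u \<bullet> b) *\<^sub>R Z b s)" for s u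
  have M0: "M 0 e = e" for e unfolding M_def Z(1) by (rule euclidean_representation)
  have linM: "bounded_linear (M s)" for s
    unfolding M_def by (intro bounded_linear_intros)
  have derM: "((\<lambda>s. M s e) has_vector_derivative DV s (X s x0) (M s e)) (at s within {0..T})"
    if "s \<in> {0..T}" for s e
  proof -
    have "((\<lambda>s. M s e) has_vector_derivative (\<Sum>b\<in>Basis. (e \<bullet> b) *\<^sub>R DV s (X s x0) (Z b s))) (at s within {0..T})"
      unfolding M_def
      by (intro has_vector_derivative_sum bounded_linear.has_vector_derivative[OF bounded_linear_scaleR_right] Z that)
    then show ?thesis
      unfolding M_def by (simp add: blinfun.sum_right blinfun.scaleR_right)
  qed
  obtain L where L: "0 \<le> L" "\<And>t x. t \<in> {0..T} \<Longrightarrow> x \<in> closure \<Omega> \<Longrightarrow> norm (DV t x) \<le> L"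
    using DV_bound by blast
  obtain \<rho> where \<rho>: "0 < \<rho>" "\<And>s. s \<in> {0..T} \<Longrightarrow> ball (X s x0) \<rho> \<subseteq> \<Omega>"
    using flow_tube[OF x0] by blast
  obtain r C where rC: "0 < r" "0 < C" "ball x0 r \<subseteq> \<Omega>"
    "\<And>s x. s \<in> {0..T} \<Longrightarrow> x \<in> ball x0 r \<Longrightarrow> norm (X s x - X s x0) \<le> C * norm (x - x0)"
    using flow_Lipschitz[OF x0] by blast
  have "(X s has_derivative M s) (at x0)" if s: "s \<in> {0..T}" for s
    unfolding has_derivative_at_alt
  proof (intro conjI linM allI impI)
    fix e :: real assume e: "e > 0"
    \<comment> \<open>Chosen to absorb the Gronwall factor at the end; the summand 1 keeps the
      denominator positive when \<open>T = 0\<close>.\<close>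
    define \<epsilon> where "\<epsilon> = e / ((C * T + 1) * exp (L * T))"
    have CT: "0 < C * T + 1" using rC T by (simp add: add_nonneg_pos)
    then have \<epsilon>: "0 < \<epsilon>" unfolding \<epsilon>_def using e by simp
    have "uniformly_continuous_on ({0..T} \<times> closure \<Omega>) (\<lambda>(t, x). DV t x)"
      by (rule compact_uniformly_continuous[OF DV_cont compact_spacetime])
    then obtain \<delta> where \<delta>: "\<delta> > 0" "\<And>p p'. p \<in> {0..T} \<times> closure \<Omega> \<Longrightarrow> p' \<in> {0..T} \<times> closure \<Omega> \<Longrightarrow>
        dist p' p < \<delta> \<Longrightarrow> dist (case p' of (t, x) \<Rightarrow> DV t x) (case p of (t, x) \<Rightarrow> DV t x) < \<epsilon>"
      using \<epsilon> unfolding uniformly_continuous_on_def by blast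
    define \<eta> where "\<eta> = min \<rho> \<delta>"
    have \<eta>: "0 < \<eta>" unfolding \<eta>_def using \<rho> \<delta> by auto
    show "\<exists>d>0. \<forall>y. norm (y - x0) < d \<longrightarrow> norm (X s y - X s x0 - M s (y - x0)) \<le> e * norm (y - x0)"
    proof (intro exI[of _ "min r (\<eta> / C)"] conjI allI impI)
      show "0 < min r (\<eta> / C)" using rC \<eta> by auto
      fix y assume y: "norm (y - x0) < min r (\<eta> / C)"
      then have yr: "y \<in> ball x0 r" by (simp add: dist_norm norm_minus_commute)
      then have cly: "y \<in> closure \<Omega>" using rC(3) in_closure by blast
      let ?R = "\<lambda>s. X s y - X s x0 - M s (y - x0)"
      let ?R' = "\<lambda>s. V s (X s y) - V s (X s x0) - DV s (X s x0) (M s (y - x0))"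
      have "norm (?R s) \<le> (norm (?R 0) + \<epsilon> * C * norm (y - x0) * (s - 0)) * exp (L * (s - 0))"
      proof (rule gronwall_norm[where f' = ?R'])
        fix \<sigma> assume \<sigma>: "\<sigma> \<in> {0..s}"
        then have \<sigma>T: "\<sigma> \<in> {0..T}" using s by auto
        have "((\<lambda>s. M s (y - x0)) has_vector_derivative DV \<sigma> (X \<sigma> x0) (M \<sigma> (y - x0))) (at \<sigma> within {0..s})"
          by (rule has_vector_derivative_within_subset[OF derM[OF \<sigma>T]]) (use s in auto)
        then show "(?R has_vector_derivative ?R' \<sigma>) (at \<sigma> within {0..s})"
          using s by (intro has_vector_derivative_diff integral_curveD[OF X_curve] cl0 cly \<sigma>) auto
        have dist: "norm (X \<sigma> y - X \<sigma> x0) \<le> C * norm (y - x0)" by (rule rC(4)[OF \<sigma>T yr])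
        also have "\<dots> < \<eta>" using y rC(2) by (simp add: field_simps)
        finally have near: "X \<sigma> y \<in> ball (X \<sigma> x0) \<eta>" by (simp add: dist_norm norm_minus_commute)
        \<comment> \<open>The mean value inequality is applied to \<open>V\<close> minus its linear
          part at \<open>X \<sigma> x0\<close>. The derivative of that difference is small on the
          ball of radius \<open>\<eta>\<close>.\<close>
        have "norm ((V \<sigma> (X \<sigma> y) - DV \<sigma> (X \<sigma> x0) (X \<sigma> y)) - (V \<sigma> (X \<sigma> x0) - DV \<sigma> (X \<sigma> x0) (X \<sigma> x0)))
            \<le> \<epsilon> * norm (X \<sigma> y - X \<sigma> x0)"
        proof (rule differentiable_bound[where S = "ball (X \<sigma> x0) \<eta>" and
              f' = "\<lambda>\<xi>. blinfun_apply (DV \<sigma> \<xi> - DV \<sigma> (X \<sigma> x0))"])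
          fix \<xi> assume \<xi>: "\<xi> \<in> ball (X \<sigma> x0) \<eta>"
          then have \<xi>\<Omega>: "\<xi> \<in> \<Omega>" using \<rho>(2)[OF \<sigma>T] unfolding \<eta>_def by auto
          have "((\<lambda>y. V \<sigma> y - DV \<sigma> (X \<sigma> x0) y) has_derivative
             (\<lambda>h. DV \<sigma> \<xi> h - DV \<sigma> (X \<sigma> x0) h)) (at \<xi>)"
            by (intro has_derivative_diff V_deriv[OF \<sigma>T \<xi>\<Omega>] bounded_linear_imp_has_derivative)
              (rule blinfun.bounded_linear_right)
          moreover have "blinfun_apply (DV \<sigma> \<xi> - DV \<sigma> (X \<sigma> x0)) = (\<lambda>h. DV \<sigma> \<xi> h - DV \<sigma> (X \<sigma> x0) h)"
            by (rule ext) (rule blinfun.diff_left)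
          ultimately show "((\<lambda>y. V \<sigma> y - DV \<sigma> (X \<sigma> x0) y) has_derivative
             blinfun_apply (DV \<sigma> \<xi> - DV \<sigma> (X \<sigma> x0))) (at \<xi> within ball (X \<sigma> x0) \<eta>)"
            by (metis has_derivative_at_withinI)
          have "dist (\<sigma>, \<xi>) (\<sigma>, X \<sigma> x0) < \<delta>"
            using \<xi> unfolding \<eta>_def by (simp add: dist_Pair_Pair dist_commute)
          then have "dist (DV \<sigma> \<xi>) (DV \<sigma> (X \<sigma> x0)) < \<epsilon>"
            using \<delta>(2)[of "(\<sigma>, X \<sigma> x0)" "(\<sigma>, \<xi>)"] \<sigma>T in_closure[OF \<xi>\<Omega>] in_closure[OF flow_in_domain[OF x0 \<sigma>T]]
            by simp
          then show "onorm (blinfun_apply (DV \<sigma> \<xi> - DV \<sigma> (X \<sigma> x0))) \<le> \<epsilon>"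
            by (simp add: dist_norm norm_blinfun.rep_eq[symmetric])
        qed (use near \<eta> in auto)
        also have "\<dots> \<le> \<epsilon> * (C * norm (y - x0))"
          using dist \<epsilon> by (intro mult_left_mono) auto
        finally have b1: "norm (V \<sigma> (X \<sigma> y) - V \<sigma> (X \<sigma> x0) - DV \<sigma> (X \<sigma> x0) (X \<sigma> y - X \<sigma> x0)) \<le> \<epsilon> * C * norm (y - x0)"
          by (simp add: blinfun.diff_right algebra_simps)
        have "norm (DV \<sigma> (X \<sigma> x0) (?R \<sigma>)) \<le> norm (DV \<sigma> (X \<sigma> x0)) * norm (?R \<sigma>)"
          by (rule norm_blinfun)
        also have "\<dots> \<le> L * norm (?R \<sigma>)"
          by (intro mult_right_mono L(2) \<sigma>T in_closure flow_in_domain x0) auto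
        finally have b2: "norm (DV \<sigma> (X \<sigma> x0) (?R \<sigma>)) \<le> L * norm (?R \<sigma>)" .
        have "?R' \<sigma> = DV \<sigma> (X \<sigma> x0) (?R \<sigma>) +
           (V \<sigma> (X \<sigma> y) - V \<sigma> (X \<sigma> x0) - DV \<sigma> (X \<sigma> x0) (X \<sigma> y - X \<sigma> x0))"
          by (simp add: blinfun.diff_right)
        also have "norm \<dots> \<le> L * norm (?R \<sigma>) + \<epsilon> * C * norm (y - x0)"
          by (rule norm_triangle_mono[OF b2 b1])
        finally show "norm (?R' \<sigma>) \<le> L * norm (?R \<sigma>) + \<epsilon> * C * norm (y - x0)" .
      qed (use L \<epsilon> rC s in auto)
      also have "?R 0 = 0" using X_0 cl0 cly M0 by simp
      also have "(norm (0::'a) + \<epsilon> * C * norm (y - x0) * (s - 0)) * exp (L * (s - 0))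
          = \<epsilon> * norm (y - x0) * ((C * s) * exp (L * s))" by simp
      also have "\<dots> \<le> \<epsilon> * norm (y - x0) * ((C * T + 1) * exp (L * T))"
      proof (intro mult_left_mono mult_mono)
        have "C * s \<le> C * T"
          using s rC(2) by (intro mult_left_mono) auto
        then show "C * s \<le> C * T + 1" by linarith
        have "L * s \<le> L * T"
          using s L(1) by (intro mult_left_mono) auto
        then show "exp (L * s) \<le> exp (L * T)" by simp
      qed (use \<epsilon> CT in simp_all)
      also have "\<dots> = e * norm (y - x0)"
        unfolding \<epsilon>_def using CT by simp
      finally show "norm (X s y - X s x0 - M s (y - x0)) \<le> e * norm (y - x0)" .
    qed
  qed
  from that[of M, OF M0 this derM] show thesis .
qed

end

section \<open>Jacobian of the flow and change of variables\<close>

lemma sum_Basis_cart: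
  fixes f :: "real^'n \<Rightarrow> 'b::comm_monoid_add"
  shows "(\<Sum>b\<in>Basis. f b) = (\<Sum>i\<in>UNIV. f (axis i 1))"
proof -
  have "(Basis :: (real^'n) set) = (\<lambda>i. axis i 1) ` UNIV"
    by (auto simp: Basis_vec_def)
  then have "(\<Sum>b\<in>Basis. f b) = (\<Sum>b\<in>(\<lambda>i. axis i 1) ` UNIV. f b)"
    by (rule arg_cong)
  also have "\<dots> = (\<Sum>i\<in>UNIV. f (axis i 1))"
    by (subst sum.reindex) (auto simp: inj_on_def axis_eq_axis)
  finally show ?thesis .
qed

lemma trace_matrix_eq_sum_Basis:
  fixes f :: "real^'n \<Rightarrow> real^'n"
  shows "trace (matrix f) = (\<Sum>b\<in>Basis. f b \<bullet> b)"
  unfolding sum_Basis_cart trace_def matrix_def by (simp add: inner_axis)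

lemma divergence_scaleR:
  fixes \<rho> :: "'a::euclidean_space \<Rightarrow> real" and W :: "'a \<Rightarrow> 'a"
  assumes \<rho>: "\<rho> differentiable (at x)" and W: "(W has_derivative D) (at x)"
  shows "divergence (\<lambda>y. \<rho> y *\<^sub>R W y) x = gradient \<rho> x \<bullet> W x + \<rho> x * (\<Sum>b\<in>Basis. D b \<bullet> b)"
proof -
  have "((\<lambda>y. \<rho> y *\<^sub>R W y) has_derivative (\<lambda>h. \<rho> x *\<^sub>R D h + (gradient \<rho> x \<bullet> h) *\<^sub>R W x)) (at x)"
    by (intro has_derivative_scaleR has_derivative_gradient assms)
  note frechet_derivative_at[OF this, symmetric]
  then have "divergence (\<lambda>y. \<rho> y *\<^sub>R W y) x =
      (\<Sum>b\<in>Basis. \<rho> x * (D b \<bullet> b) + (gradient \<rho> x \<bullet> b) * (W x \<bullet> b))"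
    unfolding divergence_def by (simp add: inner_add_left)
  also have "\<dots> = gradient \<rho> x \<bullet> W x + \<rho> x * (\<Sum>b\<in>Basis. D b \<bullet> b)"
    by (simp add: sum.distrib sum_distrib_left flip: euclidean_inner)
  finally show ?thesis .
qed

text \<open>Liouville's formula. Every column of \<open>M\<close> solves the variational equation,
  so Jacobi's formula applies with \<open>A\<close> the matrix of \<open>DV s (X s x)\<close>, whose
  trace is the divergence. From here on the space is \<open>real^'n\<close>, where
  \<open>det\<close> and \<open>matrix\<close> are available.\<close>

lemma flow_det_has_derivative:
  fixes \<Omega> :: "(real^'n) set"
  assumes "tangential_flow \<Omega> V DV T X" and x: "x \<in> \<Omega>"
  obtains M where "det (matrix (M 0)) = 1" "\<And>s. s \<in> {0..T} \<Longrightarrow> (X s has_derivative M s) (at x)"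
    "\<And>s. s \<in> {0..T} \<Longrightarrow> ((\<lambda>s. det (matrix (M s))) has_real_derivative
       (\<Sum>b\<in>Basis. DV s (X s x) b \<bullet> b) * det (matrix (M s))) (at s within {0..T})"
proof -
  interpret tangential_flow \<Omega> V DV T X by fact
  obtain M where M: "\<And>e. M 0 e = e" "\<And>s. s \<in> {0..T} \<Longrightarrow> (X s has_derivative M s) (at x)"
    "\<And>s e. s \<in> {0..T} \<Longrightarrow> ((\<lambda>s. M s e) has_vector_derivative DV s (X s x) (M s e)) (at s within {0..T})"
    using flow_has_derivative[OF x] by blast
  have "matrix (M 0) = mat 1"
    by (simp add: matrix_def mat_def M(1) axis_def vec_eq_iff)
  then have "det (matrix (M 0)) = 1" by simp
  then show thesis
  proof (rule that[OF _ M(2)])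
    fix s assume s: "s \<in> {0..T}"
    have "((\<lambda>s. det (matrix (M s))) has_real_derivative
        trace (matrix (DV s (X s x))) * det (matrix (M s))) (at s within {0..T})"
    proof (rule det_has_derivative_trace)
      fix i j
      have "((\<lambda>s. M s (axis j 1) $ i) has_vector_derivative DV s (X s x) (M s (axis j 1)) $ i) (at s within {0..T})"
        using bounded_linear.has_vector_derivative[OF bounded_linear_vec_nth M(3)[OF s]] .
      moreover have "DV s (X s x) (M s (axis j 1)) = matrix (DV s (X s x)) *v M s (axis j 1)"
        by (simp add: blinfun.bounded_linear_right bounded_linear.linear matrix_works)
      moreover have "(matrix (DV s (X s x)) *v M s (axis j 1)) $ i = (matrix (DV s (X s x)) ** matrix (M s)) $ i $ j"
        by (simp add: matrix_matrix_mult_def matrix_vector_mult_def matrix_def)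
      ultimately show "((\<lambda>s. matrix (M s) $ i $ j) has_real_derivative
          (matrix (DV s (X s x)) ** matrix (M s)) $ i $ j) (at s within {0..T})"
        by (simp add: has_real_derivative_iff_has_vector_derivative matrix_def)
    qed
    then show "((\<lambda>s. det (matrix (M s))) has_real_derivative
       (\<Sum>b\<in>Basis. DV s (X s x) b \<bullet> b) * det (matrix (M s))) (at s within {0..T})"
      unfolding trace_matrix_eq_sum_Basis .
  qed
qed

text \<open>The underlying theorem concerns Lebesgue measurable vector valued functions, hence the
  detour through \<open>real^1\<close>. Returning from \<open>lebesgue\<close> to
  \<open>lborel\<close> requires Borel measurability of the integrand, which is the premise
  \<open>meas\<close>.\<close>

lemma lborel_change_of_variables:
  fixes g :: "real^'n::{finite,wellorder} \<Rightarrow> real^'n::_" and h :: "real^'n::_ \<Rightarrow> real"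
  assumes S: "S \<in> sets borel" and der: "\<And>x. x \<in> S \<Longrightarrow> (g has_derivative g' x) (at x)"
    and inj: "inj_on g S" and h: "set_integrable lborel (g ` S) h"
    and meas: "set_borel_measurable lborel S (\<lambda>x. \<bar>det (matrix (g' x))\<bar> * h (g x))"
  shows "set_integrable lborel S (\<lambda>x. \<bar>det (matrix (g' x))\<bar> * h (g x))"
    and "(LINT x:S|lborel. \<bar>det (matrix (g' x))\<bar> * h (g x)) = (LINT y:g ` S|lborel. h y)"
proof -
  let ?f = "\<lambda>x. \<bar>det (matrix (g' x))\<bar> * h (g x)" and ?h = "\<lambda>y. vec (h y) :: real^1"
  \<comment> \<open>The equivalence holds for any prescribed value of the integral. Taking the
    integral of \<open>h\<close> itself as that value makes one side automatic and delivers
    integrability and equality together.\<close>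
  have "(\<lambda>x. \<bar>det (matrix (g' x))\<bar> *\<^sub>R ?h (g x)) absolutely_integrable_on S \<and>
      integral S (\<lambda>x. \<bar>det (matrix (g' x))\<bar> *\<^sub>R ?h (g x)) = integral (g ` S) ?h \<longleftrightarrow>
      ?h absolutely_integrable_on g ` S \<and> integral (g ` S) ?h = integral (g ` S) ?h"
    using S der inj by (intro has_absolute_integral_change_of_variables) (auto intro: has_derivative_at_withinI)
  then have cov: "?f absolutely_integrable_on S \<and> integral S ?f = integral (g ` S) h \<longleftrightarrow>
      h absolutely_integrable_on g ` S"
    unfolding absolutely_integrable_on_1_iff integral_on_1_eq by (simp add: vec_eq_iff)
  have hL: "set_integrable lebesgue (g ` S) h"
    using h borel_measurable_integrable[OF h[unfolded set_integrable_def]]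
    unfolding set_integrable_def by (simp add: integrable_completion)
  with cov have fL: "set_integrable lebesgue S ?f" and eq: "integral S ?f = integral (g ` S) h" by auto
  show fB: "set_integrable lborel S ?f"
    using fL meas unfolding set_integrable_def set_borel_measurable_def by (simp add: integrable_completion)
  show "(LINT x:S|lborel. ?f x) = (LINT y:g ` S|lborel. h y)"
    unfolding set_borel_integral_eq_integral(2)[OF fB] set_borel_integral_eq_integral(2)[OF h] by (rule eq)
qed

section \<open>Solutions of the WLF system\<close>

locale wlf_solution =
  fixes \<Omega> :: "(real ^ 'n::{finite,wellorder}) set"
    and \<rho> p \<omega>0 :: "real ^ 'n::_ \<Rightarrow> real"
    and q \<omega> \<phi> :: "real \<Rightarrow> real ^ 'n::_ \<Rightarrow> real"
    and \<omega>bar :: "real \<Rightarrow> real"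
    and X :: "real \<Rightarrow> real ^ 'n::_ \<Rightarrow> real ^ 'n::_"
  assumes domain: "smooth_bounded_domain \<Omega>"
    and rho_smooth: "smooth_closure \<Omega> \<rho>"
    and rho_pos: "\<And>x. x \<in> closure \<Omega> \<Longrightarrow> 0 < \<rho> x"
    and p_eq: "\<And>x. p x = \<rho> x / (LINT y:\<Omega>|lborel. \<rho> y)"
    and q0_density: "pos_prob_density_on \<Omega> (q 0)"
    and omega0_eq: "\<And>x. x \<in> \<Omega> \<Longrightarrow> \<omega>0 x = ln (\<rho> x) - ln (q 0 x)"
    and solution: "wlf_system \<Omega> \<rho> \<omega>0 \<omega> \<phi> \<omega>bar X"
    and regular: "wlf_regular \<Omega> \<omega> \<phi>"
    and transport: "\<And>t. 0 \<le> t \<Longrightarrow> pushforward_density \<Omega> (X t) (q 0) (q t)"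
begin

definition Z :: real where "Z = (LINT y:\<Omega>|lborel. \<rho> y)"

text \<open>The relation \<open>\<omega> = ln (\<rho> / q)\<close> solved for \<open>q\<close>.
  Being built from \<open>\<omega>\<close>, it is continuous and positive on the closure.\<close>

definition r :: "real \<Rightarrow> real ^ 'n::_ \<Rightarrow> real" where "r t y = \<rho> y * exp (- \<omega> t y)"

lemma open_domain: "open \<Omega>" and compact_closure: "compact (closure \<Omega>)" and nonempty: "\<Omega> \<noteq> {}"
  using domain unfolding smooth_bounded_domain_def by (auto simp: compact_eq_bounded_closed)

lemma in_closure: "x \<in> \<Omega> \<Longrightarrow> x \<in> closure \<Omega>"
  using closure_subset by blast

lemma domain_borel [measurable]: "\<Omega> \<in> sets borel"
  using open_domain by simp

lemma rho_continuous: "continuous_on (closure \<Omega>) \<rho>"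
  using rho_smooth unfolding smooth_closure_def Ck_closure_def by blast

lemma rho_differentiable: "x \<in> \<Omega> \<Longrightarrow> \<rho> differentiable (at x)"
proof -
  assume x: "x \<in> \<Omega>"
  have "Ck_on 1 \<Omega> \<rho>" using rho_smooth unfolding smooth_closure_def Ck_closure_def by blast
  then show ?thesis
    using Ck_on_differentiable[OF _ open_domain x, where bs = "[]"] by auto
qed

lemma omega_cont_time: "0 < T \<Longrightarrow> cont_time T (hoelder_norm 0 (1/2) \<Omega>) \<omega>"
  and phi_cont_time: "0 < T \<Longrightarrow> cont_time T (hoelder_norm 2 (1/2) \<Omega>) \<phi>"
  using regular unfolding wlf_regular_def by auto

lemma omega_continuous: "0 \<le> t \<Longrightarrow> continuous_on (closure \<Omega>) (\<omega> t)"
proof -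
  assume t: "0 \<le> t"
  have "hoelder_norm 0 (1/2) \<Omega> (\<omega> t) < \<infinity>"
    using omega_cont_time[of "t + 1"] t unfolding cont_time_def by auto
  then have "Ck_closure 0 \<Omega> (\<omega> t)" by (rule hoelder_norm_finite_Ck_closure)
  then show ?thesis unfolding Ck_closure_def by blast
qed

lemma phi_Ck: "0 \<le> t \<Longrightarrow> Ck_on 2 \<Omega> (\<phi> t)"
proof -
  assume t: "0 \<le> t"
  have "hoelder_norm 2 (1/2) \<Omega> (\<phi> t) < \<infinity>"
    using phi_cont_time[of "t + 1"] t unfolding cont_time_def by auto
  then have "Ck_closure 2 \<Omega> (\<phi> t)" by (rule hoelder_norm_finite_Ck_closure)
  then show ?thesis unfolding Ck_closure_def by blast
qed

lemma set_integrable_continuous: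
  fixes f :: "real ^ 'n::_ \<Rightarrow> real"
  assumes "continuous_on (closure \<Omega>) f"
  shows "set_integrable lborel \<Omega> f"
proof -
  have "set_integrable lborel (closure \<Omega>) f"
    unfolding set_integrable_def by (rule borel_integrable_compact[OF compact_closure assms])
  then show ?thesis
    by (rule set_integrable_subset) (auto simp: closure_subset)
qed

lemma r_pos: "y \<in> closure \<Omega> \<Longrightarrow> 0 < r t y"
  unfolding r_def using rho_pos by simp

lemma r_continuous: "0 \<le> t \<Longrightarrow> continuous_on (closure \<Omega>) (r t)"
  unfolding r_def by (intro continuous_intros rho_continuous omega_continuous)

lemmas initial = solution[unfolded wlf_system_def, THEN conjunct1]
  solution[unfolded wlf_system_def, THEN conjunct2, THEN conjunct1]
lemmas evolution = mp[OF spec[OF solution[unfolded wlf_system_def, THEN conjunct2, THEN conjunct2]]]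

lemma omega_0: "x \<in> closure \<Omega> \<Longrightarrow> \<omega> 0 x = \<omega>0 x"
  by (rule initial(1)[THEN bspec])

lemma X_0: "x \<in> closure \<Omega> \<Longrightarrow> X 0 x = x"
  by (rule initial(2)[THEN bspec])

lemma continuity_equation: "0 \<le> t \<Longrightarrow> x \<in> \<Omega> \<Longrightarrow>
    1 / \<rho> x * divergence (\<lambda>y. \<rho> y *\<^sub>R gradient (\<phi> t) y) x = - (\<omega> t x - \<omega>bar t)"
  by (rule evolution[THEN conjunct1, THEN bspec])

lemma X_closure: "0 \<le> t \<Longrightarrow> x \<in> closure \<Omega> \<Longrightarrow> X t x \<in> closure \<Omega>"
  by (rule evolution[THEN conjunct2, THEN conjunct1, THEN bspec, THEN conjunct1])

lemma omega_flow: "0 \<le> t \<Longrightarrow> x \<in> closure \<Omega> \<Longrightarrow>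
    ((\<lambda>s. \<omega> s (X s x)) has_real_derivative - (\<omega> t (X t x) - \<omega>bar t)) (at t within {0..})"
  by (rule evolution[THEN conjunct2, THEN conjunct1, THEN bspec, THEN conjunct2, THEN conjunct1])

lemma X_flow: "0 \<le> t \<Longrightarrow> x \<in> closure \<Omega> \<Longrightarrow>
    ((\<lambda>s. X s x) has_vector_derivative gradient_cl \<Omega> (\<phi> t) (X t x)) (at t within {0..})"
  by (rule evolution[THEN conjunct2, THEN conjunct1, THEN bspec, THEN conjunct2, THEN conjunct2])

lemma neumann:
  "0 \<le> t \<Longrightarrow> z \<in> frontier \<Omega> \<Longrightarrow> outward_normal \<Omega> z n \<Longrightarrow> gradient_cl \<Omega> (\<phi> t) z \<bullet> n = 0"
  by (rule evolution[THEN conjunct2, THEN conjunct2, THEN conjunct1, THEN bspec, THEN spec, THEN mp])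

lemma omega_mean: "0 \<le> t \<Longrightarrow> (LINT x:\<Omega>|lborel. \<rho> x * (\<omega> t x - \<omega>bar t)) = 0"
  by (rule evolution[THEN conjunct2, THEN conjunct2, THEN conjunct2, THEN conjunct1])

lemma q0_eq: "x \<in> \<Omega> \<Longrightarrow> q 0 x = \<rho> x * exp (- \<omega>0 x)"
proof -
  assume x: "x \<in> \<Omega>"
  have "0 < \<rho> x" "0 < q 0 x"
    using rho_pos in_closure x q0_density unfolding pos_prob_density_on_def by auto
  then show ?thesis
    unfolding omega0_eq[OF x] by (simp add: exp_diff)
qed

section \<open>Jacobian identity and identification of the transported density\<close>

text \<open>The Neumann condition speaks of unit normals; undoing the normalisation gives tangency
  for every local defining function. Since \<open>gradient_cl\<close> agrees with
  \<open>gradient\<close> on the open set \<Omega>, it inherits the Hessian as derivative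
  there.\<close>

lemma tangential_flow:
  assumes T: "0 < T"
  obtains DV where "tangential_flow \<Omega> (\<lambda>t. gradient_cl \<Omega> (\<phi> t)) DV T X"
    "\<And>t x. t \<in> {0..T} \<Longrightarrow> x \<in> \<Omega> \<Longrightarrow> DV t x = hessian (\<phi> t) x"
    "\<And>t x. t \<in> {0..T} \<Longrightarrow> x \<in> \<Omega> \<Longrightarrow> gradient_cl \<Omega> (\<phi> t) x = gradient (\<phi> t) x"
proof -
  obtain DV where DV: 
    "continuous_on ({0..T} \<times> closure \<Omega>) (\<lambda>(t, x). gradient_cl \<Omega> (\<phi> t) x)"
    "continuous_on ({0..T} \<times> closure \<Omega>) (\<lambda>(t, x). DV t x)"
    "\<And>t x. t \<in> {0..T} \<Longrightarrow> x \<in> \<Omega> \<Longrightarrow> DV t x = hessian (\<phi> t) x"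
    "\<And>t x. t \<in> {0..T} \<Longrightarrow> x \<in> \<Omega> \<Longrightarrow> gradient_cl \<Omega> (\<phi> t) x = gradient (\<phi> t) x"
    using cont_time_gradient_hessian[OF open_domain phi_cont_time[OF T]] by blast
  interpret tangential_field \<Omega> "\<lambda>t. gradient_cl \<Omega> (\<phi> t)" DV T
  proof
    show "smooth_bounded_domain \<Omega>" by (rule domain)
    show "0 \<le> T" using T by simp
    show "continuous_on ({0..T} \<times> closure \<Omega>) (\<lambda>(t, x). gradient_cl \<Omega> (\<phi> t) x)" by (rule DV)
    show "continuous_on ({0..T} \<times> closure \<Omega>) (\<lambda>(t, x). DV t x)" by (rule DV)
    show "(gradient_cl \<Omega> (\<phi> t) has_derivative DV t x) (at x)" if "t \<in> {0..T}" "x \<in> \<Omega>" for t x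
    proof -
      have "(gradient (\<phi> t) has_derivative DV t x) (at x)"
        unfolding DV(3)[OF that]
        by (rule has_derivative_gradient_hessian[OF phi_Ck open_domain]) (use that in auto)
      then show ?thesis
        by (rule has_derivative_transform_within_open[OF _ open_domain that(2)]) (use DV(4) that in auto)
    qed
    show "gradient g z \<bullet> gradient_cl \<Omega> (\<phi> t) z = 0"
      if "t \<in> {0..T}" "z \<in> frontier \<Omega>" "local_defining_function \<Omega> z U g" for t z U g
    proof -
      have "gradient g z \<noteq> 0"
        using that(3) unfolding local_defining_function_def by blast
      moreover have "outward_normal \<Omega> z (gradient g z /\<^sub>R norm (gradient g z))"
        using that(3) unfolding outward_normal_def by blast
      then have "gradient_cl \<Omega> (\<phi> t) z \<bullet> (gradient g z /\<^sub>R norm (gradient g z)) = 0"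
        using that(1) by (intro neumann that(2)) auto
      ultimately show ?thesis by (simp add: inner_commute)
    qed
  qed
  show thesis
  proof (rule that[OF _ DV(3,4)])
    show "tangential_flow \<Omega> (\<lambda>t. gradient_cl \<Omega> (\<phi> t)) DV T X"
    proof
      show "X 0 x = x" if "x \<in> closure \<Omega>" for x by (rule X_0[OF that])
      show "integral_curve (\<lambda>s. X s x)" if "x \<in> closure \<Omega>" for x
        unfolding integral_curve_def
      proof (intro ballI conjI)
        fix s assume "s \<in> {0..T}"
        then have s: "0 \<le> s" by simp
        show "X s x \<in> closure \<Omega>" by (rule X_closure[OF s that])
        show "((\<lambda>s. X s x) has_vector_derivative gradient_cl \<Omega> (\<phi> s) (X s x)) (at s within {0..T})"
          by (rule has_vector_derivative_within_subset[OF X_flow[OF s that]]) auto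
      qed
    qed
  qed
qed

lemma X_domain:
  assumes t: "0 \<le> t"
  shows "X t ` \<Omega> = \<Omega>" "inj_on (X t) \<Omega>" "continuous_on \<Omega> (X t)"
proof -
  \<comment> \<open>The regularity assumptions are available on \<open>{0..T}\<close> for positive
    \<open>T\<close> only, while \<open>t\<close> may be 0.\<close>
  have "0 < t + 1" using t by simp
  then obtain DV where "tangential_flow \<Omega> (\<lambda>t. gradient_cl \<Omega> (\<phi> t)) DV (t + 1) X"
    using tangential_flow by metis
  then interpret tangential_flow \<Omega> "\<lambda>t. gradient_cl \<Omega> (\<phi> t)" DV "t + 1" X .
  show "X t ` \<Omega> = \<Omega>" "inj_on (X t) \<Omega>" "continuous_on \<Omega> (X t)"
    using flow_surj flow_inj flow_continuous t by auto
qed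

text \<open>The product \<open>J s * r s (X s x)\<close> is differentiated directly, not its
  logarithm, because the sign of \<open>J\<close> is not known beforehand. Once the product is known
  to equal the positive number \<open>q 0 x\<close>, positivity of \<open>r\<close> forces
  \<open>J t\<close> to be positive, and the absolute value is harmless.\<close>

lemma X_jacobian:
  assumes t: "0 \<le> t" and x: "x \<in> \<Omega>"
  obtains D where "(X t has_derivative D) (at x)" "\<bar>det (matrix D)\<bar> * r t (X t x) = q 0 x"
proof -
  define T where "T = t + 1"
  have T: "0 < T" "t \<in> {0..T}" "0 \<in> {0..T}" unfolding T_def using t by auto
  obtain DV where flow: "tangential_flow \<Omega> (\<lambda>t. gradient_cl \<Omega> (\<phi> t)) DV T X"
    and DV: "\<And>t x. t \<in> {0..T} \<Longrightarrow> x \<in> \<Omega> \<Longrightarrow> DV t x = hessian (\<phi> t) x"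
    "\<And>t x. t \<in> {0..T} \<Longrightarrow> x \<in> \<Omega> \<Longrightarrow> gradient_cl \<Omega> (\<phi> t) x = gradient (\<phi> t) x"
    by (rule tangential_flow[OF T(1)]) (rule that; assumption)
  obtain M where M: "det (matrix (M 0)) = 1" "\<And>s. s \<in> {0..T} \<Longrightarrow> (X s has_derivative M s) (at x)"
    "\<And>s. s \<in> {0..T} \<Longrightarrow> ((\<lambda>s. det (matrix (M s))) has_real_derivative
       (\<Sum>b\<in>Basis. DV s (X s x) b \<bullet> b) * det (matrix (M s))) (at s within {0..T})"
    by (rule flow_det_has_derivative[OF flow x]) (rule that; assumption)
  define J where "J s = det (matrix (M s))" for s
  have "((\<lambda>s. J s * r s (X s x)) has_real_derivative 0) (at s within {0..T})" if s: "s \<in> {0..T}" for s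
  proof -
    have s0: "0 \<le> s" using s by simp
    have y: "X s x \<in> \<Omega>" using X_domain(1)[OF s0] x by blast
    let ?y = "X s x" and ?v = "gradient (\<phi> s) (X s x)"
    let ?tr = "\<Sum>b\<in>Basis. hessian (\<phi> s) ?y b \<bullet> b"
    have dJ: "(J has_real_derivative ?tr * J s) (at s within {0..T})"
      using M(3)[OF s] unfolding J_def DV(1)[OF s y] .
    have dX: "((\<lambda>s. X s x) has_vector_derivative ?v) (at s within {0..T})"
      using has_vector_derivative_within_subset[OF X_flow[OF s0 in_closure[OF x]], of "{0..T}"]
      unfolding DV(2)[OF s y] by auto
    have "((\<rho> \<circ> (\<lambda>s. X s x)) has_vector_derivative gradient \<rho> ?y \<bullet> ?v) (at s within {0..T})"
      by (rule vector_derivative_diff_chain_within[OF dX])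
        (rule has_derivative_at_withinI[OF has_derivative_gradient[OF rho_differentiable[OF y]]])
    then have d\<rho>: "((\<lambda>s. \<rho> (X s x)) has_real_derivative gradient \<rho> ?y \<bullet> ?v) (at s within {0..T})"
      unfolding o_def has_real_derivative_iff_has_vector_derivative .
    have d\<omega>: "((\<lambda>s. \<omega> s (X s x)) has_real_derivative - (\<omega> s ?y - \<omega>bar s)) (at s within {0..T})"
      by (rule DERIV_subset[OF omega_flow[OF s0 in_closure[OF x]]]) auto
    have "1 / \<rho> ?y * (gradient \<rho> ?y \<bullet> ?v + \<rho> ?y * ?tr) = - (\<omega> s ?y - \<omega>bar s)"
      using continuity_equation[OF s0 y]
        divergence_scaleR[OF rho_differentiable[OF y] has_derivative_gradient_hessian[OF phi_Ck[OF s0] open_domain y]]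
      by simp
    then have ce: "gradient \<rho> ?y \<bullet> ?v + \<rho> ?y * ?tr = - (\<omega> s ?y - \<omega>bar s) * \<rho> ?y"
      using rho_pos[OF in_closure[OF y]] by (simp add: field_simps)
    have "((\<lambda>s. J s * (\<rho> (X s x) * exp (- \<omega> s (X s x)))) has_real_derivative
       J s * exp (- \<omega> s ?y) * ((gradient \<rho> ?y \<bullet> ?v + \<rho> ?y * ?tr) + (\<omega> s ?y - \<omega>bar s) * \<rho> ?y)) (at s within {0..T})"
      by (rule derivative_eq_intros dJ d\<rho> d\<omega> refl)+ (simp add: algebra_simps)
    moreover have "J s * exp (- \<omega> s ?y) * ((gradient \<rho> ?y \<bullet> ?v + \<rho> ?y * ?tr) + (\<omega> s ?y - \<omega>bar s) * \<rho> ?y) = 0"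
      unfolding ce by (simp add: algebra_simps)
    ultimately show ?thesis unfolding r_def by (simp only:)
  qed
  then obtain c where c: "\<And>s. s \<in> {0..T} \<Longrightarrow> J s * r s (X s x) = c"
    using has_field_derivative_zero_constant[of "{0..T}" "\<lambda>s. J s * r s (X s x)"] by auto
  have "J 0 * r 0 (X 0 x) = q 0 x"
    using M(1) X_0[OF in_closure[OF x]] omega_0[OF in_closure[OF x]] q0_eq[OF x] unfolding J_def r_def by simp
  then have eq: "J t * r t (X t x) = q 0 x"
    using c[OF T(2)] c[OF T(3)] by simp
  have "0 < q 0 x" using q0_density x unfolding pos_prob_density_on_def by blast
  moreover have "0 < r t (X t x)"
    by (intro r_pos X_closure t in_closure x)
  ultimately have "0 < J t" using eq by (metis zero_less_mult_pos2)
  then show thesis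
    using that[OF M(2)[OF T(2)]] eq unfolding J_def by simp
qed

text \<open>With \<open>r t\<close> as a weight, the Jacobian identity turns the transformed
  integrand into \<open>q 0 x * h (X t x)\<close>, so no determinant remains in the formula.\<close>

lemma change_of_variables:
  assumes t: "0 \<le> t" and h: "set_integrable lborel \<Omega> (\<lambda>y. r t y * h y)"
  shows "set_integrable lborel \<Omega> (\<lambda>x. q 0 x * h (X t x))"
    and "(LINT x:\<Omega>|lborel. q 0 x * h (X t x)) = (LINT y:\<Omega>|lborel. r t y * h y)"
proof -
  have "\<forall>x\<in>\<Omega>. \<exists>D. (X t has_derivative D) (at x) \<and> \<bar>det (matrix D)\<bar> * r t (X t x) = q 0 x"
    using X_jacobian[OF t] by metis
  then obtain D where D: "\<And>x. x \<in> \<Omega> \<Longrightarrow> (X t has_derivative D x) (at x)"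
    "\<And>x. x \<in> \<Omega> \<Longrightarrow> \<bar>det (matrix (D x))\<bar> * r t (X t x) = q 0 x"
    by metis
  have eq: "\<bar>det (matrix (D x))\<bar> * (r t (X t x) * h (X t x)) = q 0 x * h (X t x)" if "x \<in> \<Omega>" for x
    using D(2)[OF that] by (metis mult.assoc)
  \<comment> \<open>Only the product of \<open>r t\<close> and \<open>h\<close> is known to be
    measurable, and only on \<Omega>. Cutting off by the indicator and dividing by the positive
    continuous factor recovers \<open>h\<close>; this writes the integrand as a Borel expression
    without using the determinant.\<close>
  define k where "k y = indicator \<Omega> y *\<^sub>R (r t y * h y)" for y
  define r' where "r' y = indicator \<Omega> y *\<^sub>R r t y" for y
  define X' where "X' x = indicator \<Omega> x *\<^sub>R X t x" for x
  have [measurable]: "k \<in> borel_measurable borel"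
    using borel_measurable_integrable[OF h[unfolded set_integrable_def]] unfolding k_def by simp
  have [measurable]: "r' \<in> borel_measurable borel"
    unfolding r'_def
    by (rule borel_measurable_continuous_on_indicator[OF domain_borel continuous_on_subset[OF r_continuous[OF t] closure_subset]])
  have [measurable]: "X' \<in> borel_measurable borel"
    unfolding X'_def by (rule borel_measurable_continuous_on_indicator[OF domain_borel X_domain(3)[OF t]])
  define q' where "q' x = indicator \<Omega> x *\<^sub>R q 0 x" for x
  have [measurable]: "q' \<in> borel_measurable borel"
    using q0_density unfolding q'_def pos_prob_density_on_def set_integrable_def
    by (auto dest: borel_measurable_integrable)
  have "indicator \<Omega> x *\<^sub>R (q 0 x * h (X t x)) = q' x * (k (X' x) / r' (X' x))" for x
  proof (cases "x \<in> \<Omega>")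
    case True
    then have "X t x \<in> \<Omega>" using X_domain(1)[OF t] by blast
    moreover have "0 < r t (X t x)" by (intro r_pos X_closure t in_closure True)
    ultimately show ?thesis using True unfolding k_def r'_def X'_def q'_def by simp
  qed (simp add: q'_def)
  then have meas: "set_borel_measurable lborel \<Omega> (\<lambda>x. q 0 x * h (X t x))"
    unfolding set_borel_measurable_def by (simp only: measurable_lborel1) measurable
  have "indicator \<Omega> x *\<^sub>R (\<bar>det (matrix (D x))\<bar> * (r t (X t x) * h (X t x))) =
      indicator \<Omega> x *\<^sub>R (q 0 x * h (X t x))" for x
    using eq[of x] by (cases "x \<in> \<Omega>") auto
  then have meas': "set_borel_measurable lborel \<Omega> (\<lambda>x. \<bar>det (matrix (D x))\<bar> * (r t (X t x) * h (X t x)))"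
    using meas unfolding set_borel_measurable_def by (simp only:)
  have h': "set_integrable lborel (X t ` \<Omega>) (\<lambda>y. r t y * h y)"
    unfolding X_domain(1)[OF t] by (rule h)
  have cov: "set_integrable lborel \<Omega> (\<lambda>x. \<bar>det (matrix (D x))\<bar> * (r t (X t x) * h (X t x)))"
    "(LINT x:\<Omega>|lborel. \<bar>det (matrix (D x))\<bar> * (r t (X t x) * h (X t x))) = (LINT y:\<Omega>|lborel. r t y * h y)"
    using lborel_change_of_variables[of \<Omega> "X t" D "\<lambda>y. r t y * h y", OF domain_borel D(1) X_domain(2)[OF t] h' meas']
    unfolding X_domain(1)[OF t] by auto
  have "set_integrable lborel \<Omega> (\<lambda>x. \<bar>det (matrix (D x))\<bar> * (r t (X t x) * h (X t x))) \<longleftrightarrow>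
      set_integrable lborel \<Omega> (\<lambda>x. q 0 x * h (X t x))"
    by (rule set_integrable_cong) (use eq in auto)
  then show "set_integrable lborel \<Omega> (\<lambda>x. q 0 x * h (X t x))"
    using cov(1) by blast
  have "(LINT x:\<Omega>|lborel. q 0 x * h (X t x)) =
      (LINT x:\<Omega>|lborel. \<bar>det (matrix (D x))\<bar> * (r t (X t x) * h (X t x)))"
    by (rule set_lebesgue_integral_cong) (simp, intro allI impI, rule eq[symmetric])
  then show "(LINT x:\<Omega>|lborel. q 0 x * h (X t x)) = (LINT y:\<Omega>|lborel. r t y * h y)"
    using cov(2) by simp
qed

lemma q0_nonneg: "x \<in> \<Omega> \<Longrightarrow> 0 < q 0 x"
  and q0_integrable: "set_integrable lborel \<Omega> (q 0)"
  and q0_integral: "(LINT x:\<Omega>|lborel. q 0 x) = 1"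
  using q0_density unfolding pos_prob_density_on_def by auto

text \<open>Both functions are tested on an arbitrary Borel set. The push-forward property and
  \<open>change_of_variables\<close> with the indicator of that set give the same integral over the
  \<open>q 0\<close> side, and integrable densities with equal set integrals agree almost
  everywhere.\<close>

lemma q_eq_r:
  assumes t: "0 \<le> t"
  shows "AE y in lborel. y \<in> \<Omega> \<longrightarrow> q t y = r t y"
proof -
  let ?N = "restrict_space lborel \<Omega>"
  let ?M = "density ?N (\<lambda>x. ennreal (q 0 x))"
  let ?f = "\<lambda>y. q t y * indicator \<Omega> y" and ?r = "\<lambda>y. r t y * indicator \<Omega> y"
  have \<Omega>[simp]: "\<Omega> \<inter> space lborel \<in> sets lborel" by simp
  have q_nonneg: "0 \<le> q t y" if "y \<in> \<Omega>" for y
    using transport[OF t] that unfolding pushforward_density_def by blast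
  have distr: "distributed ?M lborel (X t) (\<lambda>y. ennreal (?f y))"
  proof -
    have "(\<lambda>y. ennreal (q t y) * indicator \<Omega> y) = (\<lambda>y. ennreal (?f y))"
      by (auto simp: indicator_def)
    then show ?thesis
      using transport[OF t] unfolding pushforward_density_def by simp
  qed
  have f_nonneg: "0 \<le> ?f y" for y using q_nonneg by (simp add: indicator_def)
  have q0_meas: "q 0 \<in> borel_measurable ?N"
    using q0_integrable unfolding set_integrable_def integrable_restrict_space[OF \<Omega>, symmetric]
    by (rule borel_measurable_integrable)
  have q0_AE: "AE x in ?N. 0 \<le> q 0 x"
    using q0_nonneg by (auto simp: AE_restrict_space_iff intro: less_imp_le)
  have X_meas: "X t \<in> measurable ?N lborel"
    using distr unfolding distributed_def by simp
  have r_int: "set_integrable lborel \<Omega> (r t)"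
    by (rule set_integrable_continuous[OF r_continuous[OF t]])
  have key: "integrable lborel (\<lambda>y. ?f y * indicator A y) \<and>
      (\<integral>y. ?f y * indicator A y \<partial>lborel) = (\<integral>y. ?r y * indicator A y \<partial>lborel)"
    if A: "A \<in> sets borel" for A
  proof -
    let ?g = "indicator A :: _ \<Rightarrow> real"
    have g: "?g \<in> borel_measurable lborel" using A by simp
    have gX: "(\<lambda>x. ?g (X t x)) \<in> borel_measurable ?N"
      by (rule measurable_compose[OF X_meas g])
    have "set_integrable lborel \<Omega> (\<lambda>y. r t y * ?g y)"
      using integrable_mult_indicator[OF _ r_int[unfolded set_integrable_def], of A] A
      unfolding set_integrable_def by (simp add: mult_ac)
    note cov = change_of_variables[OF t this]
    have "integrable ?M (\<lambda>x. ?g (X t x)) \<longleftrightarrow> set_integrable lborel \<Omega> (\<lambda>x. q 0 x * ?g (X t x))"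
      unfolding integrable_density[OF gX q0_meas q0_AE] integrable_restrict_space[OF \<Omega>] set_integrable_def
      by simp
    then have i: "integrable lborel (\<lambda>y. ?f y * ?g y)"
      using cov(1) distributed_integrable[OF distr g f_nonneg] by blast
    have "(\<integral>y. ?f y * ?g y \<partial>lborel) = (\<integral>x. ?g (X t x) \<partial>?M)"
      by (rule distributed_integral[OF distr g f_nonneg])
    also have "\<dots> = (LINT x:\<Omega>|lborel. q 0 x * ?g (X t x))"
      unfolding integral_density[OF gX q0_meas q0_AE] integral_restrict_space[OF \<Omega>] set_lebesgue_integral_def
      by simp
    also have "\<dots> = (LINT y:\<Omega>|lborel. r t y * ?g y)"
      by (rule cov(2))
    also have "\<dots> = (\<integral>y. ?r y * ?g y \<partial>lborel)"
      unfolding set_lebesgue_integral_def by (simp add: mult_ac)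
    finally show ?thesis using i by blast
  qed
  have "AE y in lborel. ?f y = ?r y"
  proof (rule density_unique_real)
    show "integrable lborel ?f" using key[of UNIV] by simp
    show "integrable lborel ?r" using r_int unfolding set_integrable_def by (simp add: mult_ac)
    fix A :: "(real ^ 'n::_) set" assume "A \<in> sets lborel"
    then show "(LINT x:A|lborel. ?f x) = (LINT x:A|lborel. ?r x)"
      using key[of A] unfolding set_lebesgue_integral_def by (simp add: mult_ac)
  qed
  then show ?thesis
    by (rule AE_mp) (auto intro!: AE_I2)
qed

section \<open>Both relative entropies expressed through \<open>\<omega>\<close>\<close>

text \<open>The mean of \<open>\<omega> t\<close> under the transported density, in Lagrangian form:
  the weight \<open>q 0\<close> is fixed, and time enters only through values along
  trajectories.\<close>

definition W :: "real \<Rightarrow> real" where "W t = (LINT x:\<Omega>|lborel. q 0 x * \<omega> t (X t x))"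

lemma r_omega_integrable: "0 \<le> t \<Longrightarrow> set_integrable lborel \<Omega> (\<lambda>y. r t y * \<omega> t y)"
  by (intro set_integrable_continuous continuous_intros r_continuous omega_continuous)

lemma r_integrable: "0 \<le> t \<Longrightarrow> set_integrable lborel \<Omega> (r t)"
  by (intro set_integrable_continuous r_continuous)

lemma rho_integrable: "set_integrable lborel \<Omega> \<rho>"
  by (intro set_integrable_continuous rho_continuous)

lemma W_eq: "0 \<le> t \<Longrightarrow> W t = (LINT y:\<Omega>|lborel. r t y * \<omega> t y)"
  unfolding W_def by (rule change_of_variables(2)[OF _ r_omega_integrable])

lemma r_integral:
  assumes "0 \<le> t"
  shows "(LINT y:\<Omega>|lborel. r t y) = 1"
  using change_of_variables(2)[OF assms, of "\<lambda>_. 1"] r_integrable[OF assms] q0_integral by simp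

text \<open>If the integral of the positive function \<open>\<rho>\<close> over \<Omega> were 0,
  then \<Omega> would be a null set, although \<open>q 0\<close> integrates to 1 over it.\<close>

lemma Z_pos: "0 < Z"
proof -
  have int: "integrable lborel (\<lambda>x. indicator \<Omega> x *\<^sub>R \<rho> x)"
    using rho_integrable unfolding set_integrable_def .
  have nonneg: "0 \<le> indicator \<Omega> x *\<^sub>R \<rho> x" for x
    using rho_pos[OF in_closure, of x] by (cases "x \<in> \<Omega>") auto
  have "Z \<noteq> 0"
  proof
    assume "Z = 0"
    then have "AE x in lborel. indicator \<Omega> x *\<^sub>R \<rho> x = 0"
      using integral_nonneg_eq_0_iff_AE[OF int] nonneg unfolding Z_def set_lebesgue_integral_def by simp
    then have "AE x in lborel. indicator \<Omega> x *\<^sub>R q 0 x = 0"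
    proof (rule AE_mp, intro AE_I2 impI)
      fix x assume "indicator \<Omega> x *\<^sub>R \<rho> x = 0"
      then show "indicator \<Omega> x *\<^sub>R q 0 x = 0"
        using rho_pos[OF in_closure, of x] by (cases "x \<in> \<Omega>") auto
    qed
    then have "(LINT x:\<Omega>|lborel. q 0 x) = 0"
      unfolding set_lebesgue_integral_def by (rule integral_eq_zero_AE)
    then show False using q0_integral by simp
  qed
  moreover have "0 \<le> Z"
    unfolding Z_def set_lebesgue_integral_def by (intro Bochner_Integration.integral_nonneg nonneg)
  ultimately show ?thesis by simp
qed

text \<open>\<open>lborel\<close> is not complete, so equality almost everywhere does not transfer
  Borel measurability; it has to be supplied for \<open>f\<close> separately.\<close>

lemma set_integrable_integral_cong_AE:
  fixes f g :: "real ^ 'n::_ \<Rightarrow> real"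
  assumes g: "set_integrable lborel \<Omega> g" and f: "set_borel_measurable lborel \<Omega> f"
    and eq: "AE x in lborel. x \<in> \<Omega> \<longrightarrow> f x = g x"
  shows "set_integrable lborel \<Omega> f" "(LINT x:\<Omega>|lborel. f x) = (LINT x:\<Omega>|lborel. g x)"
proof -
  have AE: "AE x in lborel. indicator \<Omega> x *\<^sub>R f x = indicator \<Omega> x *\<^sub>R g x"
    using eq by (rule AE_mp) (auto intro!: AE_I2)
  note m = f[unfolded set_borel_measurable_def] borel_measurable_integrable[OF g[unfolded set_integrable_def]]
  show "set_integrable lborel \<Omega> f"
    using integrable_cong_AE[OF m AE] g unfolding set_integrable_def by blast
  show "(LINT x:\<Omega>|lborel. f x) = (LINT x:\<Omega>|lborel. g x)"
    unfolding set_lebesgue_integral_def by (rule integral_cong_AE[OF m AE])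
qed

text \<open>Measurability of the density is part of \<open>distributed\<close>, but for the
  \<open>ennreal\<close> valued version; \<open>enn2real\<close> undoes the embedding because
  \<open>q t\<close> is nonnegative on \<Omega>.\<close>

lemma q_borel: "0 \<le> t \<Longrightarrow> (\<lambda>y. indicator \<Omega> y * q t y) \<in> borel_measurable borel"
proof -
  assume t: "0 \<le> t"
  have "(\<lambda>y. ennreal (q t y) * indicator \<Omega> y) \<in> borel_measurable lborel"
    and nn: "\<And>y. y \<in> \<Omega> \<Longrightarrow> 0 \<le> q t y"
    using transport[OF t] unfolding pushforward_density_def distributed_def by auto
  then have "(\<lambda>y. enn2real (ennreal (q t y) * indicator \<Omega> y)) \<in> borel_measurable borel"
    by simp
  moreover have "enn2real (ennreal (q t y) * indicator \<Omega> y) = indicator \<Omega> y * q t y" for y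
    using nn by (cases "y \<in> \<Omega>") auto
  ultimately show ?thesis by simp
qed

lemma p_borel: "(\<lambda>y. indicator \<Omega> y * p y) \<in> borel_measurable borel"
proof -
  have "(\<lambda>y. indicator \<Omega> y * \<rho> y) \<in> borel_measurable borel"
    using borel_measurable_integrable[OF rho_integrable[unfolded set_integrable_def]] by simp
  then have "(\<lambda>y. (indicator \<Omega> y * \<rho> y) / (LINT y:\<Omega>|lborel. \<rho> y)) \<in> borel_measurable borel"
    by measurable
  then show ?thesis unfolding p_eq by simp
qed

lemma KL_borel:
  fixes f g :: "real ^ 'n::_ \<Rightarrow> real"
  assumes f: "(\<lambda>y. indicator \<Omega> y * f y) \<in> borel_measurable borel"
    and g: "(\<lambda>y. indicator \<Omega> y * g y) \<in> borel_measurable borel"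
  shows "set_borel_measurable lborel \<Omega> (\<lambda>x. f x * ln (f x / g x))"
proof -
  define f' g' where "f' y = indicator \<Omega> y * f y" and "g' y = indicator \<Omega> y * g y" for y
  have [measurable]: "f' \<in> borel_measurable borel" "g' \<in> borel_measurable borel"
    using f g unfolding f'_def g'_def .
  have "(\<lambda>x. f' x * ln (f' x / g' x)) \<in> borel_measurable borel"
    by measurable
  moreover have "f' x * ln (f' x / g' x) = indicator \<Omega> x *\<^sub>R (f x * ln (f x / g x))" for x
    unfolding f'_def g'_def by (cases "x \<in> \<Omega>") auto
  ultimately show ?thesis unfolding set_borel_measurable_def by simp
qed

lemma KL_q_p:
  assumes t: "0 \<le> t"
  shows "KL_finite \<Omega> (q t) p" "KL \<Omega> (q t) p = ln Z - W t"
proof -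
  let ?g = "\<lambda>x. ln Z * r t x - r t x * \<omega> t x"
  have i: "set_integrable lborel \<Omega> (\<lambda>x. ln Z * r t x)"
    using r_integrable[OF t] by simp
  have g: "set_integrable lborel \<Omega> ?g"
    using i r_omega_integrable[OF t] by (rule set_integral_diff)
  have "AE x in lborel. x \<in> \<Omega> \<longrightarrow> q t x * ln (q t x / p x) = ?g x"
    using q_eq_r[OF t]
  proof (rule AE_mp, intro AE_I2 impI)
    fix x assume *: "x \<in> \<Omega> \<longrightarrow> q t x = r t x" and x: "x \<in> \<Omega>"
    have "r t x / p x = Z * exp (- \<omega> t x)"
      using rho_pos[OF in_closure[OF x]] unfolding p_eq r_def Z_def by simp
    then have ln: "ln (r t x / p x) = ln Z - \<omega> t x"
      using Z_pos by (simp add: ln_mult)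
    have q: "q t x = r t x" using * x by blast
    show "q t x * ln (q t x / p x) = ?g x"
      unfolding q ln by (simp add: algebra_simps)
  qed
  note cong = set_integrable_integral_cong_AE[OF g KL_borel[OF q_borel[OF t] p_borel] this]
  show "KL_finite \<Omega> (q t) p" unfolding KL_finite_def by (rule cong(1))
  have "KL \<Omega> (q t) p = (LINT x:\<Omega>|lborel. ?g x)"
    unfolding KL_def by (rule cong(2))
  also have "\<dots> = ln Z - W t"
    using set_integral_diff(2)[OF i r_omega_integrable[OF t]] r_integral[OF t] W_eq[OF t] by simp
  finally show "KL \<Omega> (q t) p = ln Z - W t" .
qed

text \<open>The normalisation \<open>omega_mean\<close> replaces the \<rho>-weighted integral of
  \<open>\<omega> t\<close> by \<open>\<omega>bar t * Z\<close>, which gives the value.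
  Nonnegativity is Gibbs' inequality.\<close>

lemma KL_p_q:
  assumes t: "0 \<le> t"
  shows "KL_finite \<Omega> p (q t)" "KL \<Omega> p (q t) = \<omega>bar t - ln Z" "0 \<le> KL \<Omega> p (q t)"
proof -
  let ?g = "\<lambda>x. (\<rho> x * \<omega> t x - ln Z * \<rho> x) / Z"
  have i1: "set_integrable lborel \<Omega> (\<lambda>x. \<rho> x * \<omega> t x)"
    by (intro set_integrable_continuous continuous_intros rho_continuous omega_continuous t)
  have i2: "set_integrable lborel \<Omega> (\<lambda>x. c * \<rho> x)" for c
    using rho_integrable by simp
  have g: "set_integrable lborel \<Omega> ?g"
    using set_integral_diff(1)[OF i1 i2] by simp
  have "AE x in lborel. x \<in> \<Omega> \<longrightarrow> p x * ln (p x / q t x) = ?g x"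
    using q_eq_r[OF t]
  proof (rule AE_mp, intro AE_I2 impI)
    fix x assume *: "x \<in> \<Omega> \<longrightarrow> q t x = r t x" and x: "x \<in> \<Omega>"
    have "p x / r t x = exp (\<omega> t x) / Z"
      using rho_pos[OF in_closure[OF x]] unfolding p_eq r_def Z_def by (simp add: exp_minus field_simps)
    then have ln: "ln (p x / r t x) = \<omega> t x - ln Z"
      using Z_pos by (simp add: ln_div)
    have q: "q t x = r t x" using * x by blast
    show "p x * ln (p x / q t x) = ?g x"
      unfolding q ln unfolding p_eq Z_def[symmetric] by (simp add: algebra_simps diff_divide_distrib)
  qed
  note cong = set_integrable_integral_cong_AE[OF g KL_borel[OF p_borel q_borel[OF t]] this]
  show "KL_finite \<Omega> p (q t)" unfolding KL_finite_def by (rule cong(1))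
  have KL: "KL \<Omega> p (q t) = (LINT x:\<Omega>|lborel. ?g x)"
    unfolding KL_def by (rule cong(2))
  have "(LINT x:\<Omega>|lborel. \<rho> x * (\<omega> t x - \<omega>bar t)) = (LINT x:\<Omega>|lborel. \<rho> x * \<omega> t x - \<omega>bar t * \<rho> x)"
    by (simp add: algebra_simps)
  also have "\<dots> = (LINT x:\<Omega>|lborel. \<rho> x * \<omega> t x) - \<omega>bar t * Z"
    using set_integral_diff(2)[OF i1 i2] by (simp add: Z_def)
  finally have "(LINT x:\<Omega>|lborel. \<rho> x * \<omega> t x) = \<omega>bar t * Z"
    using omega_mean[OF t] by simp
  then have "(LINT x:\<Omega>|lborel. ?g x) = (\<omega>bar t * Z - ln Z * Z) / Z"
    using set_integral_diff(2)[OF i1 i2] by (simp add: Z_def)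
  also have "\<dots> = \<omega>bar t - ln Z"
    using Z_pos by (simp add: field_simps)
  finally show "KL \<Omega> p (q t) = \<omega>bar t - ln Z" using KL by simp
  \<comment> \<open>Pointwise, ln u is at most u - 1 with u the ratio of \<open>r t x\<close> to
    \<open>p x\<close>, equal to \<open>Z * exp (- \<omega> t x)\<close>. Weighted by
    \<open>p\<close>, the lower bound is \<open>p - r t\<close>, which integrates to 0 since both
    are probability densities.\<close>
  have "(LINT x:\<Omega>|lborel. p x - r t x) \<le> (LINT x:\<Omega>|lborel. ?g x)"
  proof (rule set_integral_mono[OF _ g])
    show "set_integrable lborel \<Omega> (\<lambda>x. p x - r t x)"
      using set_integral_diff(1)[OF i2[of "1 / Z"] r_integrable[OF t]] unfolding p_eq Z_def[symmetric] by simp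
    fix x assume x: "x \<in> \<Omega>"
    have "ln (Z * exp (- \<omega> t x)) \<le> Z * exp (- \<omega> t x) - 1"
      using Z_pos by (intro ln_le_minus_one) simp
    then have "1 - Z * exp (- \<omega> t x) \<le> \<omega> t x - ln Z"
      using Z_pos by (simp add: ln_mult)
    then have "\<rho> x / Z * (1 - Z * exp (- \<omega> t x)) \<le> \<rho> x / Z * (\<omega> t x - ln Z)"
      using rho_pos[OF in_closure[OF x]] Z_pos by (intro mult_left_mono) auto
    then show "p x - r t x \<le> ?g x"
      unfolding p_eq Z_def[symmetric] r_def using Z_pos by (simp add: field_simps)
  qed
  moreover have "(LINT x:\<Omega>|lborel. p x - r t x) = 0"
    using set_integral_diff(2)[OF i2[of "1 / Z"] r_integrable[OF t]] r_integral[OF t] Z_pos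
    unfolding p_eq Z_def[symmetric] by (simp add: Z_def[symmetric])
  ultimately show "0 \<le> KL \<Omega> p (q t)" using KL by simp
qed

text \<open>Differences of \<open>\<omega>\<close> along two trajectories decay like \<open>e\<^sup>-\<^sup>t\<close>, which makes the time dependence
  of the integrand of \<open>W\<close> explicit.\<close>

lemma omega_flow_eq:
  assumes t: "0 \<le> t" and x: "x \<in> \<Omega>" and y: "y \<in> \<Omega>"
  shows "\<omega> t (X t x) = \<omega> t (X t y) + exp (- t) * (\<omega>0 x - \<omega>0 y)"
proof -
  let ?f = "\<lambda>s. exp s * (\<omega> s (X s x) - \<omega> s (X s y))"
  have "(?f has_real_derivative 0) (at s within {0..})" if "s \<in> {0..}" for s
  proof -
    have s: "0 \<le> s" using that by simp
    show ?thesis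
      by (rule derivative_eq_intros omega_flow[OF s in_closure[OF x]] omega_flow[OF s in_closure[OF y]] refl)+
        (simp add: algebra_simps)
  qed
  then obtain c where c: "\<And>s. s \<in> {0..} \<Longrightarrow> ?f s = c"
    using has_field_derivative_zero_constant[of "{0..}" ?f] by auto
  have "?f t = ?f 0" using c[of t] c[of 0] t by simp
  also have "?f 0 = \<omega>0 x - \<omega>0 y"
    using X_0 omega_0 x y in_closure by simp
  finally show ?thesis
    by (simp add: exp_minus field_simps)
qed

section \<open>Time derivative, decay and dissipation of the entropy\<close>

text \<open>Integrating \<open>omega_flow_eq\<close> over \<open>x\<close> against
  \<open>q 0\<close>, with one reference point \<open>y\<close> fixed, gives \<open>W\<close> as
  \<open>\<omega>\<close> along the single trajectory of \<open>y\<close> plus a constant times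
  \<open>exp (- s)\<close>. Its derivative is then read off from the evolution equation.\<close>

lemma W_derivative:
  assumes t: "0 \<le> t"
  shows "(W has_real_derivative - (W t - \<omega>bar t)) (at t within {0..})"
proof -
  obtain y where y: "y \<in> \<Omega>" using nonempty by blast
  \<comment> \<open>The case \<open>t = 0\<close> of \<open>change_of_variables\<close>, where the
    flow is the identity.\<close>
  have i: "set_integrable lborel \<Omega> (\<lambda>x. q 0 x * \<omega>0 x)"
  proof -
    have "set_integrable lborel \<Omega> (\<lambda>x. q 0 x * \<omega> 0 (X 0 x))"
      by (rule change_of_variables(1)[OF _ r_omega_integrable]) auto
    moreover have "q 0 x * \<omega> 0 (X 0 x) = q 0 x * \<omega>0 x" if "x \<in> \<Omega>" for x
      using X_0 omega_0 that in_closure by simp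
    ultimately show ?thesis
      using set_integrable_cong[of lborel lborel \<Omega> \<Omega> "\<lambda>x. q 0 x * \<omega> 0 (X 0 x)" "\<lambda>x. q 0 x * \<omega>0 x"] by simp
  qed
  define I where "I = (LINT x:\<Omega>|lborel. q 0 x * \<omega>0 x)"
  have W: "W s = \<omega> s (X s y) + exp (- s) * (I - \<omega>0 y)" if s: "0 \<le> s" for s
  proof -
    have "W s = (LINT x:\<Omega>|lborel. (\<omega> s (X s y) - exp (- s) * \<omega>0 y) * q 0 x + exp (- s) * (q 0 x * \<omega>0 x))"
      unfolding W_def
      by (rule set_lebesgue_integral_cong) (auto simp: omega_flow_eq[OF s _ y] algebra_simps)
    also have "\<dots> = (\<omega> s (X s y) - exp (- s) * \<omega>0 y) * 1 + exp (- s) * I"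
      unfolding I_def q0_integral[symmetric]
      by (subst set_integral_add(2)) (use i q0_integrable in auto)
    finally show ?thesis by (simp add: algebra_simps)
  qed
  have "((\<lambda>s. \<omega> s (X s y) + exp (- s) * (I - \<omega>0 y)) has_real_derivative
     - (\<omega> t (X t y) - \<omega>bar t) + (- exp (- t)) * (I - \<omega>0 y)) (at t within {0..})"
    by (rule derivative_eq_intros omega_flow[OF t in_closure[OF y]] refl)+ simp
  then have "((\<lambda>s. \<omega> s (X s y) + exp (- s) * (I - \<omega>0 y)) has_real_derivative - (W t - \<omega>bar t)) (at t within {0..})"
    by (rule DERIV_cong) (simp add: W[OF t])
  then show ?thesis
    unfolding has_field_derivative_def by (rule has_derivative_transform[rotated 2]) (use t W in auto)
qed

text \<open>The derivative of \<open>ln Z - W\<close> is \<open>W t - \<omega>bar t\<close>.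
  Inserting \<open>ln Z\<close> with both signs splits it into minus the two entropies.\<close>

lemma KL_derivative:
  assumes t: "0 \<le> t"
  shows "((\<lambda>s. KL \<Omega> (q s) p) has_real_derivative (- KL \<Omega> (q t) p - KL \<Omega> p (q t))) (at t within {0..})"
proof -
  have "((\<lambda>s. ln Z - W s) has_real_derivative 0 - (- (W t - \<omega>bar t))) (at t within {0..})"
    by (intro derivative_intros W_derivative t)
  then have "((\<lambda>s. ln Z - W s) has_real_derivative (- KL \<Omega> (q t) p - KL \<Omega> p (q t))) (at t within {0..})"
    unfolding KL_q_p(2)[OF t] KL_p_q(2)[OF t] by simp
  then show ?thesis
    unfolding has_field_derivative_def by (rule has_derivative_transform[rotated 2]) (use t KL_q_p(2) in auto)
qed

text \<open>After multiplication by \<open>exp s\<close>, the entropy itself drops out of the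
  derivative, and what remains is \<open>- (exp s * KL \<Omega> p (q s))\<close>, which is
  nonpositive.\<close>

lemma KL_decay:
  assumes t: "0 \<le> t"
  shows "KL \<Omega> (q t) p \<le> exp (- t) * KL \<Omega> (q 0) p"
proof -
  let ?K = "\<lambda>s. KL \<Omega> (q s) p"
  have "exp 0 * ?K 0 \<ge> exp t * ?K t"
  proof (rule DERIV_nonpos_imp_decreasing_open[OF t])
    fix s assume s: "0 < s" "s < t"
    have "(?K has_real_derivative (- ?K s - KL \<Omega> p (q s))) (at s)"
      using DERIV_subset[OF KL_derivative, of s "{0<..}"] s at_within_open[of s "{0<..}"]
      by (auto simp: subset_eq)
    then have "((\<lambda>s. exp s * ?K s) has_real_derivative - (exp s * KL \<Omega> p (q s))) (at s)"
      by (auto intro!: derivative_eq_intros simp: algebra_simps)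
    moreover have "- (exp s * KL \<Omega> p (q s)) \<le> 0"
      using KL_p_q(3)[of s] s by simp
    ultimately show "\<exists>y. ((\<lambda>s. exp s * ?K s) has_real_derivative y) (at s) \<and> y \<le> 0" by blast
  next
    have "continuous_on {0..} ?K"
      using KL_derivative by (meson DERIV_continuous atLeast_iff continuous_on_eq_continuous_within)
    then have "continuous_on {0..t} ?K" by (rule continuous_on_subset) auto
    then show "continuous_on {0..t} (\<lambda>s. exp s * ?K s)" by (intro continuous_intros)
  qed
  then show ?thesis by (simp add: exp_minus field_simps)
qed

lemma KL_continuous: "continuous_on {0..} (\<lambda>s. KL \<Omega> (q s) p)"
  unfolding continuous_on_eq_continuous_within
proof
  fix t :: real assume "t \<in> {0..}"
  then show "continuous (at t within {0..}) (\<lambda>s. KL \<Omega> (q s) p)"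
    by (intro DERIV_continuous[OF KL_derivative]) simp
qed

text \<open>The dissipation is Borel as a pointwise limit of difference quotients of the continuous
  function \<open>t \<mapsto> KL(q\<^sub>t, p)\<close>.\<close>

lemma KL_sum_borel:
  "(\<lambda>t. indicator {0..T} t * (KL \<Omega> (q t) p + KL \<Omega> p (q t))) \<in> borel_measurable borel"
proof (rule borel_measurable_LIMSEQ_real)
  \<comment> \<open>Freezing the entropy at its initial value for negative times gives a continuous,
    hence Borel, function on the whole line. The increments \<open>h n\<close> are positive, so the
    quotients stay in the range of the derivative in \<open>{0..}\<close>, also at time 0 and beyond
    \<open>T\<close>.\<close>
  define k where "k t = KL \<Omega> (q (max 0 t)) p" for t
  define h where "h n = 1 / real (Suc n)" for n
  have h: "0 < h n" for n unfolding h_def by simp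
  have h0: "h \<longlonglongrightarrow> 0"
    unfolding h_def using LIMSEQ_inverse_real_of_nat by (simp add: inverse_eq_divide)
  have "continuous_on UNIV k"
    unfolding k_def by (rule continuous_on_compose2[OF KL_continuous]) (auto intro!: continuous_intros)
  then have [measurable]: "k \<in> borel_measurable borel"
    by (rule borel_measurable_continuous_onI)
  show "(\<lambda>t. indicator {0..T} t * ((k t - k (t + h n)) / h n)) \<in> borel_measurable borel" for n
    by measurable
  fix t :: real
  show "(\<lambda>n. indicator {0..T} t * ((k t - k (t + h n)) / h n)) \<longlonglongrightarrow>
      indicator {0..T} t * (KL \<Omega> (q t) p + KL \<Omega> p (q t))"
  proof (cases "t \<in> {0..T}")
    case True
    then have t: "0 \<le> t" by simp
    have "filterlim (\<lambda>n. t + h n) (at t within {0..}) sequentially"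
      unfolding filterlim_at
    proof
      show "\<forall>\<^sub>F n in sequentially. t + h n \<in> {0..} \<and> t + h n \<noteq> t"
        using h t by (intro always_eventually allI) (simp add: less_imp_neq[symmetric] add_nonneg_nonneg less_imp_le)
      show "(\<lambda>n. t + h n) \<longlonglongrightarrow> t" using tendsto_add[OF tendsto_const h0, of t] by simp
    qed
    from filterlim_compose[OF KL_derivative[OF t, unfolded has_field_derivative_iff] this]
    have "(\<lambda>n. (KL \<Omega> (q (t + h n)) p - KL \<Omega> (q t) p) / (t + h n - t))
        \<longlonglongrightarrow> - KL \<Omega> (q t) p - KL \<Omega> p (q t)" .
    from tendsto_minus[OF this]
    have "(\<lambda>n. - ((KL \<Omega> (q (t + h n)) p - KL \<Omega> (q t) p) / h n)) \<longlonglongrightarrow> KL \<Omega> (q t) p + KL \<Omega> p (q t)"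
      by (simp add: add.commute)
    moreover have "- ((KL \<Omega> (q (t + h n)) p - KL \<Omega> (q t) p) / h n) = (k t - k (t + h n)) / h n" for n
      using t h[of n] unfolding k_def by (simp add: max_def minus_divide_left)
    ultimately show ?thesis using True by simp
  qed simp
qed

text \<open>The fundamental theorem for the gauge integral does not ask for a continuous derivative.
  Absolute integrability is then obtained for the two summands separately:
  \<open>KL \<Omega> (q t) p\<close> is continuous in time, and \<open>KL \<Omega> p (q t)\<close>
  is a nonnegative difference of integrable functions. Borel measurability of the sum brings the
  result to \<open>lborel\<close>.\<close>

lemma KL_dissipation:
  assumes T: "0 < T"
  shows "set_integrable lborel {0..T} (\<lambda>t. KL \<Omega> (q t) p + KL \<Omega> p (q t))"
    and "(LINT t:{0..T}|lborel. KL \<Omega> (q t) p + KL \<Omega> p (q t)) = KL \<Omega> (q 0) p - KL \<Omega> (q T) p"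
proof -
  let ?K = "\<lambda>t. KL \<Omega> (q t) p" and ?P = "\<lambda>t. KL \<Omega> p (q t)"
  have "((\<lambda>t. ?K t + ?P t) has_integral (- ?K T - - ?K 0)) {0..T}"
  proof (rule fundamental_theorem_of_calculus)
    fix t assume "t \<in> {0..T}"
    then have "(?K has_real_derivative (- ?K t - ?P t)) (at t within {0..T})"
      by (intro DERIV_subset[OF KL_derivative]) auto
    then have "((\<lambda>t. - ?K t) has_real_derivative - (- ?K t - ?P t)) (at t within {0..T})"
      by (rule DERIV_minus)
    then show "((\<lambda>t. - ?K t) has_vector_derivative ?K t + ?P t) (at t within {0..T})"
      by (simp add: has_real_derivative_iff_has_vector_derivative add.commute)
  qed (use T in simp)
  then have int: "((\<lambda>t. ?K t + ?P t) has_integral (?K 0 - ?K T)) {0..T}" by simp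
  have contK: "continuous_on {0..T} ?K"
    by (rule continuous_on_subset[OF KL_continuous]) auto
  then have K: "?K absolutely_integrable_on {0..T}"
    by (rule absolutely_integrable_continuous_real)
  have "(\<lambda>t. (?K t + ?P t) - ?K t) integrable_on {0..T}"
    by (rule integrable_diff[OF has_integral_integrable[OF int] integrable_continuous_interval[OF contK]])
  then have "?P absolutely_integrable_on {0..T}"
    by (intro nonnegative_absolutely_integrable_1) (auto simp: KL_p_q(3))
  with K have "(\<lambda>t. ?K t + ?P t) absolutely_integrable_on {0..T}"
    by (rule set_integral_add(1))
  then show fin: "set_integrable lborel {0..T} (\<lambda>t. ?K t + ?P t)"
    using KL_sum_borel[of T] unfolding set_integrable_def by (simp add: integrable_completion)
  show "(LINT t:{0..T}|lborel. ?K t + ?P t) = ?K 0 - ?K T"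
    unfolding set_borel_integral_eq_integral(2)[OF fin] by (rule integral_unique[OF int])
qed

end

theorem theorem4p3:
  fixes \<Omega> :: "(real ^ 'n::{finite,wellorder}) set"
    and \<rho> p \<omega>0 :: "real ^ 'n::_ \<Rightarrow> real"
    and q \<omega> \<phi> :: "real \<Rightarrow> real ^ 'n::_ \<Rightarrow> real"
    and \<omega>bar :: "real \<Rightarrow> real"
    and X :: "real \<Rightarrow> real ^ 'n::_ \<Rightarrow> real ^ 'n::_"
  assumes domain: "smooth_bounded_domain \<Omega>"
    and rho_smooth: "smooth_closure \<Omega> \<rho>"
    and rho_pos: "\<And>x. x \<in> closure \<Omega> \<Longrightarrow> 0 < \<rho> x"
    and p_eq: "\<And>x. p x = \<rho> x / (LINT y:\<Omega>|lborel. \<rho> y)"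
    and q0_density: "pos_prob_density_on \<Omega> (q 0)"
    and omega0_eq: "\<And>x. x \<in> \<Omega> \<Longrightarrow> \<omega>0 x = ln (\<rho> x) - ln (q 0 x)"
    and omega0_Lipschitz: "\<omega>0 \<in> hoelder_space 0 1 \<Omega>"
    and solution: "wlf_system \<Omega> \<rho> \<omega>0 \<omega> \<phi> \<omega>bar X"
    and regular: "wlf_regular \<Omega> \<omega> \<phi>"
    and transport: "\<And>t. 0 \<le> t \<Longrightarrow> pushforward_density \<Omega> (X t) (q 0) (q t)"
  shows "(\<forall>t\<ge>0. KL_finite \<Omega> (q t) p \<and> KL_finite \<Omega> p (q t)) \<and>
    (\<forall>t\<ge>0. ((\<lambda>s. KL \<Omega> (q s) p) has_real_derivative (- KL \<Omega> (q t) p - KL \<Omega> p (q t)))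
              (at t within {0..})) \<and>
    (\<forall>t\<ge>0. KL \<Omega> (q t) p \<le> exp (- t) * KL \<Omega> (q 0) p) \<and>
    (\<forall>T>0. set_integrable lborel {0..T} (\<lambda>t. KL \<Omega> (q t) p + KL \<Omega> p (q t)) \<and>
       (LINT t:{0..T}|lborel. KL \<Omega> (q t) p + KL \<Omega> p (q t)) = KL \<Omega> (q 0) p - KL \<Omega> (q T) p)"
proof -
  interpret wlf_solution \<Omega> \<rho> p \<omega>0 q \<omega> \<phi> \<omega>bar X
    by unfold_locales (fact assms)+
  show ?thesis
    using KL_q_p(1) KL_p_q(1) KL_derivative KL_decay KL_dissipation by blast
qed

end
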